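(* Let $M$ and $N$ be $C^\infty$ manifolds (possibly with boundary) and $k\in\mathbb{N}\cup\{0\}$. The subsets $\mathrm{Sub}^{k,1}(M,N)$ and $\mathrm{Imm}^{k,1}(M,N)$ of $C^{k,1}(M,N)$ are open (in the strong topology).
   Context: Let $m=\dim M$, $n=\dim N$. Charts of $M$ are smooth maps $\varphi:U\to M$ with $U$ open in $\mathbb{H}^m:=\{x\in\mathbb{R}^m:x_1\ge0\}$, and similarly for $N$. $C^{k,1}(M,N)$ is the set of $C^k$ maps $M\to N$ whose $k$-th order derivative is locally Lipschitz with respect to any pair of charts. The Clarke derivative $Df(x)$ of a locally Lipschitz $f:U\to\mathbb{R}^n$ ($U\subset\mathbb{H}^m$ open) is the convex hull of all matrices $\lim_i Df(x_i)$ with $x_i\to x$ points of differentiability of $f$. Strong topology on $C^{k,1}(M,N)$: for compact $K\subset\mathbb{H}^m$ let $\|f\|^{k,1}_K$ be the supremum of $|D^jf(x)|_{j,\mathrm{op}}$ ($x\in K$, $0\le j\le k$) and of $|D^kf(y)-D^kf(x)|_{k,\mathrm{op}}/|x-y|$ ($x\neq y\in K$), with multilinear operator norms. Given $f\in C^{k,1}(M,N)$, charts $\varphi:U\to M$, $\psi:V\to N$, compact $K\subset U$ with $f\circ\varphi(K)\subset\psi(V)$ and $\epsilon\in(0,\infty]$, the elementary neighbourhood $\mathcal{N}^{k,1}(f;K,(U,\varphi),(V,\psi),\epsilon)$ is the set of $h\in C^{k,1}(M,N)$ (with $h\circ\varphi(K)\subset\psi(V)$) such that $\|\psi^{-1}\circ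 h\circ\varphi-\psi^{-1}\circ f\circ\varphi\|^{k,1}_K<\epsilon$. The strong topology has as basis all sets $\bigcap_{i\in I}\mathcal{N}^{k,1}(f;K_i,(U_i,\varphi_i),(V_i,\psi_i),\epsilon_i)$ with $f\in C^{k,1}(M,N)$ and the family $\{K_i\}_{i\in I}$ (i.e. the images $\varphi_i(K_i)$ in $M$) locally finite. Let $\sigma_j(A)$ be the $j$-th largest singular value of $A$. $\mathrm{Sub}^{k,1}(M,N)$ (respectively $\mathrm{Imm}^{k,1}(M,N)$) is the set of $f\in C^{k,1}(M,N)$ such that for any charts $(U,\varphi)$ of $M$ and $(V,\psi)$ of $N$ with $f\circ\varphi(U)\subset\psi(V)$ one has $\inf_{A\in D(\psi^{-1}\circ f\circ\varphi)(x)}\sigma_n(A)>0$ (respectively $\inf_{A\in D(\psi^{-1}\circ f\circ\varphi)(x)}\sigma_m(A)>0$) for all $x\in U$, where $D$ is the Clarke derivative. *)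

theory Defs
  imports "HOL-Analysis.Analysis" "HOL-Library.Multiset"
begin

section \<open>Calculus on relatively open subsets of the half space\<close>

text \<open>The first coordinate is the one with the least index; the coordinate type is any nonempty
  finite linear order, so the dimension is an arbitrary number that is at least 1.\<close>

definition half_space :: "(real ^ 'm::{finite,linorder}) set" where
  "half_space = {x. 0 \<le> x $ Min UNIV}"

text \<open>\<open>nderiv f [v\<^sub>1, \<dots>, v\<^sub>j] x\<close> is \<open>D\<^sup>j f(x)(v\<^sub>1, \<dots>, v\<^sub>j)\<close>.
  Derivatives are one-sided at boundary points. Only the germ of \<open>f\<close> at \<open>x\<close> in the half space
  matters, so for \<open>x\<close> in a relatively open domain the values of \<open>f\<close> outside it are irrelevant.\<close>

primrec nderiv ::
  "(real ^ 'm::{finite,linorder} \<Rightarrow> real ^ 'n) \<Rightarrow> (real ^ 'm::{finite,linorder}) list \<Rightarrow>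
   real ^ 'm::{finite,linorder} \<Rightarrow> real ^ 'n" where
  "nderiv f [] = f"
| "nderiv f (v # vs) = (\<lambda>x. frechet_derivative (nderiv f vs) (at x within half_space) v)"

text \<open>Differentiability and continuity of the multilinear-map-valued derivatives are stated after
  evaluation at fixed directions.\<close>

definition Ck_on ::
  "nat \<Rightarrow> (real ^ 'm::{finite,linorder}) set \<Rightarrow> (real ^ 'm::{finite,linorder} \<Rightarrow> real ^ 'n) \<Rightarrow> bool" where
  "Ck_on k W f \<longleftrightarrow>
     (\<forall>vs. length vs < k \<longrightarrow> (\<forall>x\<in>W. nderiv f vs differentiable (at x within half_space))) \<and>
     (\<forall>vs. length vs \<le> k \<longrightarrow> continuous_on W (nderiv f vs))"

definition smooth_on ::
  "(real ^ 'm::{finite,linorder}) set \<Rightarrow> (real ^ 'm::{finite,linorder} \<Rightarrow> real ^ 'n) \<Rightarrow> bool" where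
  "smooth_on W f \<longleftrightarrow> (\<forall>k. Ck_on k W f)"

definition multi_onorm :: "nat \<Rightarrow> ((real ^ 'm) list \<Rightarrow> real ^ 'n) \<Rightarrow> real" where
  "multi_onorm j T = (SUP vs\<in>{vs. length vs = j \<and> (\<forall>v\<in>set vs. norm v \<le> 1)}. norm (T vs))"

definition Ck1_on ::
  "nat \<Rightarrow> (real ^ 'm::{finite,linorder}) set \<Rightarrow> (real ^ 'm::{finite,linorder} \<Rightarrow> real ^ 'n) \<Rightarrow> bool" where
  "Ck1_on k W f \<longleftrightarrow> Ck_on k W f \<and>
     (\<forall>x\<in>W. \<exists>d>0. \<exists>L. \<forall>y\<in>W \<inter> ball x d. \<forall>z\<in>W \<inter> ball x d.
        multi_onorm k (\<lambda>vs. nderiv f vs y - nderiv f vs z) \<le> L * dist y z)"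

definition Ck1_norm ::
  "nat \<Rightarrow> (real ^ 'm::{finite,linorder}) set \<Rightarrow> (real ^ 'm::{finite,linorder} \<Rightarrow> real ^ 'n) \<Rightarrow> ereal" where
  "Ck1_norm k K f = sup
     (SUP j\<in>{..k}. SUP x\<in>K. ereal (multi_onorm j (\<lambda>vs. nderiv f vs x)))
     (SUP (x, y)\<in>{(x, y). x \<in> K \<and> y \<in> K \<and> x \<noteq> y}.
        ereal (multi_onorm k (\<lambda>vs. nderiv f vs y - nderiv f vs x) / norm (x - y)))"

definition clarke_derivative ::
  "(real ^ 'm) set \<Rightarrow> (real ^ 'm \<Rightarrow> real ^ 'n) \<Rightarrow> real ^ 'm \<Rightarrow> (real ^ 'm ^ 'n) set" where
  "clarke_derivative U f x = convex hull
     {A. \<exists>X. (\<forall>i::nat. X i \<in> U \<and> f differentiable (at (X i) within U)) \<and> X \<longlonglongrightarrow> x \<and>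
             (\<lambda>i. jacobian f (at (X i) within U)) \<longlonglongrightarrow> A}"

section \<open>Singular values\<close>

definition singular_mult :: "real ^ 'm ^ 'n \<Rightarrow> real \<Rightarrow> nat" where
  "singular_mult A s = dim {v. (transpose A ** A) *v v = s\<^sup>2 *\<^sub>R v}"

definition singular_values :: "real ^ 'm ^ 'n \<Rightarrow> real multiset" where
  "singular_values A =
     (\<Sum>s\<in>{s. 0 \<le> s \<and> 0 < singular_mult A s}. replicate_mset (singular_mult A s) s)"

text \<open>The index \<open>j\<close> counts from 1. The multiset above has one element per column of \<open>A\<close>, so if
  \<open>A\<close> has fewer rows than columns it contains additional zeros; beyond the number of columns
  \<open>\<sigma>\<^sub>j(A) = 0\<close> by convention.\<close>

definition singular_value :: "nat \<Rightarrow> real ^ 'm ^ 'n \<Rightarrow> real" where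
  "singular_value j A =
     (let ss = rev (sorted_list_of_multiset (singular_values A))
      in if 1 \<le> j \<and> j \<le> length ss then ss ! (j - 1) else 0)"

section \<open>Smooth manifolds with boundary\<close>

text \<open>A chart is a parametrisation \<open>\<phi> : U \<rightarrow> M\<close>, given together with its domain; the values of
  \<open>\<phi>\<close> outside \<open>U\<close> are irrelevant, and \<open>inv_into U \<phi>\<close> is the coordinate map \<open>\<phi>\<^sup>-\<^sup>1\<close>.\<close>

type_synonym ('m, 'a) chart = "(real, 'm) vec set \<times> ((real, 'm) vec \<Rightarrow> 'a)"

definition topological_chart :: "'a topology \<Rightarrow> ('m::{finite,linorder}, 'a) chart \<Rightarrow> bool" where
  "topological_chart M = (\<lambda>(U, \<phi>).
     openin (top_of_set half_space) U \<and> openin M (\<phi> ` U) \<and>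
     homeomorphic_map (top_of_set U) (subtopology M (\<phi> ` U)) \<phi>)"

definition smoothly_compatible ::
  "('m::{finite,linorder}, 'a) chart \<Rightarrow> ('m, 'a) chart \<Rightarrow> bool" where
  "smoothly_compatible = (\<lambda>(U, \<phi>) (V, \<psi>).
     smooth_on {x\<in>U. \<phi> x \<in> \<psi> ` V} (inv_into V \<psi> \<circ> \<phi>) \<and>
     smooth_on {y\<in>V. \<psi> y \<in> \<phi> ` U} (inv_into U \<phi> \<circ> \<psi>))"

text \<open>\<open>A\<close> is the maximal atlas, that is, the set of all charts of the manifold.\<close>

definition smooth_manifold :: "'a topology \<Rightarrow> ('m::{finite,linorder}, 'a) chart set \<Rightarrow> bool" where
  "smooth_manifold M A \<longleftrightarrow>
     Hausdorff_space M \<and> second_countable M \<and>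
     (\<forall>c\<in>A. topological_chart M c) \<and>
     (\<Union>(U, \<phi>)\<in>A. \<phi> ` U) = topspace M \<and>
     (\<forall>c\<in>A. \<forall>d\<in>A. smoothly_compatible c d) \<and>
     (\<forall>c. topological_chart M c \<and> (\<forall>d\<in>A. smoothly_compatible c d) \<longrightarrow> c \<in> A)"

section \<open>Maps of class \<open>C\<^sup>k\<^sup>,\<^sup>1\<close> and the strong topology\<close>

definition Ck1_maps ::
  "nat \<Rightarrow> 'a topology \<Rightarrow> ('m::{finite,linorder}, 'a) chart set \<Rightarrow>
   'b topology \<Rightarrow> ('n::{finite,linorder}, 'b) chart set \<Rightarrow> ('a \<Rightarrow> 'b) set" where
  "Ck1_maps k M A N B = {f \<in> topspace M \<rightarrow>\<^sub>E topspace N. continuous_map M N f \<and>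
     (\<forall>(U, \<phi>)\<in>A. \<forall>(V, \<psi>)\<in>B.
        Ck1_on k {x\<in>U. f (\<phi> x) \<in> \<psi> ` V} (inv_into V \<psi> \<circ> f \<circ> \<phi>))}"

type_synonym ('m, 'a, 'n, 'b) nbhd_data =
  "(real, 'm) vec set \<times> ('m, 'a) chart \<times> ('n, 'b) chart \<times> ereal"

definition admissible ::
  "('m::{finite,linorder}, 'a) chart set \<Rightarrow> ('n::{finite,linorder}, 'b) chart set \<Rightarrow>
   ('a \<Rightarrow> 'b) \<Rightarrow> ('m, 'a, 'n, 'b) nbhd_data \<Rightarrow> bool" where
  "admissible A B f = (\<lambda>(K, (U, \<phi>), (V, \<psi>), \<epsilon>).
     (U, \<phi>) \<in> A \<and> (V, \<psi>) \<in> B \<and> compact K \<and> K \<subseteq> U \<and> (f \<circ> \<phi>) ` K \<subseteq> \<psi> ` V \<and> 0 < \<epsilon>)"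

definition elementary_nbhd ::
  "nat \<Rightarrow> 'a topology \<Rightarrow> ('m::{finite,linorder}, 'a) chart set \<Rightarrow>
   'b topology \<Rightarrow> ('n::{finite,linorder}, 'b) chart set \<Rightarrow>
   ('a \<Rightarrow> 'b) \<Rightarrow> ('m, 'a, 'n, 'b) nbhd_data \<Rightarrow> ('a \<Rightarrow> 'b) set" where
  "elementary_nbhd k M A N B f = (\<lambda>(K, (U, \<phi>), (V, \<psi>), \<epsilon>).
     {h \<in> Ck1_maps k M A N B. (h \<circ> \<phi>) ` K \<subseteq> \<psi> ` V \<and>
        Ck1_norm k K (\<lambda>x. (inv_into V \<psi> \<circ> h \<circ> \<phi>) x - (inv_into V \<psi> \<circ> f \<circ> \<phi>) x) < \<epsilon>})"

definition locally_finite_data ::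
  "'a topology \<Rightarrow> ('m, 'a, 'n, 'b) nbhd_data set \<Rightarrow> bool" where
  "locally_finite_data M I \<longleftrightarrow>
     (\<forall>p\<in>topspace M. \<exists>W. openin M W \<and> p \<in> W \<and>
        finite {i \<in> I. case i of (K, (U, \<phi>), _) \<Rightarrow> \<phi> ` K \<inter> W \<noteq> {}})"

text \<open>Families of data are represented by their ranges: repeating an index does not change the
  intersection, and the range of a locally finite family is locally finite. For the empty family
  the intersection is the whole space of maps.\<close>

definition strong_basis ::
  "nat \<Rightarrow> 'a topology \<Rightarrow> ('m::{finite,linorder}, 'a) chart set \<Rightarrow>
   'b topology \<Rightarrow> ('n::{finite,linorder}, 'b) chart set \<Rightarrow> ('a \<Rightarrow> 'b) set set" where
  "strong_basis k M A N B =
     {Ck1_maps k M A N B \<inter> (\<Inter>i\<in>I. elementary_nbhd k M A N B f i) | f I.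
        f \<in> Ck1_maps k M A N B \<and> (\<forall>i\<in>I. admissible A B f i) \<and> locally_finite_data M I}"

definition strong_topology ::
  "nat \<Rightarrow> 'a topology \<Rightarrow> ('m::{finite,linorder}, 'a) chart set \<Rightarrow>
   'b topology \<Rightarrow> ('n::{finite,linorder}, 'b) chart set \<Rightarrow> ('a \<Rightarrow> 'b) topology" where
  "strong_topology k M A N B = topology_generated_by (strong_basis k M A N B)"

lemma topspace_strong_topology: "topspace (strong_topology k M A N B) = Ck1_maps k M A N B"
proof -
  have "Ck1_maps k M A N B \<in> strong_basis k M A N B" if "f \<in> Ck1_maps k M A N B" for f
  proof -
    have "locally_finite_data M {}"
      unfolding locally_finite_data_def by auto
    then show ?thesis
      using that unfolding strong_basis_def
      by (intro CollectI exI[of _ f] exI[of _ "{}"]) simp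
  qed
  moreover have "S \<subseteq> Ck1_maps k M A N B" if "S \<in> strong_basis k M A N B" for S
    using that unfolding strong_basis_def by blast
  ultimately show ?thesis
    unfolding strong_topology_def topology_generated_by_topspace by blast
qed

section \<open>Submersions and immersions\<close>

definition Sub_maps ::
  "nat \<Rightarrow> 'a topology \<Rightarrow> ('m::{finite,linorder}, 'a) chart set \<Rightarrow>
   'b topology \<Rightarrow> ('n::{finite,linorder}, 'b) chart set \<Rightarrow> ('a \<Rightarrow> 'b) set" where
  "Sub_maps k M A N B = {f \<in> Ck1_maps k M A N B.
     \<forall>(U, \<phi>)\<in>A. \<forall>(V, \<psi>)\<in>B. (f \<circ> \<phi>) ` U \<subseteq> \<psi> ` V \<longrightarrow>
       (\<forall>x\<in>U. 0 < (INF D\<in>clarke_derivative U (inv_into V \<psi> \<circ> f \<circ> \<phi>) x.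
                      ereal (singular_value CARD('n) D)))}"

definition Imm_maps ::
  "nat \<Rightarrow> 'a topology \<Rightarrow> ('m::{finite,linorder}, 'a) chart set \<Rightarrow>
   'b topology \<Rightarrow> ('n::{finite,linorder}, 'b) chart set \<Rightarrow> ('a \<Rightarrow> 'b) set" where
  "Imm_maps k M A N B = {f \<in> Ck1_maps k M A N B.
     \<forall>(U, \<phi>)\<in>A. \<forall>(V, \<psi>)\<in>B. (f \<circ> \<phi>) ` U \<subseteq> \<psi> ` V \<longrightarrow>
       (\<forall>x\<in>U. 0 < (INF D\<in>clarke_derivative U (inv_into V \<psi> \<circ> f \<circ> \<phi>) x.
                      ereal (singular_value CARD('m) D)))}"

end

theory Submission
  imports Defs
begin

text \<open>A bound \<open>\<sigma>\<^sub>m(D) \<ge> c\<close> on the Clarke derivative says that for every unit vector \<open>v\<close> the convex set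
  of all \<open>D v\<close> avoids the open ball of radius \<open>c\<close>; separation yields a unit vector \<open>w\<close> with
  \<open>w \<bullet> D v \<ge> c\<close> for all \<open>D\<close>. Dually, \<open>\<sigma>\<^sub>n(D) \<ge> c\<close> gives a \<open>v\<close> for every \<open>w\<close>. By Rademacher's theorem
  and a mean value inequality, this is equivalent, up to the constant, to a lower bound
  \<open>w \<bullet> (f (y + t v) - f y) \<ge> c t\<close> for difference quotients near the point. In this form the condition
  is visibly stable under perturbations with a small Lipschitz constant, also if the points of
  differentiability change. A bilinear bound \<open>w \<bullet> D v \<ge> c\<close> passes to convex hulls and through changes
  of charts, where \<open>D\<close> becomes \<open>P D Q\<close>. Finally, a manifold has a locally finite cover by
  coordinate half balls on which these estimates hold.\<close>

section \<open>Differentiation of monotone functions on the line\<close>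

text \<open>The case \<open>k = 0\<close> shapes the argument: closeness of \<open>h\<close> to
  \<open>f\<close> then controls only values and difference quotients, the points of
  differentiability of the two maps may differ, and their Clarke derivatives cannot be compared
  matrix by matrix. Convexity of the Clarke derivative is what allows one set \<open>R\<close> of
  direction pairs to serve all its matrices at once; chosen at the centre of a half ball, the same
  \<open>R\<close> then serves all points of that half ball and all maps near \<open>f\<close>. Two
  more obstacles: a segment can lie in the null set about which Rademacher's theorem says nothing,
  for instance in the boundary hyperplane, so the mean value inequality is obtained by averaging
  over parallel segments and reaches boundary points as limits. And a neighbourhood constrains
  \<open>h\<close> only in the chosen charts, whereas the conclusion concerns every pair of charts;
  hence only the existence of a positive bound at each point is transported, by the Jacobians of the
  transition maps, and no constant has to be uniform on \<open>M\<close>.\<close>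

lemma Vitali_covering_intervals:
  fixes S T :: "real set"
  assumes "open T" "S \<subseteq> T"
    and P: "\<And>x d. x \<in> S \<Longrightarrow> 0 < d \<Longrightarrow> \<exists>h. 0 < \<bar>h\<bar> \<and> \<bar>h\<bar> < d \<and> P (min x (x + h)) (max x (x + h))"
  obtains C where "countable C" "\<And>a b. (a, b) \<in> C \<Longrightarrow> a < b \<and> P a b \<and> {a..b} \<subseteq> T"
    "disjoint_family_on (\<lambda>(a, b). {a..b}) C" "negligible (S - (\<Union>(a, b)\<in>C. {a..b}))"
proof -
  define K where "K = {(a, b). a < b \<and> P a b \<and> {a..b} \<subseteq> T}"
  \<comment> \<open>Intervals are the closed balls of the line, with midpoint \<open>c\<close> and
    radius \<open>r\<close>; the point \<open>x\<close> is an endpoint of its interval, on the side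
    given by the sign of \<open>h\<close>.\<close>
  define c where "c = (\<lambda>(a, b). (a + b) / 2 :: real)"
  define r where "r = (\<lambda>(a, b). (b - a) / 2 :: real)"
  have cb: "cball (c i) (r i) = (case i of (a, b) \<Rightarrow> {a..b})" for i
    by (cases i) (auto simp: c_def r_def cball_eq_atLeastAtMost field_simps)
  have r: "0 < r i" if "i \<in> K" for i
    using that by (auto simp: K_def r_def)
  have cov: "\<exists>i. i \<in> K \<and> x \<in> cball (c i) (r i) \<and> r i < d" if x: "x \<in> S" and "0 < d" for x d
  proof -
    obtain e where e: "e > 0" "cball x e \<subseteq> T"
      using x assms open_contains_cball by blast
    obtain h where h: "0 < \<bar>h\<bar>" "\<bar>h\<bar> < min d e" "P (min x (x + h)) (max x (x + h))"
      using P[OF x, of "min d e"] e \<open>0 < d\<close> by auto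
    have "{min x (x + h)..max x (x + h)} \<subseteq> cball x e"
      using h by (auto simp: dist_real_def)
    then have "(min x (x + h), max x (x + h)) \<in> K"
      using h e by (auto simp: K_def)
    moreover have "x \<in> cball (c (min x (x + h), max x (x + h))) (r (min x (x + h), max x (x + h)))"
      unfolding cb by auto
    moreover have "r (min x (x + h), max x (x + h)) < d"
      using h by (auto simp: r_def)
    ultimately show ?thesis by blast
  qed
  obtain C where C: "countable C" "C \<subseteq> K"
     "pairwise (\<lambda>i j. disjnt (cball (c i) (r i)) (cball (c j) (r j))) C"
     "negligible (S - (\<Union>i\<in>C. cball (c i) (r i)))"
    by (rule Vitali_covering_theorem_cballs[of K r S c, OF r cov])
  show thesis
  proof
    show "disjoint_family_on (\<lambda>(a, b). {a..b}) C"
      using C(3) by (auto simp: disjoint_family_on_def pairwise_def disjnt_def cb)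
    show "negligible (S - (\<Union>(a, b)\<in>C. {a..b}))"
      using C(4) by (simp add: cb)
  qed (use C in \<open>auto simp: K_def\<close>)
qed

text \<open>Slopes above \<open>q\<close> occur at arbitrarily small steps of either sign, so the
  upper derivate in direction \<open>v\<close> is at least \<open>q\<close>. Applied to
  \<open>- f\<close> and \<open>- p\<close> it says that the lower derivate is at most
  \<open>p\<close>; a point in both sets with \<open>p < q\<close> is one where the slopes have no
  limit.\<close>

definition steep_points :: "('a::real_normed_vector \<Rightarrow> real) \<Rightarrow> 'a \<Rightarrow> real \<Rightarrow> 'a set" where
  "steep_points f v q =
     {x. \<forall>d>0. \<exists>h. 0 < \<bar>h\<bar> \<and> \<bar>h\<bar> < d \<and> q < (f (x + h *\<^sub>R v) - f x) / h}"

lemma steep_pointsE: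
  assumes "x \<in> steep_points f v q" "0 < d"
  obtains h where "0 < \<bar>h\<bar>" "\<bar>h\<bar> < d" "q < (f (x + h *\<^sub>R v) - f x) / h"
  using assms unfolding steep_points_def by blast

text \<open>For a fixed scale \<open>d\<close> the union over all steps \<open>h\<close> is open by
  continuity, so only the scales have to be made countable.\<close>

lemma borel_steep_points:
  assumes f: "continuous_on UNIV f"
  shows "steep_points f v q \<in> sets borel"
proof -
  define G where "G d = (\<Union>h\<in>{h. 0 < \<bar>h\<bar> \<and> \<bar>h\<bar> < d}. {x. q < (f (x + h *\<^sub>R v) - f x) / h})" for d
  have "steep_points f v q = (\<Inter>n::nat. G (1 / Suc n))"
  proof (intro set_eqI iffI)
    fix x assume x: "x \<in> (\<Inter>n::nat. G (1 / Suc n))"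
    show "x \<in> steep_points f v q"
      unfolding steep_points_def
    proof (intro CollectI allI impI)
      fix d :: real assume "0 < d"
      then obtain n where "1 / Suc n < d"
        using nat_approx_posE by blast
      moreover have "x \<in> G (1 / Suc n)"
        using x by blast
      ultimately show "\<exists>h. 0 < \<bar>h\<bar> \<and> \<bar>h\<bar> < d \<and> q < (f (x + h *\<^sub>R v) - f x) / h"
        unfolding G_def by force
    qed
  qed (auto simp: steep_points_def G_def)
  moreover have "open (G d)" for d
    unfolding G_def
    by (intro open_UN ballI open_Collect_less continuous_intros continuous_on_compose2[OF f]) auto
  ultimately show ?thesis
    by simp
qed

text \<open>The Stieltjes measure of \<open>F\<close> turns sums of increments into measures, so
  nested families of intervals compare by monotonicity of the measure. Continuity of
  \<open>F\<close> makes the endpoints weightless; the identity for \<open>F\<close> gives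
  lengths.\<close>

lemma emeasure_interval_family:
  fixes F :: "real \<Rightarrow> real"
  assumes F: "mono F" "continuous_on UNIV F"
    and C: "countable C" "disjoint_family_on (\<lambda>(a, b). {a..b}) C" "\<And>a b. (a, b) \<in> C \<Longrightarrow> a \<le> b"
  shows "emeasure (interval_measure F) (\<Union>(a, b)\<in>C. {a..b})
       = (\<integral>\<^sup>+i. ennreal (F (snd i) - F (fst i)) \<partial>count_space C)"
proof -
  have "emeasure (interval_measure F) (\<Union>(a, b)\<in>C. {a..b})
      = (\<integral>\<^sup>+i. emeasure (interval_measure F) (case i of (a, b) \<Rightarrow> {a..b}) \<partial>count_space C)"
    using C by (intro emeasure_UN_countable) auto
  also have "\<dots> = (\<integral>\<^sup>+i. ennreal (F (snd i) - F (fst i)) \<partial>count_space C)"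
    using C(3) F
    by (intro nn_integral_cong) (auto simp: monoD split!: prod.splits intro!: emeasure_interval_measure_Icc)
  finally show ?thesis .
qed

text \<open>Vitali's argument: cover \<open>S\<close> by disjoint intervals over which
  \<open>F\<close> grows at rate at most \<open>p\<close>, then cover the part of \<open>S\<close>
  in their interiors by disjoint subintervals over which \<open>F\<close> grows at rate at least
  \<open>q\<close>. As \<open>F\<close> is monotone, the increments over the inner intervals add up
  to at most those over the outer ones, so \<open>q\<close> times the measure of \<open>S\<close> is
  at most \<open>p\<close> times it, up to \<open>e\<close>.\<close>

lemma null_sets_slope_gap_mono:
  fixes F :: "real \<Rightarrow> real"
  assumes F: "mono F" "continuous_on UNIV F" and "p < q"
  shows "steep_points F 1 q \<inter> steep_points (\<lambda>x. - F x) 1 (- p) \<in> null_sets lborel" (is "?E \<in> _")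
proof -
  have E[measurable]: "?E \<in> sets borel"
    by (intro sets.Int borel_steep_points continuous_intros F)
  let ?\<mu> = "interval_measure F"
  have main: "measure lebesgue (?E \<inter> ball 0 R) = 0" for R
  proof (cases "?E = {}")
    case False
    define S where "S = ?E \<inter> ball 0 R"
    have S: "S \<in> lmeasurable"
      unfolding S_def by (intro bounded_set_imp_lmeasurable) (use E in auto)
    have slope: "0 \<le> (F (x + h) - F x) / h" if "0 < \<bar>h\<bar>" for x h
      using that monoD[OF F(1), of x "x + h"] monoD[OF F(1), of "x + h" x]
      by (auto simp: zero_le_divide_iff abs_if split: if_splits)
    \<comment> \<open>Slopes of a monotone function are nonnegative, so a single point with a slope
      below \<open>p\<close> forces \<open>0 < p\<close>.\<close>
    obtain x where "x \<in> ?E" using False by blast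
    then obtain h where "0 < \<bar>h\<bar>" "- p < (- F (x + h *\<^sub>R 1) - - F x) / h"
      using steep_pointsE[of x "\<lambda>x. - F x" 1 "- p" 1] by auto
    then have "0 < p" using slope[of h x] by (auto simp: minus_divide_left diff_divide_distrib)
    then have "0 < q" using \<open>p < q\<close> by simp
    have "q * measure lebesgue S \<le> p * (measure lebesgue S + e)" if "0 < e" for e
    proof -
      \<comment> \<open>Confining the first family to \<open>T\<close> bounds its total length by
        the measure of \<open>S\<close> plus \<open>e\<close>.\<close>
      obtain T where T: "open T" "S \<subseteq> T" "T - S \<in> lmeasurable" "emeasure lebesgue (T - S) < ennreal e"
        using sets_lebesgue_outer_open[of S e] S \<open>0 < e\<close> by auto
      have P1: "\<exists>h. 0 < \<bar>h\<bar> \<and> \<bar>h\<bar> < d \<and>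
          F (max x (x + h)) - F (min x (x + h)) \<le> p * (max x (x + h) - min x (x + h))"
        if x: "x \<in> S" and "0 < d" for x d
      proof -
        obtain h where h: "0 < \<bar>h\<bar>" "\<bar>h\<bar> < d" "- p < (- F (x + h *\<^sub>R 1) - - F x) / h"
          using x \<open>0 < d\<close> steep_pointsE[of x "\<lambda>x. - F x" 1 "- p" d] unfolding S_def by auto
        then show ?thesis
          by (intro exI[of _ h]) (auto simp: max_def min_def field_simps abs_if split: if_splits)
      qed
      have P2: "\<exists>h. 0 < \<bar>h\<bar> \<and> \<bar>h\<bar> < d \<and>
          q * (max x (x + h) - min x (x + h)) \<le> F (max x (x + h)) - F (min x (x + h))"
        if x: "x \<in> S \<inter> B" and "0 < d" for x d B
      proof -
        obtain h where h: "0 < \<bar>h\<bar>" "\<bar>h\<bar> < d" "q < (F (x + h *\<^sub>R 1) - F x) / h"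
          using x \<open>0 < d\<close> steep_pointsE[of x F 1 q d] unfolding S_def by auto
        then show ?thesis
          by (intro exI[of _ h]) (auto simp: max_def min_def field_simps abs_if split: if_splits)
      qed
      obtain C where C: "countable C"
          "\<And>a b. (a, b) \<in> C \<Longrightarrow> a < b \<and> F b - F a \<le> p * (b - a) \<and> {a..b} \<subseteq> T"
          "disjoint_family_on (\<lambda>(a, b). {a..b}) C" "negligible (S - (\<Union>(a, b)\<in>C. {a..b}))"
        using Vitali_covering_intervals[OF T(1,2), of "\<lambda>a b. F b - F a \<le> p * (b - a)"] P1 by metis
      \<comment> \<open>Open intervals, so that the second covering can be kept inside
        \<open>U\<close>; only the countably many endpoints of the first family are lost.\<close>
      define U where "U = (\<Union>(a, b)\<in>C. {a<..<b})"
      have "open U" unfolding U_def by auto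
      obtain D where D: "countable D"
          "\<And>a b. (a, b) \<in> D \<Longrightarrow> a < b \<and> q * (b - a) \<le> F b - F a \<and> {a..b} \<subseteq> U"
          "disjoint_family_on (\<lambda>(a, b). {a..b}) D" "negligible (S \<inter> U - (\<Union>(a, b)\<in>D. {a..b}))"
        using Vitali_covering_intervals[OF \<open>open U\<close>, of "S \<inter> U" "\<lambda>a b. q * (b - a) \<le> F b - F a"] P2
        by (metis inf_le2)
      let ?C = "\<Union>(a, b)\<in>C. {a..b}" and ?D = "\<Union>(a, b)\<in>D. {a..b}"
      have bC: "?C \<in> sets borel" and bD: "?D \<in> sets borel"
        using C(1) D(1) by (auto intro!: sets.countable_UN')
      have "negligible (fst ` C \<union> snd ` C)"
        using C(1) by (auto simp: negligible_iff_null_sets intro!: null_sets_completionI countable_imp_null_set_lborel)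
      then have neg: "negligible ((S - ?C) \<union> (fst ` C \<union> snd ` C) \<union> (S \<inter> U - ?D))"
        using C(4) D(4) by (metis negligible_Un)
      have "S \<subseteq> ?D \<union> ((S - ?C) \<union> (fst ` C \<union> snd ` C) \<union> (S \<inter> U - ?D))"
      proof
        fix x assume x: "x \<in> S"
        show "x \<in> ?D \<union> ((S - ?C) \<union> (fst ` C \<union> snd ` C) \<union> (S \<inter> U - ?D))"
        proof (cases "x \<in> ?C \<and> x \<notin> U")
          case True
          then obtain a b where ab: "(a, b) \<in> C" "x \<in> {a..b}" "x \<notin> {a<..<b}"
            unfolding U_def by blast
          then have "x = fst (a, b) \<or> x = snd (a, b)" by auto
          then show ?thesis using ab(1) by blast
        qed (use x in blast)
      qed
      then have "emeasure lebesgue S \<le> emeasure lebesgue (?D \<union> ((S - ?C) \<union> (fst ` C \<union> snd ` C) \<union> (S \<inter> U - ?D)))"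
        using neg bD by (intro emeasure_mono) (auto dest!: negligible_imp_sets intro!: sets.Un)
      also have "\<dots> = emeasure lebesgue ?D"
        using neg bD by (intro emeasure_Un_null_set) (auto simp: negligible_iff_null_sets)
      also have "\<dots> = emeasure lborel ?D" using bD by simp
      finally have SD: "emeasure lebesgue S \<le> emeasure lborel ?D" .
      have lebD: "emeasure lborel ?D = (\<integral>\<^sup>+i. ennreal (snd i - fst i) \<partial>count_space D)"
        unfolding lborel_eq_real
        using emeasure_interval_family[of "\<lambda>x. x" D] D(1-3) by (auto simp: mono_def less_imp_le)
      have lebC: "emeasure lborel ?C = (\<integral>\<^sup>+i. ennreal (snd i - fst i) \<partial>count_space C)"
        unfolding lborel_eq_real
        using emeasure_interval_family[of "\<lambda>x. x" C] C(1-3) by (auto simp: mono_def less_imp_le)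
      have "ennreal q * emeasure lborel ?D = (\<integral>\<^sup>+i. ennreal q * ennreal (snd i - fst i) \<partial>count_space D)"
        unfolding lebD by (simp add: nn_integral_cmult)
      also have "\<dots> \<le> (\<integral>\<^sup>+i. ennreal (F (snd i) - F (fst i)) \<partial>count_space D)"
        using D(2) \<open>0 < q\<close>
        by (intro nn_integral_mono) (auto simp flip: ennreal_mult intro!: ennreal_leI simp: less_imp_le)
      also have "\<dots> = emeasure ?\<mu> ?D"
        using D by (intro emeasure_interval_family[symmetric] F) (auto simp: less_imp_le)
      also have "\<dots> \<le> emeasure ?\<mu> ?C"
      proof (intro emeasure_mono)
        have "?D \<subseteq> U" using D(2) by blast
        also have "U \<subseteq> ?C" unfolding U_def by (intro UN_mono) auto
        finally show "?D \<subseteq> ?C" .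
      qed (use bC in auto)
      also have "\<dots> = (\<integral>\<^sup>+i. ennreal (F (snd i) - F (fst i)) \<partial>count_space C)"
        using C by (intro emeasure_interval_family F) (auto simp: less_imp_le)
      also have "\<dots> \<le> (\<integral>\<^sup>+i. ennreal p * ennreal (snd i - fst i) \<partial>count_space C)"
        using C(2) \<open>0 < p\<close>
        by (intro nn_integral_mono) (auto simp flip: ennreal_mult intro!: ennreal_leI simp: less_imp_le)
      also have "\<dots> = ennreal p * emeasure lborel ?C"
        unfolding lebC by (simp add: nn_integral_cmult)
      also have "\<dots> \<le> ennreal p * emeasure lebesgue T"
      proof -
        have "?C \<subseteq> T" using C(2) by blast
        then have "emeasure lborel ?C \<le> emeasure lborel T"
          using T(1) by (intro emeasure_mono) auto
        then show ?thesis using T(1) by (intro mult_left_mono) auto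
      qed
      also have "emeasure lebesgue T = emeasure lebesgue (S \<union> (T - S))"
        using T(2) by (intro arg_cong[where f="emeasure lebesgue"]) blast
      also have "\<dots> \<le> emeasure lebesgue S + emeasure lebesgue (T - S)"
        using S T(3) by (intro emeasure_subadditive) auto
      also have "\<dots> \<le> emeasure lebesgue S + ennreal e"
        using T(4) by (intro add_left_mono) auto
      finally have "ennreal q * emeasure lborel ?D \<le> ennreal p * (emeasure lebesgue S + ennreal e)"
        by (simp add: mult_left_mono)
      then have "ennreal q * emeasure lebesgue S \<le> ennreal p * (emeasure lebesgue S + ennreal e)"
        using SD by (meson dual_order.trans mult_left_mono zero_le)
      then show ?thesis
        using S \<open>0 < e\<close> \<open>0 < q\<close> \<open>0 < p\<close>
        by (simp add: emeasure_eq_measure2 flip: ennreal_mult ennreal_plus)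
    qed
    note le = this
    have "q * measure lebesgue S \<le> p * measure lebesgue S + e" if "0 < e" for e
      using le[of "e / p"] that \<open>0 < p\<close> by (simp add: distrib_left)
    then have "q * measure lebesgue S \<le> p * measure lebesgue S"
      by (rule field_le_epsilon)
    then show ?thesis
      using \<open>p < q\<close> measure_nonneg[of lebesgue S] unfolding S_def[symmetric] mult_le_cancel_right by linarith
  qed simp
  have "negligible (?E \<inter> ball 0 R)" for R
    using main[of R] by (subst negligible_iff_measure) (auto intro!: bounded_set_imp_lmeasurable)
  then have "negligible (\<Union>n::nat. ?E \<inter> ball 0 (real n))"
    by (intro negligible_countable_Union) auto
  moreover have "?E = (\<Union>n::nat. ?E \<inter> ball 0 (real n))"
    using reals_Archimedean2 by (auto simp: dist_norm) 
  ultimately have "negligible ?E" by simp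
  then show ?thesis
    using E by (simp add: negligible_iff_null_sets null_sets_def)
qed

text \<open>Adding \<open>L * x\<close> makes \<open>F\<close> monotone and shifts every slope by
  \<open>L\<close>.\<close>

lemma null_sets_slope_gap_Lipschitz:
  fixes F :: "real \<Rightarrow> real"
  assumes F: "L-lipschitz_on UNIV F" and "p < q"
  shows "steep_points F 1 q \<inter> steep_points (\<lambda>x. - F x) 1 (- p) \<in> null_sets lborel"
proof -
  define G where "G x = F x + L * x" for x
  have "mono G"
  proof (rule monoI)
    fix x y :: real assume "x \<le> y"
    then show "G x \<le> G y"
      using lipschitz_onD[OF F, of x y] by (auto simp: G_def dist_real_def algebra_simps abs_if split: if_splits)
  qed
  moreover have "continuous_on UNIV G"
    unfolding G_def by (intro continuous_intros lipschitz_on_continuous_on[OF F])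
  ultimately have "steep_points G 1 (q + L) \<inter> steep_points (\<lambda>x. - G x) 1 (- (p + L)) \<in> null_sets lborel"
    using \<open>p < q\<close> by (intro null_sets_slope_gap_mono) auto
  moreover have "steep_points G 1 (q + L) = steep_points F 1 q"
    unfolding steep_points_def G_def
    by (intro Collect_cong all_cong ex_cong conj_cong refl)
       (auto simp: add_divide_distrib diff_divide_distrib ring_distribs)
  moreover have "steep_points (\<lambda>x. - G x) 1 (- (p + L)) = steep_points (\<lambda>x. - F x) 1 (- p)"
    unfolding steep_points_def G_def
    by (intro Collect_cong all_cong ex_cong conj_cong refl)
       (auto simp: add_divide_distrib diff_divide_distrib ring_distribs)
  ultimately show ?thesis by simp
qed

section \<open>Rademacher's theorem\<close>

lemma lborel_AE_translate:
  fixes c :: "'a::euclidean_space"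
  assumes "AE x in lborel. P x"
  shows "AE x in lborel. P (c + x)"
proof (rule AE_distrD[where f="(+) c" and M'=borel and P=P])
  show "AE x in distr lborel borel ((+) c). P x"
    by (subst lborel_distr_plus) (rule assms)
qed simp

lemma lborel_integral_translate:
  fixes g :: "'a::euclidean_space \<Rightarrow> real"
  assumes "g \<in> borel_measurable borel"
  shows "(\<integral>x. g (c + x) \<partial>lborel) = (\<integral>x. g x \<partial>lborel)"
  using integral_distr[of "(+) c" lborel borel g] assms by (simp add: lborel_distr_plus)

text \<open>Fubini in the form of averaging over translates: on every line in direction \<open>v\<close> the exceptional
  set is null, hence almost all of its translates along \<open>v\<close> are null, hence it is null itself.\<close>

lemma null_sets_slope_gap:
  fixes f :: "'a::euclidean_space \<Rightarrow> real"
  assumes f: "L-lipschitz_on UNIV f" and "p < q"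
  shows "steep_points f v q \<inter> steep_points (\<lambda>x. - f x) v (- p) \<in> null_sets lborel" (is "?E \<in> _")
proof -
  have cont: "continuous_on UNIV f" by (rule lipschitz_on_continuous_on[OF f])
  have E[measurable]: "?E \<in> sets borel"
    by (intro sets.Int borel_steep_points continuous_intros cont)
  have line: "AE t in lborel. x + t *\<^sub>R v \<notin> ?E" for x
  proof -
    have "(L * norm v)-lipschitz_on UNIV (\<lambda>t. f (x + t *\<^sub>R v))"
    proof (rule lipschitz_onI)
      fix s t :: real
      have "dist (x + s *\<^sub>R v) (x + t *\<^sub>R v) = dist s t * norm v"
        unfolding dist_norm add_diff_cancel_left scaleR_left_diff_distrib[symmetric] by simp
      then show "dist (f (x + s *\<^sub>R v)) (f (x + t *\<^sub>R v)) \<le> L * norm v * dist s t"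
        using lipschitz_onD[OF f, of "x + s *\<^sub>R v" "x + t *\<^sub>R v"]
        by (simp add: mult_ac dist_real_def)
    qed (use lipschitz_on_nonneg[OF f] in simp)
    from null_sets_slope_gap_Lipschitz[OF this \<open>p < q\<close>]
    have "{t. x + t *\<^sub>R v \<in> ?E} \<in> null_sets lborel"
      by (rule back_subst[of "\<lambda>A. A \<in> null_sets lborel"])
         (auto simp: steep_points_def scaleR_left_distrib add.assoc)
    from AE_not_in[OF this] show ?thesis by simp
  qed
  have "AE t in lborel. AE x in lborel. x + t *\<^sub>R v \<notin> ?E"
  proof (rule iffD1[OF lborel_pair.AE_commute])
    show "AE x in lborel. AE t in lborel. x + t *\<^sub>R v \<notin> ?E"
      using line by simp
  qed measurable
  moreover have "ae_filter (lborel :: real measure) \<noteq> bot"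
    by (simp add: ae_filter_eq_bot_iff)
  ultimately obtain t where "AE x in lborel. x + t *\<^sub>R v \<notin> ?E"
    using eventually_happens' by blast
  from lborel_AE_translate[OF this, of "- t *\<^sub>R v"] have "AE x in lborel. x \<notin> ?E"
    by simp
  then show ?thesis
    using E by (simp add: AE_iff_null_sets)
qed

text \<open>A limit along one fixed sequence, so that the function is measurable everywhere; it is
  the two-sided directional derivative wherever that exists.\<close>

definition dir_deriv :: "('a::real_normed_vector \<Rightarrow> real) \<Rightarrow> 'a \<Rightarrow> 'a \<Rightarrow> real" where
  "dir_deriv f v x = lim (\<lambda>n. (f (x + inverse (real (Suc n)) *\<^sub>R v) - f x) / inverse (real (Suc n)))"

lemma dir_deriv_eqI:
  assumes "((\<lambda>h. (f (x + h *\<^sub>R v) - f x) / h) \<longlongrightarrow> l) (at 0)"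
  shows "dir_deriv f v x = l"
  unfolding dir_deriv_def
  using assms LIMSEQ_inverse_real_of_nat
  by (intro limI) (auto simp: tendsto_at_iff_sequentially o_def elim!: allE[of _ "\<lambda>n. inverse (real (Suc n))"])

lemma borel_measurable_dir_deriv:
  fixes f :: "'a::euclidean_space \<Rightarrow> real"
  assumes "continuous_on UNIV f"
  shows "dir_deriv f v \<in> borel_measurable borel"
  unfolding dir_deriv_def[abs_def]
  by (intro borel_measurable_lim_metric borel_measurable_continuous_onI continuous_intros
      continuous_on_compose2[OF assms]) auto

lemma Lipschitz_slope_bound:
  fixes f :: "'a::real_normed_vector \<Rightarrow> real"
  assumes "L-lipschitz_on UNIV f"
  shows "\<bar>(f (x + h *\<^sub>R v) - f x) / h\<bar> \<le> L * norm v"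
proof (cases "h = 0")
  case False
  have "\<bar>f (x + h *\<^sub>R v) - f x\<bar> \<le> L * norm v * \<bar>h\<bar>"
    using lipschitz_onD[OF assms, of "x + h *\<^sub>R v" x] by (simp add: dist_norm mult_ac)
  then show ?thesis using False by (simp add: divide_le_eq)
qed (use lipschitz_on_nonneg[OF assms] in simp)

text \<open>The infimum of the eventual upper bounds \<open>Q\<close> is the upper limit of the
  slopes. For \<open>a\<close> below it, take rationals \<open>a < p < q < Inf Q\<close>: slopes
  above \<open>q\<close> recur because \<open>q\<close> is not in \<open>Q\<close>, hence by
  hypothesis slopes below \<open>p\<close> do not, and the slopes eventually exceed
  \<open>a\<close>.\<close>

lemma slope_convergent:
  fixes f :: "'a::real_normed_vector \<Rightarrow> real"
  assumes f: "L-lipschitz_on UNIV f"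
    and x: "\<And>p q. p \<in> \<rat> \<Longrightarrow> q \<in> \<rat> \<Longrightarrow> p < q \<Longrightarrow> x \<notin> steep_points f v q \<inter> steep_points (\<lambda>x. - f x) v (- p)"
  shows "\<exists>l. ((\<lambda>h. (f (x + h *\<^sub>R v) - f x) / h) \<longlongrightarrow> l) (at 0)"
proof -
  define s where "s h = (f (x + h *\<^sub>R v) - f x) / h" for h
  define Q where "Q = {q. \<forall>\<^sub>F h in at 0. s h \<le> q}"
  have ev: "(\<forall>\<^sub>F h in at 0. P h) \<longleftrightarrow> (\<exists>d>0. \<forall>h. 0 < \<bar>h\<bar> \<and> \<bar>h\<bar> < d \<longrightarrow> P h)" for P :: "real \<Rightarrow> bool"
    by (auto simp: eventually_at)
  have not_steep: "x \<notin> steep_points g v q \<longleftrightarrow>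
      (\<exists>d>0. \<forall>h. 0 < \<bar>h\<bar> \<and> \<bar>h\<bar> < d \<longrightarrow> (g (x + h *\<^sub>R v) - g x) / h \<le> q)" for g q
    unfolding steep_points_def mem_Collect_eq by (meson not_less)
  have up: "q \<in> Q \<longleftrightarrow> x \<notin> steep_points f v q" for q
    unfolding Q_def not_steep mem_Collect_eq ev s_def ..
  have low: "(\<forall>\<^sub>F h in at 0. p \<le> s h) \<longleftrightarrow> x \<notin> steep_points (\<lambda>x. - f x) v (- p)" for p
  proof -
    have "(- a - - b) / h \<le> - p \<longleftrightarrow> p \<le> (a - b) / h" for a b h :: real
      by (auto simp: diff_divide_distrib)
    then show ?thesis unfolding not_steep ev s_def by simp
  qed
  have sb: "\<bar>s h\<bar> \<le> L * norm v" for h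
    unfolding s_def by (rule Lipschitz_slope_bound[OF f])
  have "L * norm v \<in> Q"
    unfolding Q_def using sb by (auto simp: abs_le_iff)
  have bdd: "bdd_below Q"
  proof (rule bdd_belowI)
    fix q assume "q \<in> Q"
    then obtain h where "s h \<le> q"
      unfolding Q_def using eventually_happens'[of "at (0::real)"] by auto
    then show "- (L * norm v) \<le> q" using sb[of h] by linarith
  qed
  have "(s \<longlongrightarrow> Inf Q) (at 0)"
  proof (rule order_tendstoI)
    fix a assume "Inf Q < a"
    then obtain q where "q \<in> Q" "q < a"
      using \<open>L * norm v \<in> Q\<close> bdd by (subst (asm) cInf_less_iff) auto
    then show "\<forall>\<^sub>F h in at 0. s h < a"
      unfolding Q_def by (auto elim: eventually_mono)
  next
    fix a assume "a < Inf Q"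
    then obtain q where q: "q \<in> \<rat>" "a < q" "q < Inf Q" using Rats_dense_in_real by blast
    obtain p where p: "p \<in> \<rat>" "a < p" "p < q" using q Rats_dense_in_real by blast
    have "q \<notin> Q" using q(3) bdd cInf_lower[of q Q] by auto
    then have "\<forall>\<^sub>F h in at 0. p \<le> s h"
      using x[OF p(1) q(1) p(3)] up low by blast
    then show "\<forall>\<^sub>F h in at 0. a < s h"
      using p(2) by (auto elim: eventually_mono)
  qed
  then show ?thesis unfolding s_def by blast
qed

lemma AE_slope_tendsto_dir_deriv:
  fixes f :: "'a::euclidean_space \<Rightarrow> real"
  assumes f: "L-lipschitz_on UNIV f"
  shows "AE x in lborel. ((\<lambda>h. (f (x + h *\<^sub>R v) - f x) / h) \<longlongrightarrow> dir_deriv f v x) (at 0)"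
proof -
  let ?I = "{(p, q). p \<in> \<rat> \<and> q \<in> \<rat> \<and> p < (q::real)}"
  have "countable ?I"
    by (rule countable_subset[of _ "\<rat> \<times> \<rat>"]) (auto simp: countable_rat)
  moreover have "\<forall>(p, q)\<in>?I. AE x in lborel. x \<notin> steep_points f v q \<inter> steep_points (\<lambda>x. - f x) v (- p)"
    by (clarify, rule AE_not_in, rule null_sets_slope_gap[OF f])
  ultimately have "AE x in lborel. \<forall>(p, q)\<in>?I. x \<notin> steep_points f v q \<inter> steep_points (\<lambda>x. - f x) v (- p)"
    by (subst AE_ball_countable) (auto simp: case_prod_unfold)
  then show ?thesis
  proof eventually_elim
    case (elim x)
    then obtain l where "((\<lambda>h. (f (x + h *\<^sub>R v) - f x) / h) \<longlongrightarrow> l) (at 0)"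
      using slope_convergent[OF f, of x v] by blast
    then show ?case using dir_deriv_eqI by metis
  qed
qed

lemma dir_deriv_bound:
  fixes f :: "'a::euclidean_space \<Rightarrow> real"
  assumes f: "L-lipschitz_on UNIV f"
  shows "AE x in lborel. \<bar>dir_deriv f v x\<bar> \<le> L * norm v"
  using AE_slope_tendsto_dir_deriv[OF f, of v]
proof eventually_elim
  case (elim x)
  show ?case
    by (rule tendsto_upperbound[OF tendsto_rabs[OF elim] always_eventually])
       (rule allI, rule Lipschitz_slope_bound[OF f], simp)
qed

lemma AE_LIMSEQ_dir_deriv:
  fixes f :: "'a::euclidean_space \<Rightarrow> real"
  assumes f: "L-lipschitz_on UNIV f" and t: "t \<longlonglongrightarrow> 0" "\<And>n. t n \<noteq> 0"
  shows "AE x in lborel. (\<lambda>n. (f (x + t n *\<^sub>R v) - f x) / t n) \<longlonglongrightarrow> dir_deriv f v x"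
  using AE_slope_tendsto_dir_deriv[OF f, of v]
proof eventually_elim
  case (elim x)
  then show ?case
    using t by (auto simp: tendsto_at_iff_sequentially o_def)
qed

text \<open>The slope in direction \<open>u + v\<close> at \<open>x\<close> is the slope in direction \<open>u\<close> at \<open>x\<close> plus the slope in
  direction \<open>v\<close> at the nearby point \<open>x + t u\<close>; integrating over a box and translating removes the
  discrepancy in the limit.\<close>

lemma integral_dir_deriv_add:
  fixes f :: "'a::euclidean_space \<Rightarrow> real"
  assumes f: "L-lipschitz_on UNIV f"
  shows "(\<integral>x. indicator (box a b) x * dir_deriv f (u + v) x \<partial>lborel)
       = (\<integral>x. indicator (box a b) x * dir_deriv f u x \<partial>lborel)
       + (\<integral>x. indicator (box a b) x * dir_deriv f v x \<partial>lborel)"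
proof -
  note [measurable] = borel_measurable_dir_deriv[OF lipschitz_on_continuous_on[OF f]]
  have [measurable]: "f \<in> borel_measurable borel"
    by (intro borel_measurable_continuous_onI lipschitz_on_continuous_on[OF f])
  define t where "t n = inverse (real (Suc n))" for n
  have t: "t \<longlonglongrightarrow> 0" "t n \<noteq> 0" "0 \<le> t n" "t n \<le> 1" for n
    using LIMSEQ_inverse_real_of_nat by (auto simp: t_def[abs_def] divide_simps)
  let ?B = "box a b"
  define s where "s n w x = (f (x + t n *\<^sub>R w) - f x) / t n" for n w x
  have [measurable]: "s n w \<in> borel_measurable borel" for n w
    unfolding s_def[abs_def] by measurable
  have sb: "\<bar>s n w x\<bar> \<le> L * norm w" for n w x
    unfolding s_def by (rule Lipschitz_slope_bound[OF f])
  have s_lim: "AE x in lborel. (\<lambda>n. s n w x) \<longlonglongrightarrow> dir_deriv f w x" for w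
    unfolding s_def using AE_LIMSEQ_dir_deriv[OF f t(1,2)] .
  have L: "0 \<le> L" by (rule lipschitz_on_nonneg[OF f])
  have lim: "(\<lambda>n. \<integral>x. indicator ?B x * s n w x \<partial>lborel) \<longlonglongrightarrow> (\<integral>x. indicator ?B x * dir_deriv f w x \<partial>lborel)" for w
  proof (rule integral_dominated_convergence[where w="\<lambda>x. (L * norm w) * indicator ?B x"])
    show "AE x in lborel. (\<lambda>n. indicator ?B x * s n w x) \<longlonglongrightarrow> indicator ?B x * dir_deriv f w x"
      using s_lim[of w] by eventually_elim (intro tendsto_intros)
  qed (auto simp: sb split: split_indicator intro!: integrable_real_indicator emeasure_bounded_finite)
  \<comment> \<open>Since \<open>t n \<le> 1\<close>, one fixed ball contains all shifted boxes; its
    indicator gives the dominating function.\<close>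
  obtain R where R: "\<And>x. x \<in> ?B \<Longrightarrow> norm x \<le> R"
    using bounded_box[of a b] by (auto simp: bounded_iff)
  have lim': "(\<lambda>n. \<integral>y. indicator ?B (y - t n *\<^sub>R u) * s n v y \<partial>lborel) \<longlonglongrightarrow> (\<integral>y. indicator ?B y * dir_deriv f v y \<partial>lborel)"
  proof (rule integral_dominated_convergence[where w="\<lambda>x. (L * norm v) * indicator (cball 0 (R + norm u)) x"])
    \<comment> \<open>The shifted indicators converge at every point off the boundary of the box,
      and this boundary is null.\<close>
    have "frontier ?B \<in> null_sets lborel"
      using negligible_convex_frontier[of ?B] by (simp add: negligible_iff_null_sets null_sets_def)
    from AE_not_in[OF this]
    show "AE y in lborel. (\<lambda>n. indicator ?B (y - t n *\<^sub>R u) * s n v y) \<longlonglongrightarrow> indicator ?B y * dir_deriv f v y"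
      using s_lim[of v]
    proof eventually_elim
      case (elim y)
      have lim0: "(\<lambda>n. y - t n *\<^sub>R u) \<longlonglongrightarrow> y"
        using tendsto_diff[OF tendsto_const tendsto_scaleR[OF t(1) tendsto_const], of y u] by simp
      have "\<forall>\<^sub>F n in sequentially. indicator ?B (y - t n *\<^sub>R u) = (indicator ?B y :: real)"
      proof (cases "y \<in> ?B")
        case True
        have "\<forall>\<^sub>F n in sequentially. y - t n *\<^sub>R u \<in> ?B"
          by (rule topological_tendstoD[OF lim0 open_box True])
        then show ?thesis by eventually_elim (use True in auto)
      next
        case False
        then have "y \<in> - closure ?B"
          using elim(1) interior_open[OF open_box[of a b]] by (auto simp: frontier_def)
        then have "\<forall>\<^sub>F n in sequentially. y - t n *\<^sub>R u \<in> - closure ?B"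
          by (intro topological_tendstoD[OF lim0]) (auto simp: open_Compl)
        then show ?thesis
          by eventually_elim (use False closure_subset[of ?B] in \<open>auto split: split_indicator\<close>)
      qed
      then have "(\<lambda>n. indicator ?B (y - t n *\<^sub>R u) :: real) \<longlonglongrightarrow> indicator ?B y"
        by (rule tendsto_eventually)
      then show ?case using elim(2) by (intro tendsto_intros)
    qed
    show "AE y in lborel. norm (indicator ?B (y - t n *\<^sub>R u) * s n v y) \<le> (L * norm v) * indicator (cball 0 (R + norm u)) y" for n
    proof (intro AE_I2)
      fix y
      show "norm (indicator ?B (y - t n *\<^sub>R u) * s n v y) \<le> (L * norm v) * indicator (cball 0 (R + norm u)) y"
      proof (cases "y - t n *\<^sub>R u \<in> ?B")
        case True
        have "norm y \<le> norm (y - t n *\<^sub>R u) + norm (t n *\<^sub>R u)"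
          using norm_triangle_ineq[of "y - t n *\<^sub>R u" "t n *\<^sub>R u"] by simp
        also have "\<dots> \<le> R + norm u"
          using True R t(3,4)[of n] by (intro add_mono) (auto simp: mult_le_one mult_left_le_one_le)
        finally show ?thesis using True sb[of n v y] by simp
      qed (use L in simp)
    qed
  qed (auto intro!: integrable_real_indicator emeasure_bounded_finite)
  have ib: "integrable lborel (\<lambda>x. indicator ?B x * g x)"
    if "g \<in> borel_measurable borel" "\<And>x. \<bar>g x\<bar> \<le> C" for g :: "'a \<Rightarrow> real" and C
  proof (rule Bochner_Integration.integrable_bound[where f="\<lambda>x. C * indicator ?B x"])
    show "AE x in lborel. norm (indicator ?B x * g x) \<le> norm (C * indicator ?B x)"
      using that(2) order_trans[OF that(2) abs_ge_self] by (intro AE_I2) (simp split: split_indicator)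
  qed (use that(1) in \<open>auto intro!: integrable_real_indicator emeasure_bounded_finite\<close>)
  have "(\<integral>x. indicator ?B x * s n (u + v) x \<partial>lborel)
      = (\<integral>x. indicator ?B x * s n u x \<partial>lborel) + (\<integral>y. indicator ?B (y - t n *\<^sub>R u) * s n v y \<partial>lborel)" for n
  proof -
    have split: "s n (u + v) x = s n u x + s n v (t n *\<^sub>R u + x)" for x
    proof -
      have "x + t n *\<^sub>R (u + v) = t n *\<^sub>R u + x + t n *\<^sub>R v"
        by (simp add: scaleR_right_distrib)
      then show ?thesis by (simp add: s_def diff_divide_distrib ac_simps)
    qed
    have "(\<integral>x. indicator ?B x * s n (u + v) x \<partial>lborel)
        = (\<integral>x. indicator ?B x * s n u x + indicator ?B x * s n v (t n *\<^sub>R u + x) \<partial>lborel)"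
      unfolding split distrib_left ..
    also have "\<dots> = (\<integral>x. indicator ?B x * s n u x \<partial>lborel) + (\<integral>x. indicator ?B x * s n v (t n *\<^sub>R u + x) \<partial>lborel)"
      by (intro Bochner_Integration.integral_add ib[of _ "L * norm u"] ib[of _ "L * norm v"] sb) auto
    also have "(\<integral>x. indicator ?B x * s n v (t n *\<^sub>R u + x) \<partial>lborel) = (\<integral>y. indicator ?B (y - t n *\<^sub>R u) * s n v y \<partial>lborel)"
      using lborel_integral_translate[of "\<lambda>y. indicator ?B (y - t n *\<^sub>R u) * s n v y" "t n *\<^sub>R u"] by simp
    finally show ?thesis .
  qed
  with tendsto_add[OF lim[of u] lim'] lim[of "u + v"] show ?thesis
    by (simp add: LIMSEQ_unique)
qed

lemma AE_dir_deriv_add: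
  fixes f :: "'a::euclidean_space \<Rightarrow> real"
  assumes f: "L-lipschitz_on UNIV f"
  shows "AE x in lborel. dir_deriv f (u + v) x = dir_deriv f u x + dir_deriv f v x"
proof -
  note [measurable] = borel_measurable_dir_deriv[OF lipschitz_on_continuous_on[OF f]]
  define h where "h x = dir_deriv f (u + v) x - (dir_deriv f u x + dir_deriv f v x)" for x
  have [measurable]: "h \<in> borel_measurable borel" unfolding h_def[abs_def] by measurable
  \<comment> \<open>\<open>C\<close> bounds the defect \<open>h\<close>, so
    \<open>1 + h x / C\<close> is almost everywhere nonnegative and can serve as a density; the
    summand 1 makes \<open>C\<close> positive.\<close>
  define C where "C = L * norm (u + v) + L * norm u + L * norm v + 1"
  have "0 \<le> L" by (rule lipschitz_on_nonneg[OF f])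
  then have "0 < C" unfolding C_def by (intro add_nonneg_pos) auto
  have hC: "AE x in lborel. \<bar>h x\<bar> \<le> C"
    using dir_deriv_bound[OF f, of "u + v"] dir_deriv_bound[OF f, of u] dir_deriv_bound[OF f, of v]
    by eventually_elim (auto simp: h_def C_def abs_le_iff)
  then have pos: "AE x in lborel. 0 \<le> 1 + h x / C"
    by eventually_elim (use \<open>0 < C\<close> in \<open>auto simp: field_simps abs_le_iff\<close>)
  have int: "integrable lborel (\<lambda>x. indicator (box a b) x * g x)"
    if "g \<in> borel_measurable borel" "AE x in lborel. \<bar>g x\<bar> \<le> K" for g :: "'a \<Rightarrow> real" and a b K
  proof (rule Bochner_Integration.integrable_bound[where f="\<lambda>x. K * indicator (box a b) x"])
    show "AE x in lborel. norm (indicator (box a b) x * g x) \<le> norm (K * indicator (box a b) x)"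
      using that(2) by eventually_elim (auto split: split_indicator)
  qed (use that in \<open>auto intro!: integrable_real_indicator emeasure_bounded_finite\<close>)
  have i: "integrable lborel (\<lambda>x. indicator (box a b) x * dir_deriv f w x)" for a b w
    by (rule int[OF _ dir_deriv_bound[OF f]]) measurable
  have h0: "(\<integral>x. indicator (box a b) x * h x \<partial>lborel) = 0" for a b
    by (simp add: h_def right_diff_distrib distrib_left i integral_dir_deriv_add[OF f]
        Bochner_Integration.integral_diff Bochner_Integration.integral_add)
  \<comment> \<open>Since \<open>h\<close> integrates to 0 over every box, this density measure agrees with Lebesgue measure.\<close>
  let ?M = "density lborel (\<lambda>x. ennreal (1 + h x / C))"
  have "lborel = ?M"
  proof (rule lborel_eqI)
    fix l r :: 'a assume lr: "\<And>b. b \<in> Basis \<Longrightarrow> l \<bullet> b \<le> r \<bullet> b"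
    have i1: "integrable lborel (\<lambda>x. indicator (box l r) x * h x)" by (rule int[OF _ hC]) auto
    have i2: "integrable lborel (\<lambda>x. indicator (box l r) x * (1 + h x / C))"
    proof (rule int[where K=2])
      show "AE x in lborel. \<bar>1 + h x / C\<bar> \<le> 2"
        using hC by eventually_elim (use \<open>0 < C\<close> in \<open>auto simp: field_simps abs_le_iff\<close>)
    qed auto
    have "emeasure ?M (box l r) = (\<integral>\<^sup>+x. ennreal (1 + h x / C) * indicator (box l r) x \<partial>lborel)"
      by (intro emeasure_density) auto
    also have "\<dots> = (\<integral>\<^sup>+x. ennreal (indicator (box l r) x * (1 + h x / C)) \<partial>lborel)"
      by (intro nn_integral_cong) (auto split: split_indicator)
    also have "\<dots> = ennreal (\<integral>x. indicator (box l r) x * (1 + h x / C) \<partial>lborel)"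
    proof (rule nn_integral_eq_integral[OF i2])
      show "AE x in lborel. 0 \<le> indicator (box l r) x * (1 + h x / C)"
        using pos by eventually_elim auto
    qed
    also have "(\<integral>x. indicator (box l r) x * (1 + h x / C) \<partial>lborel)
             = (\<integral>x. indicator (box l r) x + (indicator (box l r) x * h x) / C \<partial>lborel)"
      by (simp add: distrib_left)
    also have "\<dots> = (\<integral>x. indicator (box l r) x \<partial>lborel) + (\<integral>x. (indicator (box l r) x * h x) / C \<partial>lborel)"
      by (intro Bochner_Integration.integral_add integrable_divide i1) (auto intro!: integrable_real_indicator emeasure_bounded_finite)
    also have "\<dots> = measure lborel (box l r)" using h0 by simp
    also have "\<dots> = (\<Prod>b\<in>Basis. (r - l) \<bullet> b)" using lr by (auto simp: measure_lborel_box_eq)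
    finally show "emeasure ?M (box l r) = ennreal (\<Prod>b\<in>Basis. (r - l) \<bullet> b)" .
  qed simp
  then have "density lborel (\<lambda>x. 1) = ?M" by (simp add: density_1)
  then have "AE x in lborel. 1 = ennreal (1 + h x / C)"
    by (subst (asm) sigma_finite_measure.density_unique_iff[OF sigma_finite_lborel]) auto
  then show ?thesis
  proof eventually_elim
    case (elim x)
    then have "1 + h x / C = 1" by (metis ennreal_eq_1)
    then show ?case using \<open>0 < C\<close> by (simp add: h_def)
  qed
qed

section \<open>From directional derivatives to differentiability\<close>

lemma dir_deriv_scaleR:
  assumes "((\<lambda>h. (f (x + h *\<^sub>R v) - f x) / h) \<longlongrightarrow> l) (at 0)"
  shows "dir_deriv f (c *\<^sub>R v) x = c * l"
proof (rule dir_deriv_eqI, cases "c = 0")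
  case False
  have "filterlim (\<lambda>h. h * c) (at 0) (at 0)"
    using False by (auto simp: filterlim_at eventually_at_filter intro!: tendsto_eq_intros)
  from filterlim_compose[OF assms this]
  have "((\<lambda>h. (f (x + (h * c) *\<^sub>R v) - f x) / (h * c)) \<longlongrightarrow> l) (at 0)" .
  from tendsto_mult[OF tendsto_const[of c] this]
  show "((\<lambda>h. (f (x + h *\<^sub>R c *\<^sub>R v) - f x) / h) \<longlongrightarrow> c * l) (at 0)"
    using False by simp
qed simp

text \<open>Expand \<open>v\<close> in the basis and use additivity almost everywhere for each
  partial sum. The exceptional null set depends on \<open>v\<close>, so only countably many
  directions can be treated simultaneously.\<close>

lemma AE_dir_deriv_linear:
  fixes f :: "'a::euclidean_space \<Rightarrow> real"
  assumes f: "L-lipschitz_on UNIV f"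
  shows "AE x in lborel. dir_deriv f v x = (\<Sum>b\<in>Basis. (v \<bullet> b) * dir_deriv f b x)"
proof -
  have "AE x in lborel. dir_deriv f (\<Sum>b\<in>S. (v \<bullet> b) *\<^sub>R b) x = (\<Sum>b\<in>S. (v \<bullet> b) * dir_deriv f b x)"
    if "finite S" for S
    using that
  proof (induction S)
    case empty
    have "dir_deriv f 0 x = 0" for x
      by (rule dir_deriv_eqI) simp
    then show ?case by simp
  next
    case (insert b S)
    from AE_dir_deriv_add[OF f, of "(v \<bullet> b) *\<^sub>R b" "\<Sum>b\<in>S. (v \<bullet> b) *\<^sub>R b"]
      AE_slope_tendsto_dir_deriv[OF f, of b] insert.IH
    show ?case
      by eventually_elim (simp add: insert.hyps dir_deriv_scaleR)
  qed
  from this[OF finite_Basis] show ?thesis by (simp add: euclidean_representation)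
qed

text \<open>By compactness of the unit sphere, finitely many directions of \<open>Z\<close> form a
  net. The slopes converge uniformly on a finite net, and the Lipschitz bound carries this over to
  all unit directions.\<close>

lemma Lipschitz_has_derivative_if_dense:
  fixes f :: "'a::euclidean_space \<Rightarrow> real"
  assumes f: "L-lipschitz_on UNIV f" and A: "linear A" and Z: "closure Z = UNIV"
    and lim: "\<And>v. v \<in> Z \<Longrightarrow> ((\<lambda>h. (f (x + h *\<^sub>R v) - f x) / h) \<longlongrightarrow> A v) (at 0)"
  shows "(f has_derivative A) (at x)"
  unfolding has_derivative_at_alt
proof (intro conjI allI impI)
  show "bounded_linear A" using A by (simp add: linear_conv_bounded_linear)
  then obtain K where K: "0 < K" "\<And>z. norm (A z) \<le> norm z * K"
    using bounded_linear.pos_bounded by metis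
  have L: "0 \<le> L" by (rule lipschitz_on_nonneg[OF f])
  fix e :: real assume "0 < e"
  \<comment> \<open>Replacing a unit direction by a point of the net at distance below
    \<open>\<eta>\<close> costs at most \<open>L * \<eta>\<close> in the slope of \<open>f\<close>
    and \<open>K * \<eta>\<close> in \<open>A\<close>, together \<open>e / 2\<close>.\<close>
  define \<eta> where "\<eta> = e / (2 * (L + K))"
  have \<eta>: "0 < \<eta>" "(L + K) * \<eta> = e / 2"
  proof -
    have "0 < L + K" using K(1) L by simp
    then show "0 < \<eta>" "(L + K) * \<eta> = e / 2"
      using \<open>0 < e\<close> by (simp_all add: \<eta>_def field_simps)
  qed
  have cov: "sphere 0 1 \<subseteq> (\<Union>z\<in>Z. ball z \<eta>)"
  proof
    fix u :: 'a
    have "u \<in> closure Z" using Z by simp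
    then show "u \<in> (\<Union>z\<in>Z. ball z \<eta>)"
      using \<eta>(1) by (auto simp: closure_approachable)
  qed
  obtain Z0 where Z0: "Z0 \<subseteq> Z" "finite Z0" "sphere 0 1 \<subseteq> (\<Union>z\<in>Z0. ball z \<eta>)"
    using cov by (rule compactE_image[OF compact_sphere open_ball])
  have "\<forall>\<^sub>F h in at 0. \<forall>z\<in>Z0. dist ((f (x + h *\<^sub>R z) - f x) / h) (A z) < e / 2"
    using Z0(1,2) lim \<open>0 < e\<close> by (intro eventually_ball_finite ballI tendstoD) auto
  then obtain d where d: "0 < d" "\<And>h z. h \<noteq> 0 \<Longrightarrow> \<bar>h\<bar> < d \<Longrightarrow> z \<in> Z0 \<Longrightarrow> \<bar>(f (x + h *\<^sub>R z) - f x) / h - A z\<bar> < e / 2"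
    by (auto simp: eventually_at dist_real_def)
  show "\<exists>d>0. \<forall>y. norm (y - x) < d \<longrightarrow> norm (f y - f x - A (y - x)) \<le> e * norm (y - x)"
  proof (intro exI[of _ d] conjI allI impI)
    fix y assume y: "norm (y - x) < d"
    show "norm (f y - f x - A (y - x)) \<le> e * norm (y - x)"
    proof (cases "y = x")
      case False
      define h where "h = norm (y - x)"
      define u where "u = (y - x) /\<^sub>R h"
      have h: "0 < h" "h < d" "y = x + h *\<^sub>R u" using False y by (auto simp: h_def u_def)
      have "u \<in> sphere 0 1" using False by (simp add: u_def h_def)
      then obtain z where z: "z \<in> Z0" "norm (z - u) < \<eta>" using Z0(3) by (auto simp: dist_norm)
      have "\<bar>f (x + h *\<^sub>R z) - f x - h * A z\<bar> = h * \<bar>(f (x + h *\<^sub>R z) - f x) / h - A z\<bar>"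
        using h(1) by (simp add: abs_mult_pos' field_simps flip: abs_mult_pos)
      also have "\<dots> \<le> h * (e / 2)"
        using d(2)[of h z] h z(1) by (intro mult_left_mono) auto
      finally have 1: "\<bar>f (x + h *\<^sub>R z) - f x - h * A z\<bar> \<le> h * (e / 2)" .
      have "\<bar>f y - f (x + h *\<^sub>R z)\<bar> \<le> L * (h * norm (z - u))"
        using lipschitz_onD[OF f, of y "x + h *\<^sub>R z"] h
        by (simp add: dist_norm norm_minus_commute flip: scaleR_diff_right)
      also have "\<dots> \<le> L * (h * \<eta>)"
        using z(2) h(1) L by (intro mult_left_mono) auto
      finally have 2: "\<bar>f y - f (x + h *\<^sub>R z)\<bar> \<le> L * (h * \<eta>)" .
      have "\<bar>h * A (z - u)\<bar> \<le> h * (norm (z - u) * K)"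
        using K(2)[of "z - u"] h(1) by (simp add: abs_mult)
      also have "\<dots> \<le> h * (\<eta> * K)"
        using z(2) h(1) K(1) by (intro mult_left_mono mult_right_mono) auto
      finally have 3: "\<bar>h * A (z - u)\<bar> \<le> h * (\<eta> * K)" .
      have Aeq: "A (y - x) = h * A u" "A (z - u) = A z - A u"
        using h A by (simp_all add: linear_cmul linear_diff)
      have "f y - f x - A (y - x) = (f (x + h *\<^sub>R z) - f x - h * A z) + (f y - f (x + h *\<^sub>R z)) + h * A (z - u)"
        by (simp add: Aeq algebra_simps)
      then have "\<bar>f y - f x - A (y - x)\<bar> \<le> h * (e / 2) + L * (h * \<eta>) + h * (\<eta> * K)"
        using 1 2 3 by linarith
      also have "\<dots> = h * (e / 2 + (L + K) * \<eta>)" by (simp add: algebra_simps)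
      finally show ?thesis unfolding \<eta>(2) by (simp add: h_def mult.commute)
    qed (simp add: linear_0[OF A])
  qed (rule d(1))
qed

lemma Rademacher_real:
  fixes f :: "'a::euclidean_space \<Rightarrow> real"
  assumes f: "L-lipschitz_on UNIV f"
  shows "AE x in lborel. f differentiable (at x)"
proof -
  obtain Z :: "'a set" where Z: "countable Z" "closure Z = UNIV"
    using separable[of "UNIV :: 'a set"] by (metis top.extremum_uniqueI)
  have "AE x in lborel. \<forall>v\<in>Z. ((\<lambda>h. (f (x + h *\<^sub>R v) - f x) / h) \<longlongrightarrow> (\<Sum>b\<in>Basis. (v \<bullet> b) * dir_deriv f b x)) (at 0)"
    unfolding AE_ball_countable[OF Z(1)]
  proof
    fix v
    show "AE x in lborel. ((\<lambda>h. (f (x + h *\<^sub>R v) - f x) / h) \<longlongrightarrow> (\<Sum>b\<in>Basis. (v \<bullet> b) * dir_deriv f b x)) (at 0)"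
      using AE_slope_tendsto_dir_deriv[OF f, of v] AE_dir_deriv_linear[OF f, of v]
      by eventually_elim simp
  qed
  then show ?thesis
  proof eventually_elim
    case (elim x)
    have "linear (\<lambda>v. \<Sum>b\<in>Basis. (v \<bullet> b) * dir_deriv f b x)"
      by (intro linear_compose_sum ballI linearI) (auto simp: algebra_simps)
    from Lipschitz_has_derivative_if_dense[OF f this Z(2)] elim show ?case
      unfolding differentiable_def by blast
  qed
qed

theorem Rademacher:
  fixes f :: "'a::euclidean_space \<Rightarrow> 'b::euclidean_space"
  assumes f: "L-lipschitz_on UNIV f"
  shows "AE x in lborel. f differentiable (at x)"
proof -
  have "AE x in lborel. (\<lambda>x. f x \<bullet> b) differentiable (at x)" if "b \<in> Basis" for b
  proof (rule Rademacher_real)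
    show "L-lipschitz_on UNIV (\<lambda>x. f x \<bullet> b)"
    proof (rule lipschitz_onI)
      fix x y
      have "\<bar>(f x - f y) \<bullet> b\<bar> \<le> norm (f x - f y)" by (rule Basis_le_norm[OF that])
      then show "dist (f x \<bullet> b) (f y \<bullet> b) \<le> L * dist x y"
        using lipschitz_onD[OF f, of x y] by (simp add: dist_norm inner_diff_left)
    qed (rule lipschitz_on_nonneg[OF f])
  qed
  then have "AE x in lborel. \<forall>b\<in>Basis. (\<lambda>x. f x \<bullet> b) differentiable (at x)"
    by (intro AE_finite_allI) auto
  then show ?thesis
    by eventually_elim (subst differentiable_componentwise_within, simp)
qed

section \<open>Mean value inequality for Lipschitz maps\<close>

lemma has_derivative_imp_slope_tendsto:
  fixes f :: "'a::real_normed_vector \<Rightarrow> real"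
  assumes "(f has_derivative A) (at x)"
  shows "((\<lambda>h. (f (x + h *\<^sub>R v) - f x) / h) \<longlongrightarrow> A v) (at 0)"
proof -
  interpret A: bounded_linear A by (rule has_derivative_bounded_linear[OF assms])
  have "((\<lambda>h. x + h *\<^sub>R v) has_derivative (\<lambda>h. h *\<^sub>R v)) (at 0)"
    by (auto intro!: derivative_eq_intros)
  from has_derivative_compose[OF this, of f A]
  have "((\<lambda>h. f (x + h *\<^sub>R v)) has_derivative (\<lambda>h. A (h *\<^sub>R v))) (at 0)"
    using assms by simp
  then have "((\<lambda>h. f (x + h *\<^sub>R v)) has_real_derivative A v) (at 0)"
    by (simp add: has_field_derivative_def A.scaleR mult.commute[of "A v"] mult_commute_abs)
  then show ?thesis by (simp add: DERIV_def)
qed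

text \<open>The segment may consist of points where \<open>G\<close> is not differentiable. Almost
  all points of a tube around it are good, so the inequality holds on average over parallel segments
  starting in a small ball; shrinking the ball recovers the given segment.\<close>

lemma Lipschitz_mean_value:
  fixes G :: "'a::euclidean_space \<Rightarrow> 'b::euclidean_space"
  assumes G: "L-lipschitz_on UNIV G" and "open O'"
    and slope: "\<And>y A. y \<in> O' \<Longrightarrow> (G has_derivative A) (at y) \<Longrightarrow> s \<le> w \<bullet> A v"
    and t: "0 \<le> t" and seg: "\<And>r. 0 \<le> r \<Longrightarrow> r \<le> t \<Longrightarrow> a + r *\<^sub>R v \<in> O'"
  shows "s * t \<le> w \<bullet> (G (a + t *\<^sub>R v) - G a)"
proof -
  define g where "g x = w \<bullet> G x" for x
  define M where "M = norm w * L"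
  have L: "0 \<le> L" by (rule lipschitz_on_nonneg[OF G])
  have g: "M-lipschitz_on UNIV g"
  proof (rule lipschitz_onI)
    fix x y
    have "\<bar>w \<bullet> (G x - G y)\<bar> \<le> norm w * norm (G x - G y)" by (rule Cauchy_Schwarz_ineq2)
    also have "\<dots> \<le> norm w * (L * dist x y)"
      using lipschitz_onD[OF G, of x y] by (intro mult_left_mono) (auto simp: dist_norm)
    finally show "dist (g x) (g y) \<le> M * dist x y"
      by (simp add: g_def M_def dist_real_def inner_diff_right)
  qed (simp add: M_def L)
  have M: "0 \<le> M" by (rule lipschitz_on_nonneg[OF g])
  have cont: "continuous_on UNIV g" by (rule lipschitz_on_continuous_on[OF g])
  note [measurable] = borel_measurable_dir_deriv[OF cont] borel_measurable_continuous_onI[OF cont]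
  have AE: "AE y in lborel. y \<in> O' \<longrightarrow> s \<le> dir_deriv g v y"
    using Rademacher[OF G]
  proof eventually_elim
    case (elim y)
    then obtain A where A: "(G has_derivative A) (at y)" unfolding differentiable_def by blast
    then have "(g has_derivative (\<lambda>z. w \<bullet> A z)) (at y)"
      unfolding g_def by (rule has_derivative_inner_right)
    from dir_deriv_eqI[OF has_derivative_imp_slope_tendsto[OF this]] slope[OF _ A]
    show ?case by simp
  qed
  let ?K = "(\<lambda>r. a + r *\<^sub>R v) ` {0..t}"
  have "compact ?K" by (intro compact_continuous_image continuous_intros) auto
  \<comment> \<open>A whole tube around the compact segment stays in \<open>O'\<close>, which makes
    the parallel segments admissible.\<close>
  then obtain \<delta> where \<delta>: "0 < \<delta>" "{x. infdist x ?K \<le> \<delta>} \<subseteq> O'"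
    using compact_in_open_separated[of ?K O'] seg t \<open>open O'\<close> by (auto simp: image_subset_iff)
  \<comment> \<open>Moving the start of the segment within a ball of radius
    \<open>\<epsilon>\<close> changes the values at both ends by at most
    \<open>M * \<epsilon>\<close> each.\<close>
  have main: "s * t \<le> g (a + t *\<^sub>R v) - g a + 2 * M * \<epsilon>" if \<epsilon>: "0 < \<epsilon>" "\<epsilon> \<le> \<delta>" for \<epsilon>
  proof -
    let ?Q = "cball a \<epsilon>"
    have inO: "x + r *\<^sub>R v \<in> O'" if "x \<in> ?Q" "0 \<le> r" "r \<le> t" for x r
    proof -
      have "infdist (x + r *\<^sub>R v) ?K \<le> dist (x + r *\<^sub>R v) (a + r *\<^sub>R v)"
        using that by (intro infdist_le) auto
      also have "\<dots> \<le> \<delta>" using that \<epsilon> by (simp add: dist_norm norm_minus_commute)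
      finally show ?thesis using \<delta> by blast
    qed
    define m where "m = measure lborel ?Q"
    have m: "0 < m" unfolding m_def using content_cball_pos[OF \<epsilon>(1), of a] by simp
    \<comment> \<open>Averaging over a small ball makes the increment a differentiable function of the step length.\<close>
    define \<Phi> where "\<Phi> r = (\<integral>x. indicator ?Q x * g (x + r *\<^sub>R v) \<partial>lborel)" for r
    have ib: "integrable lborel (\<lambda>x. indicator ?Q x * k x)" if "continuous_on UNIV k" for k :: "'a \<Rightarrow> real"
      using borel_integrable_compact[OF compact_cball continuous_on_subset[OF that subset_UNIV], of a \<epsilon>]
      by (simp add: if_distrib indicator_def mult.commute cong: if_cong)
    have ig: "integrable lborel (\<lambda>x. indicator ?Q x * g (x + r *\<^sub>R v))" for r
      by (intro ib continuous_on_compose2[OF cont] continuous_intros) auto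
    have md: "(\<lambda>x. indicator ?Q x * dir_deriv g v (x + r *\<^sub>R v)) \<in> borel_measurable borel" for r
      by (intro borel_measurable_times borel_measurable_indicator
          measurable_compose[OF _ borel_measurable_dir_deriv[OF cont]]) auto
    have D: "(\<Phi> has_real_derivative (\<integral>x. indicator ?Q x * dir_deriv g v (x + r *\<^sub>R v) \<partial>lborel)) (at r)" for r
      unfolding DERIV_def tendsto_at_iff_sequentially
    proof (intro allI impI)
      fix X :: "nat \<Rightarrow> real" assume X: "\<forall>i. X i \<in> UNIV - {0}" "X \<longlonglongrightarrow> 0"
      define sl where "sl i x = (g (x + X i *\<^sub>R v) - g x) / X i" for i x
      have "AE x in lborel. (\<lambda>i. sl i x) \<longlonglongrightarrow> dir_deriv g v x"
        unfolding sl_def using X by (intro AE_LIMSEQ_dir_deriv[OF g]) auto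
      from lborel_AE_translate[OF this, of "r *\<^sub>R v"]
      have *: "AE x in lborel. (\<lambda>i. sl i (x + r *\<^sub>R v)) \<longlonglongrightarrow> dir_deriv g v (x + r *\<^sub>R v)"
        by (simp add: add.commute)
      have "(\<lambda>i. \<integral>x. indicator ?Q x * sl i (x + r *\<^sub>R v) \<partial>lborel) \<longlonglongrightarrow> (\<integral>x. indicator ?Q x * dir_deriv g v (x + r *\<^sub>R v) \<partial>lborel)"
      proof (rule integral_dominated_convergence[where w="\<lambda>x. (M * norm v) * indicator ?Q x"])
        show "AE x in lborel. (\<lambda>i. indicator ?Q x * sl i (x + r *\<^sub>R v)) \<longlonglongrightarrow> indicator ?Q x * dir_deriv g v (x + r *\<^sub>R v)"
          using * by eventually_elim (intro tendsto_intros)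
        show "AE x in lborel. norm (indicator ?Q x * sl i (x + r *\<^sub>R v)) \<le> (M * norm v) * indicator ?Q x" for i
          using Lipschitz_slope_bound[OF g, of _ "X i" v] unfolding sl_def
          by (intro AE_I2) (simp split: split_indicator)
        show "(\<lambda>x. indicator ?Q x * sl i (x + r *\<^sub>R v)) \<in> borel_measurable lborel" for i
        proof -
          have "(\<lambda>x. sl i (x + r *\<^sub>R v)) \<in> borel_measurable borel"
            unfolding sl_def using X(1)
            by (intro borel_measurable_continuous_onI continuous_intros continuous_on_compose2[OF cont]) auto
          then show ?thesis
            by (intro borel_measurable_times borel_measurable_indicator) auto
        qed
      qed (auto intro!: md integrable_real_indicator emeasure_bounded_finite)
      moreover have "(\<integral>x. indicator ?Q x * sl i (x + r *\<^sub>R v) \<partial>lborel) = (\<Phi> (r + X i) - \<Phi> r) / X i" for i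
      proof -
        have "(\<integral>x. indicator ?Q x * sl i (x + r *\<^sub>R v) \<partial>lborel)
            = (\<integral>x. (indicator ?Q x * g (x + (r + X i) *\<^sub>R v) - indicator ?Q x * g (x + r *\<^sub>R v)) / X i \<partial>lborel)"
          by (simp add: sl_def algebra_simps)
        then show ?thesis using ig unfolding \<Phi>_def by simp
      qed
      ultimately show "((\<lambda>h. (\<Phi> (r + h) - \<Phi> r) / h) \<circ> X) \<longlonglongrightarrow> (\<integral>x. indicator ?Q x * dir_deriv g v (x + r *\<^sub>R v) \<partial>lborel)"
        by (simp add: o_def)
    qed
    have low: "s * m \<le> (\<integral>x. indicator ?Q x * dir_deriv g v (x + r *\<^sub>R v) \<partial>lborel)" if r: "0 \<le> r" "r \<le> t" for r
    proof -
      have "(\<integral>x. indicator ?Q x * s \<partial>lborel) \<le> (\<integral>x. indicator ?Q x * dir_deriv g v (x + r *\<^sub>R v) \<partial>lborel)"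
      proof (rule integral_mono_AE)
        show "integrable lborel (\<lambda>x. indicator ?Q x * dir_deriv g v (x + r *\<^sub>R v))"
        proof (rule Bochner_Integration.integrable_bound[where f="\<lambda>x. (M * norm v) * indicator ?Q x"])
          have "AE x in lborel. \<bar>dir_deriv g v (x + r *\<^sub>R v)\<bar> \<le> M * norm v"
            using lborel_AE_translate[OF dir_deriv_bound[OF g, of v], of "r *\<^sub>R v"] by (simp add: add.commute)
          then show "AE x in lborel. norm (indicator ?Q x * dir_deriv g v (x + r *\<^sub>R v)) \<le> norm ((M * norm v) * indicator ?Q x)"
            by eventually_elim (use M in \<open>auto split: split_indicator simp: abs_mult\<close>)
        qed (auto intro!: md integrable_real_indicator emeasure_bounded_finite)
        have "AE x in lborel. x + r *\<^sub>R v \<in> O' \<longrightarrow> s \<le> dir_deriv g v (x + r *\<^sub>R v)"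
          using lborel_AE_translate[OF AE, of "r *\<^sub>R v"] by (simp add: add.commute)
        then show "AE x in lborel. indicator ?Q x * s \<le> indicator ?Q x * dir_deriv g v (x + r *\<^sub>R v)"
          by eventually_elim (use inO r in \<open>auto split: split_indicator\<close>)
      qed (auto intro!: integrable_real_indicator emeasure_bounded_finite)
      then show ?thesis by (simp add: m_def mult.commute)
    qed
    have "\<Phi> 0 - s * m * 0 \<le> \<Phi> t - s * m * t"
    proof (rule DERIV_nonneg_imp_nondecreasing[OF t])
      fix r assume r: "0 \<le> r" "r \<le> t"
      show "\<exists>y. ((\<lambda>r. \<Phi> r - s * m * r) has_real_derivative y) (at r) \<and> 0 \<le> y"
        using low[OF r]
        by (intro exI[of _ "(\<integral>x. indicator ?Q x * dir_deriv g v (x + r *\<^sub>R v) \<partial>lborel) - s * m"] conjI)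
           (auto intro!: derivative_eq_intros D)
    qed
    then have "s * m * t \<le> \<Phi> t - \<Phi> 0" by simp
    also have "\<dots> = (\<integral>x. indicator ?Q x * (g (x + t *\<^sub>R v) - g x) \<partial>lborel)"
      unfolding \<Phi>_def using ig[of t] ig[of 0] by (simp add: right_diff_distrib)
    also have "\<dots> \<le> (\<integral>x. indicator ?Q x * (g (a + t *\<^sub>R v) - g a + 2 * M * \<epsilon>) \<partial>lborel)"
    proof (rule integral_mono_AE)
      show "integrable lborel (\<lambda>x. indicator ?Q x * (g (x + t *\<^sub>R v) - g x))"
        by (intro ib continuous_intros continuous_on_compose2[OF cont]) auto
      show "AE x in lborel. indicator ?Q x * (g (x + t *\<^sub>R v) - g x) \<le> indicator ?Q x * (g (a + t *\<^sub>R v) - g a + 2 * M * \<epsilon>)"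
      proof (intro AE_I2)
        fix x
        show "indicator ?Q x * (g (x + t *\<^sub>R v) - g x) \<le> indicator ?Q x * (g (a + t *\<^sub>R v) - g a + 2 * M * \<epsilon>)"
        proof (cases "x \<in> ?Q")
          case True
          have "M * dist x a \<le> M * \<epsilon>" using True M by (intro mult_left_mono) (auto simp: dist_commute)
          moreover have "\<bar>g (x + t *\<^sub>R v) - g (a + t *\<^sub>R v)\<bar> \<le> M * dist x a" "\<bar>g x - g a\<bar> \<le> M * dist x a"
            using lipschitz_onD[OF g, of "x + t *\<^sub>R v" "a + t *\<^sub>R v"] lipschitz_onD[OF g, of x a]
            by (auto simp: dist_norm)
          ultimately show ?thesis using True by auto
        qed simp
      qed
    qed (auto intro!: integrable_real_indicator emeasure_bounded_finite)
    also have "\<dots> = m * (g (a + t *\<^sub>R v) - g a + 2 * M * \<epsilon>)" by (simp add: m_def)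
    finally show ?thesis using m by (simp add: mult.commute[of s] mult.assoc)
  qed
  have "s * t \<le> g (a + t *\<^sub>R v) - g a"
  proof (rule field_le_epsilon)
    fix e :: real assume "0 < e"
    define \<epsilon> where "\<epsilon> = min \<delta> (e / (2 * M + 1))"
    have "0 < \<epsilon>" "\<epsilon> \<le> \<delta>" using \<delta>(1) M \<open>0 < e\<close> by (auto simp: \<epsilon>_def)
    moreover have "2 * M * \<epsilon> \<le> 2 * M * (e / (2 * M + 1))"
      using M by (intro mult_left_mono) (auto simp: \<epsilon>_def)
    moreover have "2 * M * (e / (2 * M + 1)) \<le> e"
      using M \<open>0 < e\<close> by (simp add: divide_le_eq algebra_simps)
    ultimately show "s * t \<le> g (a + t *\<^sub>R v) - g a + e"
      using main[of \<epsilon>] by linarith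
  qed
  then show ?thesis by (simp add: g_def inner_diff_right)
qed

section \<open>Difference quotients and the Clarke derivative\<close>

text \<open>\<open>norm A\<close> is the Frobenius norm, which dominates the operator norm by
  Cauchy-Schwarz in each row.\<close>

lemma norm_matrix_vector_le:
  fixes A :: "real ^ 'm ^ 'n"
  shows "norm (A *v v) \<le> norm A * norm v"
proof -
  have "norm (A *v v) = L2_set (\<lambda>i. \<bar>A $ i \<bullet> v\<bar>) UNIV"
    by (simp add: norm_vec_def[of "A *v v"] matrix_vector_mul_component)
  also have "\<dots> \<le> L2_set (\<lambda>i. norm (A $ i) * norm v) UNIV"
    by (intro L2_set_mono Cauchy_Schwarz_ineq2) auto
  also have "\<dots> = norm A * norm v"
    by (simp add: norm_vec_def[of A] L2_set_left_distrib)
  finally show ?thesis .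
qed

text \<open>A crude constant is enough: the bound serves to extract convergent subsequences of
  Jacobians.\<close>

lemma norm_matrix_le:
  fixes A :: "real ^ 'm ^ 'n"
  assumes "\<And>v. norm (A *v v) \<le> K * norm v"
  shows "norm A \<le> real CARD('n) * (real CARD('m) * K)"
proof -
  have entry: "\<bar>A $ i $ j\<bar> \<le> K" for i j
  proof -
    have "\<bar>A $ i $ j\<bar> = \<bar>(A *v axis j 1) $ i\<bar>"
      by (simp add: matrix_vector_mul_component inner_axis)
    also have "\<dots> \<le> norm (A *v axis j 1)" by (rule component_le_norm_cart)
    also have "\<dots> \<le> K" using assms[of "axis j 1"] by simp
    finally show ?thesis .
  qed
  have "norm A \<le> (\<Sum>i\<in>UNIV. norm (A $ i))"
    unfolding norm_vec_def[of A] by (rule L2_set_le_sum) simp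
  also have "\<dots> \<le> (\<Sum>i\<in>(UNIV::'n set). real CARD('m) * K)"
  proof (rule sum_mono)
    fix i
    have "norm (A $ i) \<le> (\<Sum>j\<in>UNIV. \<bar>A $ i $ j\<bar>)" by (rule norm_le_l1_cart)
    also have "\<dots> \<le> (\<Sum>j\<in>(UNIV::'m set). K)" by (intro sum_mono entry)
    finally show "norm (A $ i) \<le> real CARD('m) * K" by simp
  qed
  finally show ?thesis by simp
qed

lemma convex_half_space: "convex half_space"
  unfolding half_space_def convex_def
  by (auto intro!: add_nonneg_nonneg mult_nonneg_nonneg)

lemma closed_half_space: "closed half_space"
  unfolding half_space_def by (intro closed_Collect_le continuous_intros)

lemma openin_half_space_cball:
  assumes "openin (top_of_set half_space) U" "x \<in> U"
  obtains r where "0 < r" "cball x r \<inter> half_space \<subseteq> U"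
  using assms unfolding openin_contains_cball by blast

text \<open>Pairing \<open>G\<close> with the fixed vector \<open>A v\<close> gives a real function
  whose slopes tend to the square of \<open>norm (A v)\<close> and are bounded by
  \<open>norm (A v) * L * norm v\<close>; one factor cancels.\<close>

lemma has_derivative_norm_le:
  fixes G :: "'a::real_normed_vector \<Rightarrow> 'b::real_inner"
  assumes G: "L-lipschitz_on UNIV G" and A: "(G has_derivative A) (at y)"
  shows "norm (A v) \<le> L * norm v"
proof -
  have "((\<lambda>x. A v \<bullet> G x) has_derivative (\<lambda>z. A v \<bullet> A z)) (at y)"
    by (rule has_derivative_inner_right[OF A])
  from has_derivative_imp_slope_tendsto[OF this]
  have "((\<lambda>h. (A v \<bullet> G (y + h *\<^sub>R v) - A v \<bullet> G y) / h) \<longlongrightarrow> A v \<bullet> A v) (at 0)" .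
  moreover have "(norm (A v) * L)-lipschitz_on UNIV (\<lambda>x. A v \<bullet> G x)"
  proof (rule lipschitz_onI)
    fix x y
    have "\<bar>A v \<bullet> (G x - G y)\<bar> \<le> norm (A v) * norm (G x - G y)" by (rule Cauchy_Schwarz_ineq2)
    also have "\<dots> \<le> norm (A v) * (L * dist x y)"
      using lipschitz_onD[OF G, of x y] by (intro mult_left_mono) (auto simp: dist_norm)
    finally show "dist (A v \<bullet> G x) (A v \<bullet> G y) \<le> norm (A v) * L * dist x y"
      by (simp add: dist_real_def inner_diff_right)
  qed (use lipschitz_on_nonneg[OF G] in simp)
  then have "(A v \<bullet> G (y + h *\<^sub>R v) - A v \<bullet> G y) / h \<le> norm (A v) * L * norm v" for h
    by (rule order_trans[OF abs_ge_self Lipschitz_slope_bound])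
  ultimately have "A v \<bullet> A v \<le> norm (A v) * L * norm v"
    by (intro tendsto_upperbound) auto
  then have "norm (A v) * norm (A v) \<le> norm (A v) * (L * norm v)"
    by (simp add: dot_square_norm power2_eq_square mult.assoc)
  then show ?thesis
    using lipschitz_on_nonneg[OF G] by (cases "A v = 0") auto
qed

text \<open>Pairs \<open>(v, w)\<close> of a direction in the domain and a direction in the target. For immersions
  every unit vector \<open>v\<close> gets a suitable \<open>w\<close>, for submersions every unit vector \<open>w\<close> gets a suitable
  \<open>v\<close>.\<close>

definition expanding_on ::
  "((real ^ 'm) \<times> (real ^ 'n)) set \<Rightarrow> real \<Rightarrow> (real ^ 'm) set \<Rightarrow> (real ^ 'm \<Rightarrow> real ^ 'n) \<Rightarrow> bool" where
  "expanding_on R c S F \<longleftrightarrow>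
     (\<forall>(v, w)\<in>R. \<forall>y t. 0 \<le> t \<and> y \<in> S \<and> y + t *\<^sub>R v \<in> S \<longrightarrow> c * t \<le> w \<bullet> (F (y + t *\<^sub>R v) - F y))"

lemma expanding_on_subset: "expanding_on R c S F \<Longrightarrow> T \<subseteq> S \<Longrightarrow> expanding_on R c T F"
  unfolding expanding_on_def by blast

lemma expanding_onD:
  "expanding_on R c S F \<Longrightarrow> (v, w) \<in> R \<Longrightarrow> 0 \<le> t \<Longrightarrow> y \<in> S \<Longrightarrow> y + t *\<^sub>R v \<in> S \<Longrightarrow>
     c * t \<le> w \<bullet> (F (y + t *\<^sub>R v) - F y)"
  unfolding expanding_on_def by blast

text \<open>Upper semicontinuity of the Clarke derivative gives the bound for all derivatives near \<open>x\<close>;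
  the mean value inequality turns it into a bound for difference quotients. To have a globally
  Lipschitz function on the whole space, \<open>F\<close> is composed with the projection onto a compact convex
  neighbourhood of \<open>x\<close> in the half space.\<close>

lemma expanding_on_if_clarke:
  fixes F :: "real ^ 'm::{finite,linorder} \<Rightarrow> real ^ 'n"
  assumes U: "openin (top_of_set half_space) U" "x \<in> U"
    and F: "0 < r0" "L-lipschitz_on (ball x r0 \<inter> half_space) F"
    and R: "\<And>v w. (v, w) \<in> R \<Longrightarrow> norm v \<le> 1 \<and> norm w \<le> 1"
    and D: "\<And>v w A. (v, w) \<in> R \<Longrightarrow> A \<in> clarke_derivative U F x \<Longrightarrow> c \<le> w \<bullet> (A *v v)"
    and "c' < c"
  obtains r where "0 < r" "expanding_on R c' (ball x r \<inter> half_space) F"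
proof -
  obtain r1 where r1: "0 < r1" "cball x r1 \<inter> half_space \<subseteq> U"
    using openin_half_space_cball[OF U] .
  define r2 where "r2 = min r1 (r0 / 2)"
  have r2: "0 < r2" "cball x r2 \<inter> half_space \<subseteq> U" "cball x r2 \<subseteq> ball x r0"
    using r1 F(1) by (auto simp: r2_def)
  define C where "C = cball x r2 \<inter> half_space"
  define k where "k = Min (UNIV :: 'm set)"
  have xH: "x \<in> half_space" using U openin_imp_subset by blast
  have "x \<in> C" using r2(1) xH by (simp add: C_def)
  then have "C \<noteq> {}" by blast
  have C: "convex C" "closed C" "C \<subseteq> U"
    using r2(2) by (auto simp: C_def convex_Int convex_half_space closed_Int closed_half_space)
  define G where "G = F \<circ> closest_point C"
  have GF: "G y = F y" if "y \<in> C" for y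
    using that by (simp add: G_def closest_point_self)
  have G: "L-lipschitz_on UNIV G"
  proof (rule lipschitz_onI)
    fix y z
    have "closest_point C y \<in> ball x r0 \<inter> half_space" for y
      using closest_point_in_set[OF C(2) \<open>C \<noteq> {}\<close>, of y] r2(3) unfolding C_def by blast
    then have "dist (G y) (G z) \<le> L * dist (closest_point C y) (closest_point C z)"
      unfolding G_def o_def by (intro lipschitz_onD[OF F(2)]) auto
    also have "\<dots> \<le> L * dist y z"
      using closest_point_lipschitz[OF C(1,2) \<open>C \<noteq> {}\<close>] lipschitz_on_nonneg[OF F(2)] by (intro mult_left_mono)
    finally show "dist (G y) (G z) \<le> L * dist y z" .
  qed (rule lipschitz_on_nonneg[OF F(2)])
  \<comment> \<open>In the open half ball \<open>P r\<close>, for \<open>r \<le> r2\<close>, the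
    projection is the identity, so two-sided derivatives of \<open>G\<close> there are derivatives
    of \<open>F\<close> within \<open>U\<close> and enter the Clarke derivative.\<close>
  define P where "P r = ball x r \<inter> {y. 0 < y $ k}" for r
  have openP: "open (P r)" for r
    unfolding P_def by (intro open_Int open_ball open_Collect_less continuous_intros)
  have convexP: "convex (P r)" for r
  proof -
    have "{y. 0 < y $ k} = {y. (axis k 1 :: (real, 'm) vec) \<bullet> y > 0}"
      by (simp add: inner_axis' )
    then show ?thesis unfolding P_def by (simp add: convex_Int convex_halfspace_gt)
  qed
  have PC: "P r \<subseteq> C" if "r \<le> r2" for r
    using that by (auto simp: P_def C_def half_space_def k_def)
  have jac: "F differentiable (at y within U)" "jacobian F (at y within U) *v v = A v"
    if A: "(G has_derivative A) (at y)" and y: "y \<in> P r2" for y v A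
  proof -
    have "y \<in> interior U"
      using y openP PC[of r2] C(3) by (meson interiorI order_refl order_trans)
    then have at: "at y within U = at y" by (rule at_within_interior)
    have "(F has_derivative A) (at y)"
      by (rule has_derivative_transform_within_open[OF A openP[of r2] y]) (use PC GF in blast)
    then show "F differentiable (at y within U)" "jacobian F (at y within U) *v v = A v"
      unfolding at jacobian_def
      by (auto simp: differentiable_def matrix_works has_derivative_linear
          simp flip: frechet_derivative_at)
  qed
  have "\<exists>r>0. r \<le> r2 \<and> (\<forall>y\<in>P r. \<forall>A. (G has_derivative A) (at y) \<longrightarrow> (\<forall>(v, w)\<in>R. c' \<le> w \<bullet> A v))"
  proof (rule ccontr)
    \<comment> \<open>Violations arbitrarily close to \<open>x\<close> have bounded Jacobians, since
      \<open>G\<close> is Lipschitz; a limit of a subsequence is an element of the Clarke derivative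
      at \<open>x\<close> that contradicts \<open>D\<close>.\<close>
    assume *: "\<not> ?thesis"
    have "\<exists>y A v w. y \<in> P (min r2 (inverse (real (Suc n)))) \<and> (G has_derivative A) (at y) \<and> (v, w) \<in> R \<and> w \<bullet> A v < c'" for n
    proof -
      have "0 < min r2 (inverse (real (Suc n)))" "min r2 (inverse (real (Suc n))) \<le> r2"
        using r2(1) by auto
      with * have "\<not> (\<forall>y\<in>P (min r2 (inverse (real (Suc n)))). \<forall>A. (G has_derivative A) (at y) \<longrightarrow>
          (\<forall>(v, w)\<in>R. c' \<le> w \<bullet> A v))"
        by blast
      then show ?thesis unfolding case_prod_unfold Ball_def not_le[symmetric] by (metis prod.collapse)
    qed
    then obtain Y A V W where YA: "\<And>n. Y n \<in> P (min r2 (inverse (real (Suc n))))"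
        "\<And>n. (G has_derivative A n) (at (Y n))" "\<And>n. (V n, W n) \<in> R" "\<And>n. W n \<bullet> A n (V n) < c'"
      by metis
    have YP: "Y n \<in> P r2" for n using YA(1)[of n] by (auto simp: P_def)
    define J where "J n = jacobian F (at (Y n) within U)" for n
    have J: "J n *v v = A n v" for n v unfolding J_def by (rule jac(2)[OF YA(2) YP])
    have "norm (J n) \<le> real CARD('n) * (real CARD('m) * L)" for n
      by (rule norm_matrix_le) (simp add: J has_derivative_norm_le[OF G YA(2)])
    then have "bounded (range J)" by (auto simp: bounded_iff)
    then obtain B s where s: "strict_mono s" "(J \<circ> s) \<longlonglongrightarrow> B"
      using bounded_imp_convergent_subsequence by metis
    have "Y \<longlonglongrightarrow> x"
    proof (rule metric_tendsto_imp_tendsto[OF LIMSEQ_inverse_real_of_nat])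
      show "\<forall>\<^sub>F n in sequentially. dist (Y n) x \<le> dist (inverse (real (Suc n))) 0"
      proof (intro always_eventually allI)
        fix n
        have "dist x (Y n) < inverse (real (Suc n))" using YA(1)[of n] by (simp add: P_def)
        then show "dist (Y n) x \<le> dist (inverse (real (Suc n))) 0" by (simp add: dist_commute)
      qed
    qed
    then have "(Y \<circ> s) \<longlonglongrightarrow> x" using s(1) by (rule LIMSEQ_subseq_LIMSEQ)
    moreover have "Y n \<in> U" for n using YP PC[of r2] C(3) by blast
    moreover have "F differentiable (at (Y n) within U)" for n by (rule jac(1)[OF YA(2) YP])
    ultimately have "B \<in> clarke_derivative U F x"
      using s(2) unfolding clarke_derivative_def J_def
      by (intro hull_inc CollectI exI[of _ "Y \<circ> s"]) (auto simp: o_def)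
    from D[OF _ this] have B: "c \<le> w \<bullet> (B *v v)" if "(v, w) \<in> R" for v w using that by blast
    \<comment> \<open>The pairs \<open>V n\<close>, \<open>W n\<close> need not converge: their
      norms are at most 1, so closeness of the matrices to \<open>B\<close> suffices, uniformly over
      \<open>R\<close>.\<close>
    obtain n where n: "norm (J (s n) - B) < c - c'"
      using LIMSEQ_D[OF s(2), of "c - c'"] \<open>c' < c\<close> by auto
    let ?v = "V (s n)" and ?w = "W (s n)"
    have "c - c' < ?w \<bullet> (B *v ?v) - ?w \<bullet> (J (s n) *v ?v)"
      using B[OF YA(3)[of "s n"]] YA(4)[of "s n"] by (simp add: J)
    also have "\<dots> = ?w \<bullet> ((B - J (s n)) *v ?v)"
      by (simp add: inner_diff_right matrix_vector_mult_diff_rdistrib)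
    also have "\<dots> \<le> norm ?w * (norm (B - J (s n)) * norm ?v)"
      by (rule order_trans[OF norm_cauchy_schwarz mult_left_mono[OF norm_matrix_vector_le]]) simp
    also have "\<dots> \<le> 1 * (norm (B - J (s n)) * 1)"
      using R[OF YA(3)[of "s n"]] by (intro mult_mono) auto
    finally show False using n by (simp add: norm_minus_commute)
  qed
  then obtain r where r: "0 < r" "r \<le> r2"
    "\<And>y A v w. y \<in> P r \<Longrightarrow> (G has_derivative A) (at y) \<Longrightarrow> (v, w) \<in> R \<Longrightarrow> c' \<le> w \<bullet> A v"
    by blast
  have inner: "c' * t \<le> w \<bullet> (G (a + t *\<^sub>R v) - G a)"
    if vw: "(v, w) \<in> R" and a: "a \<in> P r" "a + t *\<^sub>R v \<in> P r" and t: "0 \<le> t" for v w a t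
  proof (rule Lipschitz_mean_value[OF G openP[of r] _ t])
    fix s assume s: "0 \<le> s" "s \<le> t"
    show "a + s *\<^sub>R v \<in> P r"
    proof (cases "t = 0")
      case False
      have "(1 - s / t) *\<^sub>R a + (s / t) *\<^sub>R (a + t *\<^sub>R v) \<in> P r"
        using s t False by (intro convexD_alt[OF convexP a]) auto
      then show ?thesis using False by (simp add: algebra_simps)
    qed (use s a in simp)
  qed (use r(3) vw in blast)
  have "expanding_on R c' (ball x r \<inter> half_space) F"
    unfolding expanding_on_def
  proof (clarify)
    fix v w y t
    assume vw: "(v, w) \<in> R" and t: "0 \<le> t"
      and y: "y \<in> ball x r" "y \<in> half_space" "y + t *\<^sub>R v \<in> ball x r" "y + t *\<^sub>R v \<in> half_space"
    \<comment> \<open>Segments touching the boundary hyperplane are pushed inwards by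
      \<open>\<delta> *\<^sub>R e\<close>; the inequality is kept as \<open>\<delta>\<close> tends
      to 0.\<close>
    define e where "e = (axis k 1 :: (real, 'm) vec)"
    have shift: "\<forall>\<^sub>F \<delta> in at_right 0. z + \<delta> *\<^sub>R e \<in> P r" if z: "z \<in> ball x r" "z \<in> half_space" for z
    proof -
      have "((\<lambda>\<delta>. z + \<delta> *\<^sub>R e) \<longlongrightarrow> z + 0 *\<^sub>R e) (at_right 0)"
        by (intro tendsto_intros)
      then have "\<forall>\<^sub>F \<delta> in at_right 0. z + \<delta> *\<^sub>R e \<in> ball x r"
        using z(1) by (intro topological_tendstoD) auto
      moreover have "\<forall>\<^sub>F \<delta> in at_right 0. (0::real) < \<delta>" by (simp add: eventually_at_right_less)
      ultimately show ?thesis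
        by eventually_elim
           (use z(2) in \<open>auto simp: P_def half_space_def k_def e_def intro: add_nonneg_pos\<close>)
    qed
    have "\<forall>\<^sub>F \<delta> in at_right 0. c' * t \<le> w \<bullet> (G (y + \<delta> *\<^sub>R e + t *\<^sub>R v) - G (y + \<delta> *\<^sub>R e))"
      using shift[OF y(1,2)] shift[OF y(3,4)]
      by eventually_elim (rule inner[OF vw _ _ t], auto simp: ac_simps)
    moreover have "((\<lambda>\<delta>. w \<bullet> (G (y + \<delta> *\<^sub>R e + t *\<^sub>R v) - G (y + \<delta> *\<^sub>R e))) \<longlongrightarrow>
        w \<bullet> (G (y + 0 *\<^sub>R e + t *\<^sub>R v) - G (y + 0 *\<^sub>R e))) (at_right 0)"
    proof -
      have "isCont G z" for z
        using lipschitz_on_continuous_on[OF G] by (simp add: continuous_on_eq_continuous_at)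
      then show ?thesis
        by (intro tendsto_intros isCont_tendsto_compose[of _ G])
    qed
    ultimately have "c' * t \<le> w \<bullet> (G (y + 0 *\<^sub>R e + t *\<^sub>R v) - G (y + 0 *\<^sub>R e))"
      by (intro tendsto_lowerbound) auto
    moreover have "y \<in> C" "y + t *\<^sub>R v \<in> C"
      using y r(2) by (auto simp: C_def)
    ultimately show "c' * t \<le> w \<bullet> (F (y + t *\<^sub>R v) - F y)"
      by (simp add: GF)
  qed
  with r(1) show thesis by (rule that)
qed

text \<open>No derivative occurs: a perturbation with Lipschitz constant \<open>e\<close> changes
  the increment over a step \<open>t\<close> by at most \<open>e * t\<close>.\<close>

lemma expanding_on_perturb:
  assumes F: "expanding_on R c S F"
    and R: "\<And>v w. (v, w) \<in> R \<Longrightarrow> norm v \<le> 1 \<and> norm w \<le> 1"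
    and H: "e-lipschitz_on S (\<lambda>x. H x - F x)"
  shows "expanding_on R (c - e) S H"
  unfolding expanding_on_def
proof (clarify)
  fix v w y t
  assume vw: "(v, w) \<in> R" and t: "0 \<le> t" and y: "y \<in> S" "y + t *\<^sub>R v \<in> S"
  let ?d = "(H (y + t *\<^sub>R v) - F (y + t *\<^sub>R v)) - (H y - F y)"
  have e: "0 \<le> e" by (rule lipschitz_on_nonneg[OF H])
  have "\<bar>w \<bullet> ?d\<bar> \<le> norm w * norm ?d" by (rule Cauchy_Schwarz_ineq2)
  also have "\<dots> \<le> 1 * (e * (t * norm v))"
    using lipschitz_onD[OF H y(2,1)] R[OF vw] t
    by (intro mult_mono) (auto simp: dist_norm)
  also have "\<dots> \<le> e * t"
    using R[OF vw] t e by (auto intro!: mult_left_mono simp: mult_left_le)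
  finally have "- (e * t) \<le> w \<bullet> ?d" by (simp add: abs_le_iff)
  moreover have "w \<bullet> (H (y + t *\<^sub>R v) - H y) = w \<bullet> (F (y + t *\<^sub>R v) - F y) + w \<bullet> ?d"
    by (simp add: inner_diff_right)
  ultimately show "(c - e) * t \<le> w \<bullet> (H (y + t *\<^sub>R v) - H y)"
    using expanding_onD[OF F vw t y] by (simp add: left_diff_distrib)
qed

text \<open>At a boundary point \<open>v\<close> may point outwards; then one uses the points \<open>y + t v\<close> with negative
  \<open>t\<close>.\<close>

lemma expanding_on_derivative:
  fixes H :: "real ^ 'm::{finite,linorder} \<Rightarrow> real ^ 'n"
  assumes H: "expanding_on R c (ball x r \<inter> half_space) H" and vw: "(v, w) \<in> R"
    and y: "y \<in> ball x r" "y \<in> half_space"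
    and A: "(H has_derivative A) (at y within half_space)"
  shows "c \<le> w \<bullet> A v"
proof -
  define T where "T = (if 0 \<le> v $ Min UNIV then {0..} else {..0::real})"
  have T: "y + t *\<^sub>R v \<in> half_space" if "t \<in> T" for t
  proof -
    have "0 \<le> t * v $ Min UNIV"
      using that by (auto simp: T_def zero_le_mult_iff split: if_splits)
    then show ?thesis using y(2) by (simp add: half_space_def)
  qed
  define \<phi> where "\<phi> t = w \<bullet> H (y + t *\<^sub>R v)" for t
  have "((\<lambda>t. y + t *\<^sub>R v) has_derivative (\<lambda>t. t *\<^sub>R v)) (at 0 within T)"
    by (auto intro!: derivative_eq_intros)
  moreover have "(H has_derivative A) (at (y + 0 *\<^sub>R v) within (\<lambda>t. y + t *\<^sub>R v) ` T)"
    using T by (auto intro: has_derivative_subset[OF A])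
  ultimately have "((\<lambda>t. H (y + t *\<^sub>R v)) has_derivative (\<lambda>t. A (t *\<^sub>R v))) (at 0 within T)"
    by (rule has_derivative_in_compose)
  then have "(\<phi> has_derivative (\<lambda>t. w \<bullet> A (t *\<^sub>R v))) (at 0 within T)"
    unfolding \<phi>_def by (rule has_derivative_inner_right)
  moreover have "(\<lambda>t. w \<bullet> A (t *\<^sub>R v)) = (*) (w \<bullet> A v)"
    using linear_cmul[OF has_derivative_linear[OF A]] by (auto simp: mult.commute)
  ultimately have "(\<phi> has_real_derivative w \<bullet> A v) (at 0 within T)"
    by (simp add: has_field_derivative_def)
  then have lim: "((\<lambda>t. (\<phi> t - \<phi> 0) / t) \<longlongrightarrow> w \<bullet> A v) (at 0 within T)"
    by (simp add: has_field_derivative_iff)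
  have "((\<lambda>t. y + t *\<^sub>R v) \<longlongrightarrow> y + 0 *\<^sub>R v) (at 0 within T)"
    by (intro tendsto_intros)
  then have "\<forall>\<^sub>F t in at 0 within T. y + t *\<^sub>R v \<in> ball x r"
    using y(1) by (intro topological_tendstoD) auto
  moreover have "\<forall>\<^sub>F t in at 0 within T. t \<in> T \<and> t \<noteq> 0"
    by (auto simp: eventually_at_filter)
  ultimately have "\<forall>\<^sub>F t in at 0 within T. c \<le> (\<phi> t - \<phi> 0) / t"
  proof eventually_elim
    case (elim t)
    show ?case
    proof (cases "0 < t")
      case True
      have "c * t \<le> w \<bullet> (H (y + t *\<^sub>R v) - H y)"
        using True elim y T by (intro expanding_onD[OF H vw]) auto
      then show ?thesis using True by (simp add: \<phi>_def inner_diff_right pos_le_divide_eq)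
    next
      case False
      have "c * (- t) \<le> w \<bullet> (H (y + t *\<^sub>R v + (- t) *\<^sub>R v) - H (y + t *\<^sub>R v))"
        using False elim y T by (intro expanding_onD[OF H vw]) auto
      then show ?thesis using False elim by (simp add: \<phi>_def inner_diff_right neg_le_divide_eq)
    qed
  qed
  moreover have "at 0 within T \<noteq> bot"
    by (simp add: T_def at_within_Ici_at_right at_within_Iic_at_left)
  ultimately show ?thesis
    using lim by (intro tendsto_lowerbound)
qed

section \<open>Singular values\<close>

lemma inner_gram:
  fixes A :: "real ^ 'm ^ 'n"
  shows "((transpose A ** A) *v u) \<bullet> v = (A *v u) \<bullet> (A *v v)"
  by (metis dot_lmul_matrix inner_commute matrix_vector_mul_assoc vector_transpose_matrix)

lemma inner_transpose_left:
  fixes A :: "real ^ 'm ^ 'n"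
  shows "(transpose A *v w) \<bullet> v = w \<bullet> (A *v v)"
  by (metis dot_lmul_matrix inner_commute vector_transpose_matrix transpose_transpose)

text \<open>A minimiser \<open>v\<close> of \<open>norm (A *v u)\<close> on the unit sphere of an
  invariant subspace is an eigenvector of the Gram matrix, and the minimum \<open>s\<close> is the
  corresponding singular value.\<close>

lemma gram_eigenvector_exists:
  fixes A :: "real ^ 'm ^ 'n"
  assumes V: "subspace V" "V \<noteq> {0}"
    and inv: "\<And>v. v \<in> V \<Longrightarrow> (transpose A ** A) *v v \<in> V"
  obtains s v where "0 \<le> s" "v \<in> V" "norm v = 1" "(transpose A ** A) *v v = s\<^sup>2 *\<^sub>R v"
    "\<And>u. u \<in> V \<Longrightarrow> s * norm u \<le> norm (A *v u)"
proof -
  obtain x where x: "x \<in> V" "x \<noteq> 0" using V subspace_0 by blast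
  then have "x /\<^sub>R norm x \<in> V \<inter> sphere 0 1" using V(1) by (simp add: subspace_scale)
  then have "V \<inter> sphere 0 1 \<noteq> {}" by blast
  moreover have "compact (V \<inter> sphere 0 1)"
    using closed_subspace[OF V(1)] by (intro closed_Int_compact) auto
  moreover have "continuous_on (V \<inter> sphere 0 1) (\<lambda>u. norm (A *v u))"
    by (intro continuous_intros linear_continuous_on linear_conv_bounded_linear[THEN iffD1]
        matrix_vector_mul_linear)
  ultimately have "\<exists>v\<in>V \<inter> sphere 0 1. \<forall>u\<in>V \<inter> sphere 0 1. norm (A *v v) \<le> norm (A *v u)"
    by (intro continuous_attains_inf)
  then obtain v where v': "v \<in> V \<inter> sphere 0 1" "\<forall>u\<in>V \<inter> sphere 0 1. norm (A *v v) \<le> norm (A *v u)"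
    by blast
  then have v: "v \<in> V" "norm v = 1" by auto
  have min: "norm (A *v v) \<le> norm (A *v u)" if "u \<in> V" "norm u = 1" for u
    using v'(2) that by simp
  define s where "s = norm (A *v v)"
  have le: "s * norm u \<le> norm (A *v u)" if u: "u \<in> V" for u
  proof (cases "u = 0")
    case False
    have "s \<le> norm (A *v (u /\<^sub>R norm u))"
      unfolding s_def using u False V(1) by (intro min) (auto simp: subspace_scale)
    also have "\<dots> = norm (A *v u) / norm u"
      by (simp add: matrix_vector_mult_scaleR divide_inverse mult.commute)
    finally show ?thesis using False by (simp add: le_divide_eq)
  qed simp
  \<comment> \<open>The residual of the eigenvalue equation. By minimality the form
    \<open>(norm (A *v u))\<^sup>2 - s\<^sup>2 * (norm u)\<^sup>2\<close> is nonnegative on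
    \<open>V\<close> and vanishes at \<open>v\<close>; along \<open>v + t *\<^sub>R z\<close> its
    linear coefficient is \<open>2 * (z \<bullet> z)\<close>, which must therefore vanish.\<close>
  define z where "z = (transpose A ** A) *v v - s\<^sup>2 *\<^sub>R v"
  have zV: "z \<in> V" unfolding z_def using V(1) v inv by (simp add: subspace_diff subspace_scale)
  define Q where "Q = (norm (A *v z))\<^sup>2 - s\<^sup>2 * (norm z)\<^sup>2"
  have quad: "0 \<le> 2 * t * (z \<bullet> z) + t\<^sup>2 * Q" for t
  proof -
    have "v + t *\<^sub>R z \<in> V" using V(1) v zV by (simp add: subspace_add subspace_scale)
    from le[OF this] have sq: "(s * norm (v + t *\<^sub>R z))\<^sup>2 \<le> (norm (A *v (v + t *\<^sub>R z)))\<^sup>2"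
      by (intro power_mono) (auto simp: s_def)
    have expand: "(norm (a + t *\<^sub>R b))\<^sup>2 = (norm a)\<^sup>2 + 2 * t * (a \<bullet> b) + t\<^sup>2 * (norm b)\<^sup>2"
      for a b :: "real ^ 'k"
      unfolding power2_norm_eq_inner
      by (simp add: inner_add_left inner_add_right inner_commute power2_eq_square algebra_simps)
    have "(norm (v + t *\<^sub>R z))\<^sup>2 = 1 + 2 * t * (v \<bullet> z) + t\<^sup>2 * (norm z)\<^sup>2"
      using v(2) expand[of v z] by simp
    moreover have "(norm (A *v (v + t *\<^sub>R z)))\<^sup>2
        = s\<^sup>2 + 2 * t * ((A *v v) \<bullet> (A *v z)) + t\<^sup>2 * (norm (A *v z))\<^sup>2"
      using expand[of "A *v v" "A *v z"]
      by (simp add: s_def matrix_vector_right_distrib matrix_vector_mult_scaleR)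
    moreover have zz: "z \<bullet> z = (A *v v) \<bullet> (A *v z) - s\<^sup>2 * (v \<bullet> z)"
      by (simp add: z_def[symmetric] inner_gram[symmetric] flip: inner_scaleR_left inner_diff_left)
    moreover have "2 * t * ((A *v v) \<bullet> (A *v z)) = 2 * t * (z \<bullet> z) + s\<^sup>2 * (2 * t * (v \<bullet> z))"
      unfolding zz by (simp add: algebra_simps)
    ultimately have "2 * t * (z \<bullet> z) + t\<^sup>2 * (norm (A *v z))\<^sup>2 - s\<^sup>2 * (t\<^sup>2 * (norm z)\<^sup>2) \<ge> 0"
      using sq by (simp add: power_mult_distrib distrib_left)
    then show ?thesis
      by (simp add: Q_def algebra_simps)
  qed
  have "z \<bullet> z = 0"
  proof (rule ccontr)
    assume "z \<bullet> z \<noteq> 0"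
    then have pos: "0 < z \<bullet> z" by simp
    \<comment> \<open>Negative, and so small that the quadratic term is at most half the size of the
      linear one.\<close>
    define t where "t = - (z \<bullet> z) / (\<bar>Q\<bar> + 1)"
    have "t\<^sup>2 * Q \<le> t\<^sup>2 * (\<bar>Q\<bar> + 1)" by (intro mult_left_mono) auto
    also have "\<dots> = - t * (z \<bullet> z)" by (simp add: t_def power2_eq_square)
    finally have "0 \<le> t * (z \<bullet> z)" using quad[of t] by simp
    moreover have "t < 0" using pos by (simp add: t_def divide_neg_pos)
    ultimately show False using pos by (simp add: zero_le_mult_iff)
  qed
  then have "(transpose A ** A) *v v = s\<^sup>2 *\<^sub>R v" by (simp add: z_def)
  with v le show thesis by (intro that[of s v]) (auto simp: s_def)
qed

section \<open>Singular spaces and the counting of singular values\<close>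

abbreviation singular_space :: "real ^ 'm ^ 'n \<Rightarrow> real \<Rightarrow> (real ^ 'm) set" where
  "singular_space A s \<equiv> {v. (transpose A ** A) *v v = s\<^sup>2 *\<^sub>R v}"

lemma subspace_singular_space: "subspace (singular_space A s)"
  by (auto simp: subspace_def matrix_vector_right_distrib matrix_vector_mult_scaleR scaleR_right_distrib
      scaleR_left_commute)

lemma singular_space_orthogonal:
  fixes A :: "real ^ 'm ^ 'n"
  assumes "u \<in> singular_space A s" "v \<in> singular_space A t" "0 \<le> s" "0 \<le> t" "s \<noteq> t"
  shows "u \<bullet> v = 0"
proof -
  have "s\<^sup>2 * (u \<bullet> v) = t\<^sup>2 * (u \<bullet> v)"
    using assms(1,2) inner_gram[of A u v] inner_gram[of A v u] by (simp add: inner_commute)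
  moreover have "s\<^sup>2 \<noteq> t\<^sup>2" using assms(3-5) by simp
  ultimately show ?thesis by simp
qed

lemma dim_Union_singular_spaces:
  fixes A :: "real ^ 'm ^ 'n"
  assumes "finite T" "T \<subseteq> {0..}"
  shows "dim (\<Union>s\<in>T. singular_space A s) = (\<Sum>s\<in>T. singular_mult A s)"
  using assms
proof (induction T)
  case (insert s T)
  have "dim (singular_space A s \<union> (\<Union>s\<in>T. singular_space A s))
      = dim (singular_space A s) + dim (\<Union>s\<in>T. singular_space A s)"
  proof (rule dim_orthogonal_sum)
    fix x y assume "x \<in> singular_space A s" "y \<in> (\<Union>s\<in>T. singular_space A s)"
    then show "x \<bullet> y = 0"
      using insert.hyps insert.prems singular_space_orthogonal[of x A s y] by fastforce
  qed
  then show ?case using insert by (simp add: singular_mult_def)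
qed simp

definition singular_value_set :: "real ^ 'm ^ 'n \<Rightarrow> real set" where
  "singular_value_set A = {s. 0 \<le> s \<and> 0 < singular_mult A s}"

lemma finite_singular_value_set: "finite (singular_value_set (A :: real ^ 'm ^ 'n))"
proof (rule ccontr)
  assume "infinite (singular_value_set A)"
  then obtain T where T: "T \<subseteq> singular_value_set A" "finite T" "card T = Suc CARD('m)"
    using infinite_arbitrarily_large by blast
  have "Suc CARD('m) = (\<Sum>s\<in>T. 1)" using T by simp
  also have "\<dots> \<le> (\<Sum>s\<in>T. singular_mult A s)"
    using T(1) by (intro sum_mono) (auto simp: singular_value_set_def Suc_le_eq)
  also have "\<dots> = dim (\<Union>s\<in>T. singular_space A s)"
    using T by (intro dim_Union_singular_spaces[symmetric]) (auto simp: singular_value_set_def)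
  also have "\<dots> \<le> CARD('m)" using dim_subset_UNIV[of "\<Union>s\<in>T. singular_space A s"] by simp
  finally show False by simp
qed

lemma singular_mult_pos_if_eigenvector:
  assumes "v \<in> singular_space A s" "v \<noteq> 0"
  shows "0 < singular_mult A s"
proof (rule ccontr)
  assume "\<not> 0 < singular_mult A s"
  then have "singular_space A s \<subseteq> {0}" by (simp add: singular_mult_def)
  then show False using assms by blast
qed

text \<open>The orthogonal complement \<open>V\<close> of all singular spaces is invariant under the
  Gram matrix. If it were nonzero, it would contain an eigenvector, which lies in one of these
  spaces and is thus orthogonal to itself.\<close>

lemma sum_singular_mult: "(\<Sum>s\<in>singular_value_set A. singular_mult A s) = CARD('m)"
  for A :: "real ^ 'm ^ 'n"
proof -
  let ?W = "\<Union>s\<in>singular_value_set A. singular_space A s"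
  define V where "V = {x. \<forall>y\<in>?W. x \<bullet> y = 0}"
  have V: "subspace V"
    by (auto simp: V_def subspace_def inner_add_left)
  have inv: "(transpose A ** A) *v v \<in> V" if v: "v \<in> V" for v
    unfolding V_def
  proof (intro CollectI ballI)
    fix y assume y: "y \<in> ?W"
    then obtain s where s: "(transpose A ** A) *v y = s\<^sup>2 *\<^sub>R y" by blast
    have vy: "v \<bullet> y = 0" using v y unfolding V_def by blast
    have "((transpose A ** A) *v v) \<bullet> y = ((transpose A ** A) *v y) \<bullet> v"
      by (metis inner_gram inner_commute)
    also have "\<dots> = s\<^sup>2 * (v \<bullet> y)" by (simp add: s inner_commute)
    finally show "((transpose A ** A) *v v) \<bullet> y = 0"
      using vy by simp
  qed
  have "V = {0}"
  proof (rule ccontr)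
    assume "V \<noteq> {0}"
    from gram_eigenvector_exists[OF V this inv] obtain s v where sv: "0 \<le> s" "v \<in> V" "norm v = 1"
        "(transpose A ** A) *v v = s\<^sup>2 *\<^sub>R v" by metis
    then have "v \<in> singular_space A s" "v \<noteq> 0" by auto
    then have "v \<in> ?W"
      using singular_mult_pos_if_eigenvector sv(1) by (auto simp: singular_value_set_def)
    then have "v \<bullet> v = 0" using sv(2) unfolding V_def by blast
    then show False using sv(3) by simp
  qed
  have "span ?W = UNIV"
  proof (rule ccontr)
    assume "span ?W \<noteq> UNIV"
    then obtain a where a: "a \<noteq> 0" "\<forall>x\<in>span ?W. a \<bullet> x = 0"
      using span_not_UNIV_orthogonal[of ?W] by blast
    then have "a \<in> V" unfolding V_def using span_base[of _ ?W] by blast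
    then show False using \<open>V = {0}\<close> a(1) by blast
  qed
  then have "dim ?W = CARD('m)" using dim_span[of ?W] by simp
  moreover have "dim ?W = (\<Sum>s\<in>singular_value_set A. singular_mult A s)"
    by (rule dim_Union_singular_spaces[OF finite_singular_value_set]) (auto simp: singular_value_set_def)
  ultimately show ?thesis by simp
qed

lemma count_singular_values:
  "count (singular_values A) s = (if s \<in> singular_value_set A then singular_mult A s else 0)"
  unfolding singular_values_def singular_value_set_def[symmetric] count_sum
  using finite_singular_value_set[of A] by (simp add: sum.delta)

lemma set_singular_values: "set_mset (singular_values A) = singular_value_set A"
  by (auto simp: set_mset_def count_singular_values singular_value_set_def)

lemma size_singular_values: "size (singular_values (A :: real ^ 'm ^ 'n)) = CARD('m)"
  unfolding singular_values_def singular_value_set_def[symmetric]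
  by (simp add: size_multiset_sum sum_singular_mult)

text \<open>In a decreasing list the entries that are at least \<open>c\<close> form an initial
  segment.\<close>

lemma le_nth_iff_length_filter:
  fixes c :: "'a::linorder"
  assumes "sorted_wrt (\<ge>) xs" "i < length xs"
  shows "c \<le> xs ! i \<longleftrightarrow> i < length (filter (\<lambda>x. c \<le> x) xs)"
  using assms
proof (induction xs arbitrary: i)
  case (Cons x xs)
  show ?case
  proof (cases "c \<le> x")
    case True
    then show ?thesis using Cons by (cases i) auto
  next
    case False
    then have "\<forall>y\<in>set (x # xs). \<not> c \<le> y" using Cons.prems(1) by auto
    then have "filter (\<lambda>x. c \<le> x) (x # xs) = []" "\<not> c \<le> (x # xs) ! i"
      using nth_mem[OF Cons.prems(2)] by (simp_all only: filter_empty_conv) blast+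
    then show ?thesis by simp
  qed
qed simp

text \<open>Replaces the position in a sorted list by a count in the multiset. A positive
  \<open>c\<close> excludes the default value 0 that is taken for \<open>j\<close> out of
  range.\<close>

lemma le_singular_value_iff:
  assumes "0 < c"
  shows "c \<le> singular_value j A \<longleftrightarrow> 1 \<le> j \<and> j \<le> size (filter_mset (\<lambda>s. c \<le> s) (singular_values A))"
proof -
  define ss where "ss = rev (sorted_list_of_multiset (singular_values A))"
  have ms: "mset ss = singular_values A" by (simp add: ss_def)
  have len: "length (filter (\<lambda>s. c \<le> s) ss) = size (filter_mset (\<lambda>s. c \<le> s) (singular_values A))"
    by (simp flip: ms mset_filter)
  have "sorted_wrt (\<ge>) ss" by (simp add: ss_def sorted_wrt_rev)
  then have "c \<le> ss ! (j - 1) \<longleftrightarrow> j - 1 < length (filter (\<lambda>s. c \<le> s) ss)" if "1 \<le> j" "j \<le> length ss"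
    using that by (intro le_nth_iff_length_filter) auto
  then show ?thesis
    using assms unfolding singular_value_def Let_def ss_def[symmetric] len[symmetric]
    by (auto dest: order_trans[OF _ length_filter_le])
qed

text \<open>The multiset has exactly \<open>CARD('m)\<close> elements, so the bound concerns all of
  them, and the least one is the minimum of \<open>norm (A *v v)\<close> over unit vectors.\<close>

lemma le_singular_value_immersive_iff:
  fixes A :: "real ^ 'm ^ 'n"
  assumes "0 < c"
  shows "c \<le> singular_value CARD('m) A \<longleftrightarrow> (\<forall>v. c * norm v \<le> norm (A *v v))"
proof -
  have "c \<le> singular_value CARD('m) A \<longleftrightarrow> CARD('m) \<le> size (filter_mset (\<lambda>s. c \<le> s) (singular_values A))"
    by (simp add: le_singular_value_iff[OF assms] Suc_le_eq)
  also have "\<dots> \<longleftrightarrow> filter_mset (\<lambda>s. c \<le> s) (singular_values A) = singular_values A"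
    using size_singular_values[of A]
    by (metis le_refl multiset_filter_subset mset_subset_size not_le subset_mset.le_neq_trans)
  also have "\<dots> \<longleftrightarrow> (\<forall>s\<in>singular_value_set A. c \<le> s)"
    by (simp add: filter_mset_eq_conv set_singular_values)
  also have "\<dots> \<longleftrightarrow> (\<forall>v. c * norm v \<le> norm (A *v v))"
  proof
    assume c: "\<forall>s\<in>singular_value_set A. c \<le> s"
    have "(UNIV :: (real ^ 'm) set) \<noteq> {0}" by (metis UNIV_I axis_eq_0_iff singletonD zero_neq_one)
    from gram_eigenvector_exists[OF subspace_UNIV this, of A]
    obtain s v where s: "0 \<le> s" "norm v = 1" "(transpose A ** A) *v v = s\<^sup>2 *\<^sub>R v"
        "\<And>u. s * norm u \<le> norm (A *v u)" by (metis UNIV_I)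
    then have "v \<in> singular_space A s" "v \<noteq> 0" by auto
    then have "s \<in> singular_value_set A"
      using singular_mult_pos_if_eigenvector s(1) by (auto simp: singular_value_set_def)
    with c have "c \<le> s" by blast
    then show "\<forall>v. c * norm v \<le> norm (A *v v)"
      using s(4) by (meson mult_right_mono norm_ge_zero order_trans)
  next
    assume c: "\<forall>v. c * norm v \<le> norm (A *v v)"
    show "\<forall>s\<in>singular_value_set A. c \<le> s"
    proof
      fix s assume s: "s \<in> singular_value_set A"
      then have "\<not> singular_space A s \<subseteq> {0}"
        unfolding singular_value_set_def singular_mult_def by (metis (no_types, lifting) dim_eq_0 less_irrefl mem_Collect_eq)
      then obtain v where v: "(transpose A ** A) *v v = s\<^sup>2 *\<^sub>R v" "v \<noteq> 0" by blast
      have "(norm (A *v v))\<^sup>2 = (s * norm v)\<^sup>2"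
        using inner_gram[of A v v] v(1) by (simp add: power2_norm_eq_inner power_mult_distrib)
      then have "norm (A *v v) = s * norm v"
        using s by (simp add: singular_value_set_def)
      then have "c * norm v \<le> s * norm v" using c by metis
      then show "c \<le> s" using v(2) by simp
    qed
  qed
  finally show ?thesis .
qed

text \<open>For \<open>s > 0\<close> the map \<open>A\<close> is injective on its singular space for
  \<open>s\<close> and carries it into that of the transpose; the kernels, at \<open>s = 0\<close>,
  may have different dimensions.\<close>

lemma singular_mult_transpose_le:
  fixes A :: "real ^ 'm ^ 'n"
  assumes "0 < s"
  shows "singular_mult A s \<le> singular_mult (transpose A) s"
proof -
  have inj: "inj_on ((*v) A) (span (singular_space A s))"
  proof (rule inj_onI)
    fix u v assume "u \<in> span (singular_space A s)" "v \<in> span (singular_space A s)" "A *v u = A *v v"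
    then have "u \<in> singular_space A s" "v \<in> singular_space A s" "A *v u = A *v v"
      using span_eq_iff[THEN iffD2, OF subspace_singular_space[of A s]] by auto
    then have "s\<^sup>2 *\<^sub>R u = s\<^sup>2 *\<^sub>R v"
      by (simp add: matrix_vector_mul_assoc[symmetric])
    then show "u = v" using assms by simp
  qed
  have "singular_mult A s = dim ((*v) A ` singular_space A s)"
    unfolding singular_mult_def by (rule dim_image_eq[OF matrix_vector_mul_linear inj, symmetric])
  also have "\<dots> \<le> dim (singular_space (transpose A) s)"
  proof (rule dim_subset, clarify)
    fix v assume "(transpose A ** A) *v v = s\<^sup>2 *\<^sub>R v"
    then have "A *v ((transpose A ** A) *v v) = s\<^sup>2 *\<^sub>R (A *v v)"
      by (simp add: matrix_vector_mult_scaleR)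
    then show "(transpose (transpose A) ** transpose A) *v (A *v v) = s\<^sup>2 *\<^sub>R (A *v v)"
      by (simp add: matrix_vector_mul_assoc matrix_mul_assoc)
  qed
  finally show ?thesis unfolding singular_mult_def .
qed

lemma singular_mult_transpose:
  assumes "0 < s"
  shows "singular_mult (transpose A) s = singular_mult A s"
  using singular_mult_transpose_le[OF assms, of A] singular_mult_transpose_le[OF assms, of "transpose A"]
  by simp

text \<open>The singular values of \<open>A\<close> and of its transpose differ only in the number
  of zeros, so they agree above the positive threshold \<open>c\<close>.\<close>

lemma le_singular_value_submersive_iff:
  fixes A :: "real ^ 'm ^ 'n"
  assumes "0 < c"
  shows "c \<le> singular_value CARD('n) A \<longleftrightarrow> (\<forall>w. c * norm w \<le> norm (transpose A *v w))"
proof -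
  have "filter_mset (\<lambda>s. c \<le> s) (singular_values A) = filter_mset (\<lambda>s. c \<le> s) (singular_values (transpose A))"
    using assms by (intro multiset_eqI) (auto simp: count_singular_values singular_value_set_def singular_mult_transpose)
  then have "c \<le> singular_value CARD('n) A \<longleftrightarrow> c \<le> singular_value CARD('n) (transpose A)"
    by (simp add: le_singular_value_iff[OF assms])
  then show ?thesis using le_singular_value_immersive_iff[OF assms, of "transpose A"] by simp
qed

section \<open>Calculus on the half space\<close>

text \<open>From every point of the half space one can move in the positive coordinate directions,
  and these span; so one-sided derivatives are unique at the boundary too.\<close>

lemma has_derivative_half_space_unique:
  assumes y: "y \<in> half_space"
    and "(f has_derivative A) (at y within half_space)" "(f has_derivative B) (at y within half_space)"
  shows "A = B"
proof (rule frechet_derivative_unique_within[OF assms(2,3)])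
  fix i :: "(real, 'a) vec" and e :: real assume i: "i \<in> Basis" and e: "0 < e"
  obtain j where j: "i = axis j 1" using i by (auto simp: Basis_vec_def)
  have "y + (e / 2) *\<^sub>R i \<in> half_space"
    using y e by (auto simp: half_space_def j axis_def)
  then show "\<exists>d. 0 < \<bar>d\<bar> \<and> \<bar>d\<bar> < e \<and> y + d *\<^sub>R i \<in> half_space"
    using e by (intro exI[of _ "e / 2"]) auto
qed

lemma frechet_derivative_half_space:
  assumes "y \<in> half_space" "(f has_derivative A) (at y within half_space)"
  shows "frechet_derivative f (at y within half_space) = A"
proof -
  have "f differentiable (at y within half_space)"
    using assms(2) by (auto simp: differentiable_def)
  then show ?thesis
    using has_derivative_half_space_unique[OF assms(1) _ assms(2)] frechet_derivative_works by blast
qed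

lemma at_within_openin_half_space:
  assumes U: "openin (top_of_set half_space) U" and "y \<in> U"
  shows "at y within U = at y within half_space"
proof -
  obtain T where "open T" "U = half_space \<inter> T" using U by (auto simp: openin_open)
  then show ?thesis using \<open>y \<in> U\<close> by (intro at_within_nhd[of y T]) auto
qed

lemma has_derivative_half_space_cong:
  assumes W: "openin (top_of_set half_space) W" "\<And>x. x \<in> W \<Longrightarrow> f x = g x" and x: "x \<in> W"
  shows "(f has_derivative A) (at x within half_space) \<longleftrightarrow> (g has_derivative A) (at x within half_space)"
  unfolding at_within_openin_half_space[OF W(1) x, symmetric]
  using has_derivative_transform[OF x, of f g A] has_derivative_transform[OF x, of g f A] W(2) by metis

lemma nderiv_cong:
  assumes W: "openin (top_of_set half_space) W" "\<And>x. x \<in> W \<Longrightarrow> f x = g x" and "x \<in> W"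
  shows "nderiv f vs x = nderiv g vs x"
  using \<open>x \<in> W\<close>
proof (induction vs arbitrary: x)
  case (Cons v vs)
  have "(\<lambda>A. (nderiv f vs has_derivative A) (at x within half_space))
      = (\<lambda>A. (nderiv g vs has_derivative A) (at x within half_space))"
    by (intro ext has_derivative_half_space_cong[OF W(1) _ Cons.prems]) (rule Cons.IH)
  then show ?case by (simp add: frechet_derivative_def)
qed (use W in simp)

lemma Ck_on_cong:
  assumes W: "openin (top_of_set half_space) W" "\<And>x. x \<in> W \<Longrightarrow> f x = g x"
  shows "Ck_on k W f \<longleftrightarrow> Ck_on k W g"
proof -
  have "nderiv f vs differentiable (at x within half_space) \<longleftrightarrow> nderiv g vs differentiable (at x within half_space)"
    if "x \<in> W" for x vs
  proof -
    have "(nderiv f vs has_derivative A) (at x within half_space)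
        \<longleftrightarrow> (nderiv g vs has_derivative A) (at x within half_space)" for A
      by (rule has_derivative_half_space_cong[OF W(1) _ that]) (rule nderiv_cong[OF W])
    then show ?thesis unfolding differentiable_def by blast
  qed
  moreover have "continuous_on W (nderiv f vs) \<longleftrightarrow> continuous_on W (nderiv g vs)" for vs
    by (intro continuous_on_cong refl nderiv_cong[OF W])
  ultimately show ?thesis unfolding Ck_on_def by blast
qed

lemma Ck_on_subset: "Ck_on k W f \<Longrightarrow> V \<subseteq> W \<Longrightarrow> Ck_on k V f"
  unfolding Ck_on_def using continuous_on_subset by blast

lemma smooth_on_cong:
  assumes "openin (top_of_set half_space) W" "\<And>x. x \<in> W \<Longrightarrow> f x = g x" "smooth_on W f"
  shows "smooth_on W g"
  using assms Ck_on_cong unfolding smooth_on_def by blast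

lemma smooth_on_subset: "smooth_on W f \<Longrightarrow> V \<subseteq> W \<Longrightarrow> smooth_on V f"
  unfolding smooth_on_def using Ck_on_subset by blast

lemma smooth_on_differentiable:
  "smooth_on W f \<Longrightarrow> x \<in> W \<Longrightarrow> f differentiable (at x within half_space)"
  unfolding smooth_on_def Ck_on_def by (metis length_greater_0_conv list.size(3) nderiv.simps(1) zero_less_one)

lemma smooth_on_continuous: "smooth_on W f \<Longrightarrow> continuous_on W f"
  unfolding smooth_on_def Ck_on_def by (metis le0 list.size(3) nderiv.simps(1))

text \<open>Only points of the half space are covered: elsewhere \<^const>\<open>frechet_derivative\<close> within the half
  space is an arbitrary linear map.\<close>

lemma nderiv_zero:
  fixes x :: "real ^ 'm::{finite,linorder}"
  shows "x \<in> half_space \<Longrightarrow> nderiv (\<lambda>x. 0 :: real ^ 'n) vs x = 0"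
proof (induction vs arbitrary: x)
  case (Cons v vs)
  have "(nderiv (\<lambda>x. 0 :: real ^ 'n) vs has_derivative (\<lambda>_. 0)) (at x within half_space)"
    by (subst has_derivative_half_space_cong[where g="\<lambda>_. 0", OF openin_subtopology_self _ Cons.prems])
       (use Cons.IH in auto)
  then show ?case by (simp add: frechet_derivative_half_space[OF Cons.prems])
qed simp

section \<open>The norms of order \<open>k,1\<close> and Lipschitz bounds\<close>

lemma multi_onorm_zero: "multi_onorm j (\<lambda>vs. 0 :: real ^ 'n) = 0" 
proof -
  have "replicate j 0 \<in> {vs :: (real ^ 'm) list. length vs = j \<and> (\<forall>v\<in>set vs. norm v \<le> 1)}"
    by auto
  then have "{vs :: (real ^ 'm) list. length vs = j \<and> (\<forall>v\<in>set vs. norm v \<le> 1)} \<noteq> {}" by blast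
  then show ?thesis unfolding multi_onorm_def norm_zero by (rule cSUP_const)
qed

text \<open>An inequality, because for empty \<open>K\<close> both suprema are
  \<open>-\<infinity>\<close>.\<close>

lemma Ck1_norm_zero:
  fixes K :: "(real ^ 'm::{finite,linorder}) set"
  assumes "K \<subseteq> half_space"
  shows "Ck1_norm k K (\<lambda>x. 0 :: real ^ 'n) \<le> 0"
proof -
  have zero: "(\<lambda>vs. nderiv (\<lambda>x. 0 :: real ^ 'n) vs x) = (\<lambda>_. 0)" if "x \<in> K" for x
    using that assms nderiv_zero by blast
  have "multi_onorm j (\<lambda>vs. nderiv (\<lambda>x. 0 :: real ^ 'n) vs x) = 0" if "x \<in> K" for j x
    unfolding zero[OF that] by (rule multi_onorm_zero)
  moreover have "multi_onorm k (\<lambda>vs. nderiv (\<lambda>x. 0 :: real ^ 'n) vs y - nderiv (\<lambda>x. 0 :: real ^ 'n) vs x) = 0" if "x \<in> K" "y \<in> K" for x y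
    unfolding fun_cong[OF zero[OF that(1)]] fun_cong[OF zero[OF that(2)]] diff_zero by (rule multi_onorm_zero)
  ultimately show ?thesis
    unfolding Ck1_norm_def by (auto intro!: SUP_least)
qed

lemma multi_onorm_0: "multi_onorm 0 T = norm (T [])"
proof -
  have "{vs :: (real ^ 'a) list. length vs = 0 \<and> (\<forall>v\<in>set vs. norm v \<le> 1)} = {[]}" by auto
  then show ?thesis unfolding multi_onorm_def by simp
qed

lemma norm_le_multi_onorm_1:
  assumes A: "bounded_linear A" and v: "norm v \<le> 1"
  shows "norm (A v) \<le> multi_onorm 1 (\<lambda>vs. A (hd vs))"
proof -
  have "norm (A (hd [v])) \<le> multi_onorm 1 (\<lambda>vs. A (hd vs))"
    unfolding multi_onorm_def
  proof (rule cSUP_upper)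
    \<comment> \<open>The supremum is taken in the reals and bounds its members only if they are
      bounded above.\<close>
    show "bdd_above ((\<lambda>vs. norm (A (hd vs))) ` {vs. length vs = 1 \<and> (\<forall>v\<in>set vs. norm v \<le> 1)})"
    proof (rule bdd_aboveI2)
      fix vs assume "vs \<in> {vs :: (real ^ 'a) list. length vs = 1 \<and> (\<forall>v\<in>set vs. norm v \<le> 1)}"
      then obtain v where v: "vs = [v]" "norm v \<le> 1" by (auto simp: length_Suc_conv)
      have "norm (A v) \<le> onorm A * norm v" by (rule onorm[OF A])
      also have "\<dots> \<le> onorm A" using v(2) onorm_pos_le[OF A] by (simp add: mult_left_le)
      finally show "norm (A (hd vs)) \<le> onorm A" using v(1) by simp
    qed
  qed (use v in auto)
  then show ?thesis by simp
qed

lemma Ck1_on_differentiable: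
  assumes "Ck1_on k W f" "0 < k" "x \<in> W"
  shows "f differentiable (at x within half_space)"
  using assms unfolding Ck1_on_def Ck_on_def by (metis list.size(3) nderiv.simps(1))

text \<open>For \<open>k = 0\<close> this is the Lipschitz condition of the class itself; for
  \<open>k > 0\<close> the first derivative is continuous, hence bounded near \<open>x\<close>, and
  half balls are convex.\<close>

lemma Ck1_on_locally_Lipschitz:
  fixes f :: "real ^ 'm::{finite,linorder} \<Rightarrow> real ^ 'n"
  assumes W: "openin (top_of_set half_space) W" "x \<in> W" and f: "Ck1_on k W f"
  obtains r L where "0 < r" "L-lipschitz_on (ball x r \<inter> half_space) f"
proof -
  obtain r0 where r0: "0 < r0" "cball x r0 \<inter> half_space \<subseteq> W"
    using openin_half_space_cball[OF W] .
  show thesis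
  proof (cases "k = 0")
    case True
    obtain d L where d: "0 < d" and L: "\<And>y z. y \<in> W \<inter> ball x d \<Longrightarrow> z \<in> W \<inter> ball x d \<Longrightarrow> norm (f y - f z) \<le> L * dist y z"
    proof -
      have "\<exists>d>0. \<exists>L. \<forall>y\<in>W \<inter> ball x d. \<forall>z\<in>W \<inter> ball x d. norm (f y - f z) \<le> L * dist y z"
        using f W(2) unfolding Ck1_on_def True multi_onorm_0 nderiv.simps(1) by blast
      then show thesis using that by blast
    qed
    have "\<bar>L\<bar>-lipschitz_on (ball x (min d r0) \<inter> half_space) f"
    proof (rule lipschitz_onI)
      fix y z assume "y \<in> ball x (min d r0) \<inter> half_space" "z \<in> ball x (min d r0) \<inter> half_space"
      then have "y \<in> W \<inter> ball x d" "z \<in> W \<inter> ball x d" using r0(2) by auto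
      from L[OF this] have "dist (f y) (f z) \<le> L * dist y z" by (simp add: dist_norm)
      also have "\<dots> \<le> \<bar>L\<bar> * dist y z" by (intro mult_right_mono) auto
      finally show "dist (f y) (f z) \<le> \<bar>L\<bar> * dist y z" .
    qed simp
    then show thesis using that[of "min d r0"] d r0(1) by simp
  next
    case False
    define D where "D y = frechet_derivative f (at y within half_space)" for y
    have D: "(f has_derivative D y) (at y within half_space)" if "y \<in> W" for y
      using Ck1_on_differentiable[OF f _ that] False unfolding D_def
      by (simp add: frechet_derivative_works[symmetric])
    have "continuous_on W (\<lambda>y. D y (axis i 1))" for i
    proof -
      have "length [axis i 1 :: (real, 'm) vec] \<le> k" using False by simp
      then have "continuous_on W (nderiv f [axis i 1])"
        using f unfolding Ck1_on_def Ck_on_def by blast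
      then show ?thesis by (simp add: D_def)
    qed
    then have "continuous_on W (\<lambda>y. \<Sum>i\<in>UNIV. norm (D y (axis i 1)))"
      by (intro continuous_intros)
    note cont = this
    \<comment> \<open>Continuity is given for each fixed direction only, so the operator norm is
      bounded by the sum over the axes; the extra 1 is the slack used by continuity at
      \<open>x\<close>.\<close>
    define C where "C = (\<Sum>i\<in>UNIV. norm (D x (axis i 1))) + 1"
    obtain d where d: "0 < d" "\<And>y. y \<in> W \<Longrightarrow> dist y x < d \<Longrightarrow> (\<Sum>i\<in>UNIV. norm (D y (axis i 1))) < C"
    proof -
      from cont W(2) obtain d where "0 < d" "\<forall>y\<in>W. dist y x < d \<longrightarrow>
          dist (\<Sum>i\<in>UNIV. norm (D y (axis i 1))) (\<Sum>i\<in>UNIV. norm (D x (axis i 1))) < 1"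
        unfolding continuous_on_iff by (metis zero_less_one)
      then show thesis
        by (intro that[of d]) (auto simp: C_def dist_real_def abs_less_iff)
    qed
    let ?S = "ball x (min d r0) \<inter> half_space"
    have SW: "?S \<subseteq> W" using r0(2) by auto
    have "C-lipschitz_on ?S f"
    proof (rule bounded_derivative_imp_lipschitz)
      show "(f has_derivative D y) (at y within ?S)" if "y \<in> ?S" for y
        using that SW by (intro has_derivative_subset[OF D[of y]]) auto
      show "convex ?S" by (intro convex_Int convex_ball convex_half_space)
      show "0 \<le> C" unfolding C_def by (intro add_nonneg_nonneg sum_nonneg) auto
      show "onorm (D y) \<le> C" if y: "y \<in> ?S" for y
      proof (rule onorm_le)
        fix v :: "(real, 'm) vec"
        have lin: "linear (D y)" using D y SW has_derivative_linear by blast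
        have "D y v = D y (\<Sum>i\<in>UNIV. v $ i *\<^sub>R axis i 1)" by (simp only: basis_expansion[of v, unfolded scalar_mult_eq_scaleR])
        also have "\<dots> = (\<Sum>i\<in>UNIV. v $ i *\<^sub>R D y (axis i 1))"
          by (simp add: linear_sum[OF lin] linear_cmul[OF lin])
        finally have "norm (D y v) \<le> (\<Sum>i\<in>UNIV. norm (v $ i *\<^sub>R D y (axis i 1)))"
          by (metis norm_sum)
        also have "\<dots> \<le> (\<Sum>i\<in>UNIV. norm v * norm (D y (axis i 1)))"
          by (intro sum_mono) (simp add: mult_right_mono component_le_norm_cart)
        also have "\<dots> = norm v * (\<Sum>i\<in>UNIV. norm (D y (axis i 1)))" by (simp add: sum_distrib_left)
        also have "\<dots> \<le> norm v * C"
          using d(2)[of y] y SW by (intro mult_left_mono) (auto simp: dist_commute less_imp_le)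
        finally show "norm (D y v) \<le> C * norm v" by (simp add: mult.commute)
      qed
    qed
    then show thesis using that[of "min d r0"] d r0(1) by simp
  qed
qed

text \<open>For \<open>k = 0\<close> the difference quotients are part of the norm. For
  \<open>k > 0\<close> its term of order 1 bounds the derivative on the convex set \<open>K\<close>;
  differentiability is a separate hypothesis because the norm only sees what
  \<open>frechet_derivative\<close> returns.\<close>

lemma Lipschitz_if_Ck1_norm_less:
  fixes g :: "real ^ 'm::{finite,linorder} \<Rightarrow> real ^ 'n"
  assumes K: "convex K" "K \<subseteq> half_space" and "0 < e" and norm: "Ck1_norm k K g < ereal e"
    and diff: "\<And>x. 0 < k \<Longrightarrow> x \<in> K \<Longrightarrow> g differentiable (at x within half_space)"
  shows "e-lipschitz_on K g"
proof (cases "k = 0")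
  case True
  show ?thesis
  proof (rule lipschitz_onI)
    fix x y assume xy: "x \<in> K" "y \<in> K"
    show "dist (g x) (g y) \<le> e * dist x y"
    proof (cases "x = y")
      case False
      have "ereal (multi_onorm k (\<lambda>vs. nderiv g vs y - nderiv g vs x) / norm (x - y))
          \<le> (SUP (x, y)\<in>{(x, y). x \<in> K \<and> y \<in> K \<and> x \<noteq> y}.
              ereal (multi_onorm k (\<lambda>vs. nderiv g vs y - nderiv g vs x) / norm (x - y)))"
        using xy False by (intro SUP_upper2[of "(x, y)"]) auto
      also have "\<dots> \<le> Ck1_norm k K g" unfolding Ck1_norm_def by (rule sup_ge2)
      also note norm
      finally have "norm (g y - g x) / norm (x - y) < e" by (simp add: True multi_onorm_0)
      then show ?thesis using False by (simp add: divide_less_eq dist_norm norm_minus_commute)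
    qed simp
  qed (use \<open>0 < e\<close> in simp)
next
  case False
  define D where "D y = frechet_derivative g (at y within half_space)" for y
  have D: "(g has_derivative D y) (at y within half_space)" if "y \<in> K" for y
    using diff[OF _ that] False unfolding D_def by (simp add: frechet_derivative_works[symmetric])
  show ?thesis
  proof (rule bounded_derivative_imp_lipschitz[OF _ K(1)])
    show "(g has_derivative D y) (at y within K)" if "y \<in> K" for y
      using D[OF that] K(2) by (rule has_derivative_subset)
    show "onorm (D y) \<le> e" if y: "y \<in> K" for y
    proof (rule onorm_le)
      fix v :: "(real, 'm) vec"
      have bl: "bounded_linear (D y)" by (rule has_derivative_bounded_linear[OF D[OF y]])
      have unit: "norm (D y u) \<le> e" if u: "norm u \<le> 1" for u
      proof -
        have "multi_onorm 1 (\<lambda>vs. D y (hd vs)) = multi_onorm 1 (\<lambda>vs. nderiv g vs y)"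
          unfolding multi_onorm_def
          by (intro SUP_cong) (auto simp: length_Suc_conv D_def)
        then have "ereal (norm (D y u)) \<le> ereal (multi_onorm 1 (\<lambda>vs. nderiv g vs y))"
          using norm_le_multi_onorm_1[OF bl u] by simp
        also have "\<dots> \<le> (SUP x\<in>K. ereal (multi_onorm 1 (\<lambda>vs. nderiv g vs x)))"
          using y by (rule SUP_upper)
        also have "\<dots> \<le> (SUP j\<in>{..k}. SUP x\<in>K. ereal (multi_onorm j (\<lambda>vs. nderiv g vs x)))"
          using False by (intro SUP_upper) auto
        also have "\<dots> \<le> Ck1_norm k K g" unfolding Ck1_norm_def by (rule sup_ge1)
        also note norm
        finally show ?thesis by simp
      qed
      show "norm (D y v) \<le> e * norm v"
      proof (cases "v = 0")
        case False
        have "D y v = norm v *\<^sub>R D y (v /\<^sub>R norm v)"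
          using False by (simp add: linear_cmul[OF bounded_linear.linear[OF bl]])
        then have "norm (D y v) = norm v * norm (D y (v /\<^sub>R norm v))" by simp
        also have "\<dots> \<le> norm v * e" using False by (intro mult_left_mono unit) auto
        finally show ?thesis by (simp add: mult.commute)
      qed (simp add: linear_0[OF bounded_linear.linear[OF bl]])
    qed
  qed (use \<open>0 < e\<close> in simp)
qed

section \<open>Uniformly definite sets of matrices\<close>

text \<open>\<open>w\<close> is the unit vector towards the point \<open>p\<close> of the closure
  nearest to 0; the whole set lies beyond the hyperplane through \<open>p\<close> orthogonal to
  \<open>p\<close>.\<close>

lemma convex_norm_ge_imp_inner_ge:
  fixes S :: "'a::euclidean_space set"
  assumes S: "convex S" and c: "0 < c" "\<And>z. z \<in> S \<Longrightarrow> c \<le> norm z"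
  obtains w where "norm w \<le> 1" "\<And>z. z \<in> S \<Longrightarrow> c \<le> w \<bullet> z"
proof (cases "S = {}")
  case False
  define p where "p = closest_point (closure S) 0"
  have ne: "closure S \<noteq> {}" using False by simp
  have p: "p \<in> closure S" unfolding p_def by (rule closest_point_in_set[OF closed_closure ne])
  have "closure S \<subseteq> {z. c \<le> norm z}"
    by (rule closure_minimal) (use c(2) in \<open>auto intro!: closed_Collect_le continuous_intros\<close>)
  then have cp: "c \<le> norm p" using p by blast
  have pos: "0 < norm p" using c(1) cp by linarith
  show thesis
  proof (rule that[of "p /\<^sub>R norm p"])
    show "norm (p /\<^sub>R norm p) \<le> 1" using pos by simp
    fix z assume "z \<in> S"
    then have z: "z \<in> closure S" using closure_subset by blast
    have "(0 - p) \<bullet> (z - p) \<le> 0"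
      unfolding p_def by (rule closest_point_dot[OF convex_closure[OF S] closed_closure z])
    then have "norm p * norm p \<le> p \<bullet> z"
      by (simp add: inner_diff_right power2_norm_eq_inner[symmetric] power2_eq_square)
    then have "norm p \<le> (p \<bullet> z) / norm p" using pos by (simp add: le_divide_eq)
    then show "c \<le> (p /\<^sub>R norm p) \<bullet> z" using cp by (simp add: divide_inverse mult.commute)
  qed
qed (use that[of 0] in auto)

text \<open>Only the prescribed direction runs over the unit sphere. Its partner comes from
  separation or from rescaling, so norm at most 1 is all that is asked of it.\<close>

definition covers_domain :: "((real ^ 'm) \<times> (real ^ 'n)) set \<Rightarrow> bool" where
  "covers_domain R \<longleftrightarrow> (\<forall>(v, w)\<in>R. norm v \<le> 1 \<and> norm w \<le> 1) \<and> (\<forall>v. norm v = 1 \<longrightarrow> (\<exists>w. (v, w) \<in> R))"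

definition covers_codomain :: "((real ^ 'm) \<times> (real ^ 'n)) set \<Rightarrow> bool" where
  "covers_codomain R \<longleftrightarrow> (\<forall>(v, w)\<in>R. norm v \<le> 1 \<and> norm w \<le> 1) \<and> (\<forall>w. norm w = 1 \<longrightarrow> (\<exists>v. (v, w) \<in> R))"

text \<open>With \<open>covers_domain\<close> for \<open>\<Q>\<close> this describes immersions,
  with \<open>covers_codomain\<close> submersions; the parameter allows one proof of openness for
  both.\<close>

definition uniformly_definite ::
  "(((real ^ 'm) \<times> (real ^ 'n)) set \<Rightarrow> bool) \<Rightarrow> (real ^ 'm ^ 'n) set \<Rightarrow> bool" where
  "uniformly_definite \<Q> C \<longleftrightarrow> (\<exists>R c. \<Q> R \<and> 0 < c \<and> (\<forall>(v, w)\<in>R. \<forall>D\<in>C. c \<le> w \<bullet> (D *v v)))"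

lemma INF_ereal_pos_iff:
  "0 < (INF x\<in>S. ereal (f x)) \<longleftrightarrow> (\<exists>c>0. \<forall>x\<in>S. c \<le> f x)"
proof
  assume "0 < (INF x\<in>S. ereal (f x))"
  then obtain c where c: "0 < ereal c" "ereal c < (INF x\<in>S. ereal (f x))"
    using ereal_dense2[of 0 "INF x\<in>S. ereal (f x)"] by auto
  have "c \<le> f x" if "x \<in> S" for x
    using less_le_trans[OF c(2) INF_lower[OF that]] by simp
  then show "\<exists>c>0. \<forall>x\<in>S. c \<le> f x" using c(1) by auto
next
  assume "\<exists>c>0. \<forall>x\<in>S. c \<le> f x"
  then obtain c where c: "0 < c" "\<forall>x\<in>S. c \<le> f x" by blast
  have "ereal c \<le> (INF x\<in>S. ereal (f x))" by (rule INF_greatest) (use c in auto)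
  then show "0 < (INF x\<in>S. ereal (f x))" using c(1) by (meson ereal_less(2) less_le_trans)
qed

lemma immersive_iff_uniformly_definite:
  fixes C :: "(real ^ 'm ^ 'n) set"
  assumes C: "convex C"
  shows "0 < (INF D\<in>C. ereal (singular_value CARD('m) D)) \<longleftrightarrow> uniformly_definite covers_domain C"
  unfolding INF_ereal_pos_iff
proof
  assume "\<exists>c>0. \<forall>D\<in>C. c \<le> singular_value CARD('m) D"
  then obtain c where c: "0 < c" "\<And>D v. D \<in> C \<Longrightarrow> c * norm v \<le> norm (D *v v)"
    using le_singular_value_immersive_iff by blast
  \<comment> \<open>The largest set of pairs that satisfies the bound, so only the covering of the
    unit sphere is left to prove.\<close>
  define R :: "((real ^ 'm) \<times> (real ^ 'n)) set"
    where "R = {(v, w). norm v \<le> 1 \<and> norm w \<le> 1 \<and> (\<forall>D\<in>C. c \<le> w \<bullet> (D *v v))}"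
  have "\<exists>w. (v, w) \<in> R" if v: "norm v = 1" for v
  proof -
    have "convex ((\<lambda>D. D *v v) ` C)"
      by (intro convex_linear_image C linearI)
         (auto simp: matrix_vector_mult_add_rdistrib scaleR_matrix_vector_assoc)
    moreover have "c \<le> norm z" if "z \<in> (\<lambda>D. D *v v) ` C" for z
      using that c(2)[of _ v] v by auto
    ultimately obtain w where "norm w \<le> 1" "\<And>z. z \<in> (\<lambda>D. D *v v) ` C \<Longrightarrow> c \<le> w \<bullet> z"
      using convex_norm_ge_imp_inner_ge[OF _ c(1)] by metis
    then show ?thesis using v by (auto simp: R_def)
  qed
  then have "covers_domain R" by (auto simp: covers_domain_def R_def)
  then show "uniformly_definite covers_domain C"
    unfolding uniformly_definite_def using c(1) by (intro exI[of _ R] exI[of _ c]) (auto simp: R_def)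
next
  assume "uniformly_definite covers_domain C"
  then obtain R :: "((real ^ 'm) \<times> (real ^ 'n)) set" and c
    where R: "covers_domain R" and c: "0 < c" "\<And>v w D. (v, w) \<in> R \<Longrightarrow> D \<in> C \<Longrightarrow> c \<le> w \<bullet> (D *v v)"
    unfolding uniformly_definite_def by blast
  have "c * norm v \<le> norm (D *v v)" if D: "D \<in> C" for D v
  proof (cases "v = 0")
    case False
    then have "norm (v /\<^sub>R norm v) = 1" by simp
    then obtain w where w: "(v /\<^sub>R norm v, w) \<in> R" "norm w \<le> 1"
      using R unfolding covers_domain_def by blast
    have "c \<le> norm w * norm (D *v (v /\<^sub>R norm v))"
      using c(2)[OF w(1) D] norm_cauchy_schwarz order_trans by blast
    also have "\<dots> \<le> 1 * norm (D *v (v /\<^sub>R norm v))" by (intro mult_right_mono w) simp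
    also have "\<dots> = norm (D *v v) / norm v"
      by (simp add: matrix_vector_mult_scaleR divide_inverse mult.commute)
    finally show ?thesis using False by (simp add: le_divide_eq)
  qed simp
  then show "\<exists>c>0. \<forall>D\<in>C. c \<le> singular_value CARD('m) D"
    using c(1) le_singular_value_immersive_iff by blast
qed

lemma submersive_iff_uniformly_definite:
  fixes C :: "(real ^ 'm ^ 'n) set"
  assumes C: "convex C"
  shows "0 < (INF D\<in>C. ereal (singular_value CARD('n) D)) \<longleftrightarrow> uniformly_definite covers_codomain C"
  unfolding INF_ereal_pos_iff
proof
  assume "\<exists>c>0. \<forall>D\<in>C. c \<le> singular_value CARD('n) D"
  then obtain c where c: "0 < c" "\<And>D w. D \<in> C \<Longrightarrow> c * norm w \<le> norm (transpose D *v w)"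
    using le_singular_value_submersive_iff by blast
  define R :: "((real ^ 'm) \<times> (real ^ 'n)) set"
    where "R = {(v, w). norm v \<le> 1 \<and> norm w \<le> 1 \<and> (\<forall>D\<in>C. c \<le> w \<bullet> (D *v v))}"
  have "\<exists>v. (v, w) \<in> R" if w: "norm w = 1" for w
  proof -
    have "convex ((\<lambda>D. transpose D *v w) ` C)"
      by (intro convex_linear_image C linearI)
         (auto simp: vec_eq_iff matrix_vector_mult_def transpose_def algebra_simps sum.distrib sum_distrib_left)
    moreover have "c \<le> norm z" if "z \<in> (\<lambda>D. transpose D *v w) ` C" for z
      using that c(2)[of _ w] w by auto
    ultimately obtain v where "norm v \<le> 1" "\<And>z. z \<in> (\<lambda>D. transpose D *v w) ` C \<Longrightarrow> c \<le> v \<bullet> z"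
      using convex_norm_ge_imp_inner_ge[OF _ c(1)] by metis
    note v = this
    have "c \<le> w \<bullet> (D *v v)" if "D \<in> C" for D
    proof -
      have "c \<le> v \<bullet> (transpose D *v w)" using v(2) that by blast
      then show ?thesis by (simp only: inner_commute[of v] inner_transpose_left)
    qed
    then have "(v, w) \<in> R" using v(1) w by (auto simp: R_def)
    then show ?thesis by blast
  qed
  then have "covers_codomain R" by (auto simp: covers_codomain_def R_def)
  then show "uniformly_definite covers_codomain C"
    unfolding uniformly_definite_def using c(1) by (intro exI[of _ R] exI[of _ c]) (auto simp: R_def)
next
  assume "uniformly_definite covers_codomain C"
  then obtain R :: "((real ^ 'm) \<times> (real ^ 'n)) set" and c
    where R: "covers_codomain R" and c: "0 < c" "\<And>v w D. (v, w) \<in> R \<Longrightarrow> D \<in> C \<Longrightarrow> c \<le> w \<bullet> (D *v v)"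
    unfolding uniformly_definite_def by blast
  have "c * norm w \<le> norm (transpose D *v w)" if D: "D \<in> C" for D w
  proof (cases "w = 0")
    case False
    then have "norm (w /\<^sub>R norm w) = 1" by simp
    then obtain v where v: "(v, w /\<^sub>R norm w) \<in> R" "norm v \<le> 1"
      using R unfolding covers_codomain_def by blast
    have "c \<le> (transpose D *v (w /\<^sub>R norm w)) \<bullet> v"
      using c(2)[OF v(1) D] by (simp only: inner_transpose_left)
    also have "\<dots> \<le> norm (transpose D *v (w /\<^sub>R norm w)) * norm v" by (rule norm_cauchy_schwarz)
    also have "\<dots> \<le> norm (transpose D *v (w /\<^sub>R norm w)) * 1" by (intro mult_left_mono v) simp
    also have "\<dots> = norm (transpose D *v w) / norm w"
      by (simp add: matrix_vector_mult_scaleR divide_inverse mult.commute)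
    finally show ?thesis using False by (simp add: le_divide_eq)
  qed simp
  then show "\<exists>c>0. \<forall>D\<in>C. c \<le> singular_value CARD('n) D"
    using c(1) le_singular_value_submersive_iff by blast
qed

section \<open>Definiteness under multiplication by invertible matrices\<close>

lemma norm_ge_if_right_inverse:
  fixes Q :: "real ^ 'a ^ 'b"
  assumes "Q *v z = u" "norm u = 1"
  shows "1 / (norm Q + 1) \<le> norm z"
proof -
  have "1 \<le> norm Q * norm z" using norm_matrix_vector_le[of Q z] assms by simp
  also have "\<dots> \<le> (norm Q + 1) * norm z" by (intro mult_right_mono) auto
  finally show ?thesis by (simp add: divide_le_eq mult.commute add_nonneg_pos)
qed

text \<open>For a unit vector \<open>u\<close> use the partner \<open>w\<close> of the normalised
  preimage \<open>z = Q' *v u\<close> and move \<open>P\<close> to the other side: the new partner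
  is \<open>transpose P *v w\<close>, divided by \<open>K\<close> to have norm at most 1. The
  constant \<open>c'\<close> collects this division and the lower bound for
  \<open>norm z\<close>.\<close>

lemma uniformly_definite_transform_immersive:
  fixes P :: "real ^ 'n ^ 'n" and Q :: "real ^ 'm ^ 'm"
  assumes R: "covers_domain R" and c: "0 < c" and inv: "Q ** Q' = mat 1"
    and D: "\<And>v w D. (v, w) \<in> R \<Longrightarrow> D \<in> C \<Longrightarrow> c \<le> w \<bullet> ((P ** D ** Q) *v v)"
  shows "uniformly_definite covers_domain C"
proof -
  define K where "K = norm (transpose P) + 1"
  define c' where "c' = c * (1 / (norm Q + 1)) / K"
  have K: "0 < K" unfolding K_def by (simp add: add_nonneg_pos)
  have c': "0 < c'" unfolding c'_def using c K by (simp add: add_nonneg_pos)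
  define R' :: "((real ^ 'm) \<times> (real ^ 'n)) set"
    where "R' = {(v, w). norm v \<le> 1 \<and> norm w \<le> 1 \<and> (\<forall>D\<in>C. c' \<le> w \<bullet> (D *v v))}"
  have "\<exists>w. (u, w) \<in> R'" if u: "norm u = 1" for u
  proof -
    define z where "z = Q' *v u"
    have Qz: "Q *v z = u" by (simp add: z_def matrix_vector_mul_assoc inv)
    have nz: "1 / (norm Q + 1) \<le> norm z" by (rule norm_ge_if_right_inverse[OF Qz u])
    then have "z \<noteq> 0" using Qz u by auto
    then have "norm (z /\<^sub>R norm z) = 1" by simp
    then obtain w where w: "(z /\<^sub>R norm z, w) \<in> R" "norm w \<le> 1"
      using R unfolding covers_domain_def by blast
    let ?w = "(transpose P *v w) /\<^sub>R K"
    have "norm (transpose P *v w) \<le> norm (transpose P) * 1"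
      by (rule order_trans[OF norm_matrix_vector_le mult_left_mono[OF w(2)]]) simp
    then have "norm ?w \<le> 1" using K by (simp add: K_def divide_inverse[symmetric] mult.commute)
    moreover have "c' \<le> ?w \<bullet> (A *v u)" if A: "A \<in> C" for A
    proof -
      have "c * (1 / (norm Q + 1)) \<le> c * norm z" using c nz by (intro mult_left_mono) auto
      also have "\<dots> \<le> norm z * (w \<bullet> ((P ** A ** Q) *v (z /\<^sub>R norm z)))"
        using D[OF w(1) A] by (simp add: mult.commute[of c] mult_left_mono del: matrix_vector_mult_scaleR)
      also have "\<dots> = w \<bullet> ((P ** A ** Q) *v z)"
        using \<open>z \<noteq> 0\<close> by (simp add: matrix_vector_mult_scaleR)
      also have "\<dots> = w \<bullet> (P *v (A *v u))"
        by (simp add: matrix_vector_mul_assoc[symmetric] Qz)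
      also have "\<dots> = (transpose P *v w) \<bullet> (A *v u)" by (simp only: inner_transpose_left)
      finally have "c' \<le> ((transpose P *v w) \<bullet> (A *v u)) / K"
        unfolding c'_def using K by (intro divide_right_mono) auto
      also have "\<dots> = ?w \<bullet> (A *v u)" by (simp only: inner_scaleR_left divide_inverse mult.commute)
      finally show ?thesis .
    qed
    ultimately have "(u, ?w) \<in> R'" using u by (auto simp: R'_def)
    then show ?thesis by blast
  qed
  then have "covers_domain R'" by (auto simp: covers_domain_def R'_def)
  then show ?thesis
    unfolding uniformly_definite_def using c' by (intro exI[of _ R'] exI[of _ c']) (auto simp: R'_def)
qed

text \<open>Dual to the immersive case: the preimage is now taken under \<open>transpose P\<close>,
  by means of the left inverse \<open>P'\<close>, and the partner \<open>v\<close> becomes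
  \<open>Q *v v\<close> divided by \<open>K\<close>.\<close>

lemma uniformly_definite_transform_submersive:
  fixes P :: "real ^ 'n ^ 'n" and Q :: "real ^ 'm ^ 'm"
  assumes R: "covers_codomain R" and c: "0 < c" and inv: "P' ** P = mat 1"
    and D: "\<And>v w D. (v, w) \<in> R \<Longrightarrow> D \<in> C \<Longrightarrow> c \<le> w \<bullet> ((P ** D ** Q) *v v)"
  shows "uniformly_definite covers_codomain C"
proof -
  define K where "K = norm Q + 1"
  define c' where "c' = c * (1 / (norm (transpose P) + 1)) / K"
  have K: "0 < K" unfolding K_def by (simp add: add_nonneg_pos)
  have c': "0 < c'" unfolding c'_def using c K by (simp add: add_nonneg_pos)
  define R' :: "((real ^ 'm) \<times> (real ^ 'n)) set"
    where "R' = {(v, w). norm v \<le> 1 \<and> norm w \<le> 1 \<and> (\<forall>D\<in>C. c' \<le> w \<bullet> (D *v v))}"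
  have "\<exists>v. (v, u) \<in> R'" if u: "norm u = 1" for u
  proof -
    define z where "z = transpose P' *v u"
    have Pz: "transpose P *v z = u"
      by (simp add: z_def matrix_vector_mul_assoc matrix_transpose_mul[symmetric] inv transpose_mat
          del: transpose_matrix_vector)
    have nz: "1 / (norm (transpose P) + 1) \<le> norm z" by (rule norm_ge_if_right_inverse[OF Pz u])
    then have "z \<noteq> 0" using Pz u by auto
    then have "norm (z /\<^sub>R norm z) = 1" by simp
    then obtain v where v: "(v, z /\<^sub>R norm z) \<in> R" "norm v \<le> 1"
      using R unfolding covers_codomain_def by blast
    let ?v = "(Q *v v) /\<^sub>R K"
    have "norm (Q *v v) \<le> norm Q * 1"
      by (rule order_trans[OF norm_matrix_vector_le mult_left_mono[OF v(2)]]) simp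
    then have "norm ?v \<le> 1" using K by (simp add: K_def divide_inverse[symmetric] mult.commute)
    moreover have "c' \<le> u \<bullet> (A *v ?v)" if A: "A \<in> C" for A
    proof -
      have "c * (1 / (norm (transpose P) + 1)) \<le> c * norm z" using c nz by (intro mult_left_mono) auto
      also have "\<dots> \<le> norm z * ((z /\<^sub>R norm z) \<bullet> ((P ** A ** Q) *v v))"
        using D[OF v(1) A] by (simp add: mult.commute[of c] mult_left_mono del: inner_scaleR_left)
      also have "\<dots> = z \<bullet> (P *v (A *v (Q *v v)))"
        using \<open>z \<noteq> 0\<close> by (simp add: matrix_vector_mul_assoc matrix_mul_assoc)
      also have "\<dots> = u \<bullet> (A *v (Q *v v))" by (simp only: inner_transpose_left[symmetric] Pz)
      finally have "c' \<le> (u \<bullet> (A *v (Q *v v))) / K"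
        unfolding c'_def using K by (intro divide_right_mono) auto
      also have "\<dots> = u \<bullet> (A *v ?v)"
        by (simp only: inner_scaleR_right matrix_vector_mult_scaleR divide_inverse mult.commute)
      finally show ?thesis .
    qed
    ultimately show ?thesis using u by (intro exI[of _ ?v]) (auto simp: R'_def)
  qed
  then have "covers_codomain R'" by (auto simp: covers_codomain_def R'_def)
  then show ?thesis
    unfolding uniformly_definite_def using c' by (intro exI[of _ R'] exI[of _ c']) (auto simp: R'_def)
qed

section \<open>Locally finite covers\<close>

text \<open>The indices are chosen from a given supply of pairs: the open sets \<open>J i\<close>
  have to cover, while the larger compact sets \<open>S i\<close> have to be locally finite.
  Finitely many indices are taken for each compact layer of an exhaustion, with \<open>S i\<close>
  inside an open set that meets only nearby layers.\<close>

lemma locally_finite_cover_selection: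
  assumes M: "second_countable M" "Hausdorff_space M"
    and sel: "\<And>p W. openin M W \<Longrightarrow> p \<in> W \<Longrightarrow>
       \<exists>i. P i \<and> openin M (J i) \<and> p \<in> J i \<and> J i \<subseteq> S i \<and> compactin M (S i) \<and> S i \<subseteq> W"
  obtains I where "\<And>i. i \<in> I \<Longrightarrow> P i" "topspace M \<subseteq> (\<Union>i\<in>I. J i)"
    "\<And>p. p \<in> topspace M \<Longrightarrow> \<exists>W. openin M W \<and> p \<in> W \<and> finite {i \<in> I. S i \<inter> W \<noteq> {}}"
proof (cases "topspace M = {}")
  case True
  show thesis by (rule that[of "{}"]) (use True in auto)
next
  case False
  \<comment> \<open>Applied with the whole space, \<open>sel\<close> shows that these relatively
    compact open sets cover; the Lindelof property reduces them to a sequence.\<close>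
  define \<U> where "\<U> = {U. openin M U \<and> (\<exists>C. compactin M C \<and> U \<subseteq> C)}"
  have "\<Union>\<U> = topspace M"
  proof
    show "\<Union>\<U> \<subseteq> topspace M" unfolding \<U>_def using openin_subset by blast
    show "topspace M \<subseteq> \<Union>\<U>"
    proof
      fix p assume "p \<in> topspace M"
      then obtain i where "openin M (J i)" "p \<in> J i" "J i \<subseteq> S i" "compactin M (S i)"
        using sel[OF openin_topspace] by blast
      then show "p \<in> \<Union>\<U>" unfolding \<U>_def by blast
    qed
  qed
  moreover have "Lindelof_space M" by (rule second_countable_imp_Lindelof_space[OF M(1)])
  ultimately obtain \<V> where \<V>: "countable \<V>" "\<V> \<subseteq> \<U>" "\<Union>\<V> = topspace M"
    unfolding Lindelof_space_def using \<U>_def by (metis (no_types, lifting) mem_Collect_eq)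
  have "\<V> \<noteq> {}" using \<V>(3) False by (metis Union_empty)
  define A where "A = from_nat_into \<V>"
  have A: "range A = \<V>" unfolding A_def by (rule range_from_nat_into[OF \<open>\<V> \<noteq> {}\<close> \<V>(1)])
  have "\<forall>n. \<exists>C. openin M (A n) \<and> compactin M C \<and> A n \<subseteq> C"
    using A \<V>(2) unfolding \<U>_def by blast
  then obtain B where AB: "\<And>n. openin M (A n)" "\<And>n. compactin M (B n)" "\<And>n. A n \<subseteq> B n" by metis
  have cover: "topspace M = (\<Union>n. A n)" using A \<V>(3) by simp
  \<comment> \<open>Compactness puts finitely many of the compact sets inside finitely many of the
    open ones; the bound \<open>max (Suc N) m\<close> makes the index grow strictly, so that
    iteration exhausts the space.\<close>
  have "\<exists>N'>N. (\<Union>n<N. B n) \<subseteq> (\<Union>n<N'. A n)" for N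
  proof -
    have "compactin M (\<Union>n<N. B n)" using AB(2) by (intro compactin_Union) auto
    moreover have "openin M U" if "U \<in> range A" for U using AB(1) that by blast
    moreover have "(\<Union>n<N. B n) \<subseteq> \<Union>(range A)"
      using cover compactin_subset_topspace[OF AB(2)] by blast
    ultimately have "\<exists>F. finite F \<and> F \<subseteq> range A \<and> (\<Union>n<N. B n) \<subseteq> \<Union>F"
      by (rule compactinD)
    then obtain F where F: "finite F" "F \<subseteq> range A" "(\<Union>n<N. B n) \<subseteq> \<Union>F"
      by blast
    then obtain K where K: "finite K" "F = A ` K"
      using finite_subset_image[of F A UNIV] by blast
    obtain m where "K \<subseteq> {..<m}" using K(1) finite_nat_iff_bounded by blast
    then have "K \<subseteq> {..<max (Suc N) m}" by auto
    then have "(\<Union>n<N. B n) \<subseteq> (\<Union>n<max (Suc N) m. A n)" using F(3) K(2) by blast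
    then show ?thesis by (intro exI[of _ "max (Suc N) m"]) auto
  qed
  then obtain nx where nx: "\<And>N. N < nx N" "\<And>N. (\<Union>n<N. B n) \<subseteq> (\<Union>n<nx N. A n)" by metis
  \<comment> \<open>Exhaustion \<open>G k \<subseteq> C k \<subseteq> G (k + 1)\<close> with \<open>G k\<close> open and \<open>C k\<close> compact; the compact layers
    \<open>L k\<close> cover, and the open sets \<open>W k\<close> around them are locally finite. For \<open>k = 0\<close> the truncated
    \<open>k - 1\<close> is harmless as \<open>C 0\<close> is empty.\<close>
  define N where "N k = (nx ^^ k) 0" for k
  define G where "G k = (\<Union>n<N k. A n)" for k
  define C where "C k = (\<Union>n<N k. B n)" for k
  have N: "N 0 = 0" "N (Suc k) = nx (N k)" for k by (simp_all add: N_def)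
  have "strict_mono N" by (rule strict_mono_Suc_iff[THEN iffD2]) (simp add: N nx)
  then have Nk: "k \<le> N k" for k by (rule strict_mono_imp_increasing)
  have GC: "G k \<subseteq> C k" for k unfolding G_def C_def using AB(3) by blast
  have CG: "C k \<subseteq> G (Suc k)" for k unfolding G_def C_def N(2) by (rule nx(2))
  have Gmono: "G j \<subseteq> G k" if "j \<le> k" for j k
    using that strict_mono_leD[OF \<open>strict_mono N\<close> that] unfolding G_def by (intro UN_mono) auto
  have openG: "openin M (G k)" for k unfolding G_def using AB(1) by blast
  have compC: "compactin M (C k)" for k unfolding C_def using AB(2) by (intro compactin_Union) auto
  have closC: "closedin M (C k)" for k by (rule compactin_imp_closedin[OF M(2) compC])
  have Gcover: "\<exists>k. p \<in> G k" if p: "p \<in> topspace M" for p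
  proof -
    obtain n where n: "p \<in> A n" using p unfolding cover by blast
    have "n < N (Suc n)" using Nk[of "Suc n"] by simp
    then have "p \<in> G (Suc n)" unfolding G_def using n by blast
    then show ?thesis by blast
  qed
  define L where "L k = C (Suc k) - G k" for k
  define W where "W k = G (Suc (Suc k)) - C (k - 1)" for k
  have CG1: "C (k - 1) \<subseteq> G k" for k
    using CG[of "k - 1"] by (cases k) (auto simp: C_def N)
  have openW: "openin M (W k)" for k unfolding W_def by (intro openin_diff openG closC)
  have LW: "L k \<subseteq> W k" for k unfolding L_def W_def using CG[of "Suc k"] CG1[of k] by blast
  have compL: "compactin M (L k)" for k
  proof -
    have "L k = C (Suc k) \<inter> (topspace M - G k)"
      unfolding L_def using compactin_subset_topspace[OF compC] by blast
    then show ?thesis using openG by (auto intro!: compact_Int_closedin compC)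
  qed
  have "\<exists>I. finite I \<and> (\<forall>i\<in>I. P i \<and> S i \<subseteq> W k) \<and> L k \<subseteq> (\<Union>i\<in>I. J i)" for k
  proof -
    have "\<forall>p\<in>L k. \<exists>i. P i \<and> openin M (J i) \<and> p \<in> J i \<and> S i \<subseteq> W k"
      using sel[OF openW] LW by blast
    then obtain s where s: "\<And>p. p \<in> L k \<Longrightarrow> P (s p) \<and> openin M (J (s p)) \<and> p \<in> J (s p) \<and> S (s p) \<subseteq> W k"
      by metis
    have "openin M U" if "U \<in> (\<lambda>p. J (s p)) ` L k" for U using s that by blast
    moreover have "L k \<subseteq> \<Union>((\<lambda>p. J (s p)) ` L k)" using s by blast
    ultimately have "\<exists>F. finite F \<and> F \<subseteq> (\<lambda>p. J (s p)) ` L k \<and> L k \<subseteq> \<Union>F"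
      by (rule compactinD[OF compL])
    then obtain F where F: "finite F" "F \<subseteq> (\<lambda>p. J (s p)) ` L k" "L k \<subseteq> \<Union>F"
      by blast
    then obtain T where T: "finite T" "T \<subseteq> L k" "F = (\<lambda>p. J (s p)) ` T"
      using finite_subset_image[OF F(1,2)] by blast
    then show ?thesis using s F(3) by (intro exI[of _ "s ` T"]) auto
  qed
  then obtain I where I: "\<And>k. finite (I k)" "\<And>k i. i \<in> I k \<Longrightarrow> P i \<and> S i \<subseteq> W k" "\<And>k. L k \<subseteq> (\<Union>i\<in>I k. J i)"
    by metis
  show thesis
  proof (rule that[of "\<Union>k. I k"])
    show "P i" if "i \<in> (\<Union>k. I k)" for i using that I(2) by blast
    show "topspace M \<subseteq> (\<Union>i\<in>\<Union>k. I k. J i)"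
    proof
      fix p assume "p \<in> topspace M"
      \<comment> \<open>The first \<open>k\<close> with \<open>p \<in> G k\<close> is not 0, as
        \<open>G 0\<close> is empty; so \<open>p\<close> lies in the layer just before it.\<close>
      then obtain k where k: "p \<in> G k" "\<And>j. j < k \<Longrightarrow> p \<notin> G j"
        using Gcover exists_least_iff[of "\<lambda>k. p \<in> G k"] by blast
      then obtain j where "k = Suc j" by (cases k) (auto simp: G_def N)
      then have "p \<in> L j" using k GC[of k] unfolding L_def by blast
      then show "p \<in> (\<Union>i\<in>\<Union>k. I k. J i)" using I(3)[of j] by blast
    qed
    fix p assume "p \<in> topspace M"
    then obtain m where m: "p \<in> G m" using Gcover by blast
    \<comment> \<open>The neighbourhood \<open>G m\<close> of \<open>p\<close> is contained in
      \<open>C (k - 1)\<close> for \<open>k > m\<close>, and \<open>W k\<close> avoids that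
      set.\<close>
    have "{i \<in> \<Union>k. I k. S i \<inter> G m \<noteq> {}} \<subseteq> (\<Union>k\<le>m. I k)"
    proof
      fix i assume "i \<in> {i \<in> \<Union>k. I k. S i \<inter> G m \<noteq> {}}"
      then obtain k where k: "i \<in> I k" "S i \<inter> G m \<noteq> {}" by blast
      have "k \<le> m"
      proof (rule ccontr)
        assume "\<not> k \<le> m"
        then have "G m \<subseteq> C (k - 1)" using Gmono[of m "k - 1"] GC[of "k - 1"] by force
        then show False using k I(2)[OF k(1)] unfolding W_def by blast
      qed
      then show "i \<in> (\<Union>k\<le>m. I k)" using k by blast
    qed
    then have "finite {i \<in> \<Union>k. I k. S i \<inter> G m \<noteq> {}}"
      by (rule finite_subset) (use I(1) in auto)
    then show "\<exists>W. openin M W \<and> p \<in> W \<and> finite {i \<in> \<Union>k. I k. S i \<inter> W \<noteq> {}}"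
      using openG m by blast
  qed
qed

section \<open>Charts\<close>

lemma bounded_bilinear_matrix_vector_mult:
  "bounded_bilinear ((*v) :: real ^ 'm ^ 'n \<Rightarrow> real ^ 'm \<Rightarrow> real ^ 'n)"
proof
  show "\<exists>K. \<forall>(A :: real ^ 'm ^ 'n) v. norm (A *v v) \<le> norm A * norm v * K"
    by (intro exI[of _ 1]) (simp add: norm_matrix_vector_le)
qed (auto simp: matrix_vector_mult_add_rdistrib matrix_vector_right_distrib matrix_vector_mult_scaleR
    scaleR_matrix_vector_assoc)

lemma topological_chartD:
  assumes "topological_chart M (U, \<phi>)"
  shows "openin (top_of_set half_space) U" "U \<subseteq> half_space" "openin M (\<phi> ` U)" "inj_on \<phi> U"
    "continuous_map (top_of_set U) M \<phi>"
    "homeomorphic_map (top_of_set U) (subtopology M (\<phi> ` U)) \<phi>"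
proof -
  show U: "openin (top_of_set half_space) U" and "openin M (\<phi> ` U)"
    and hom: "homeomorphic_map (top_of_set U) (subtopology M (\<phi> ` U)) \<phi>"
    using assms by (auto simp: topological_chart_def)
  show "U \<subseteq> half_space" using openin_imp_subset[OF U] .
  show "inj_on \<phi> U" using homeomorphic_imp_injective_map[OF hom] by simp
  show "continuous_map (top_of_set U) M \<phi>"
    using homeomorphic_imp_continuous_map[OF hom] by (simp add: continuous_map_in_subtopology)
qed

lemma openin_chart_image:
  assumes c: "topological_chart M (U, \<phi>)" and W: "openin (top_of_set half_space) W" "W \<subseteq> U"
  shows "openin M (\<phi> ` W)"
proof -
  have "openin (top_of_set U) W"
    using W topological_chartD(2)[OF c] by (rule openin_subset_trans)
  then have "openin (subtopology M (\<phi> ` U)) (\<phi> ` W)"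
    using homeomorphic_imp_open_map[OF topological_chartD(6)[OF c]] by (simp add: open_map_def)
  then show ?thesis
    using topological_chartD(3)[OF c] by (simp add: openin_open_subtopology)
qed

lemma openin_chart_preimage:
  assumes c: "topological_chart M (U, \<phi>)" and "openin M T"
  shows "openin (top_of_set half_space) {x \<in> U. \<phi> x \<in> T}"
proof -
  have "openin (top_of_set U) {x \<in> U. \<phi> x \<in> T}"
    using openin_continuous_map_preimage[OF topological_chartD(5)[OF c] assms(2)] by simp
  then show ?thesis using topological_chartD(1)[OF c] by (rule openin_trans)
qed

lemma compactin_chart_image:
  assumes c: "topological_chart M (U, \<phi>)" and K: "compact K" "K \<subseteq> U"
  shows "compactin M (\<phi> ` K)"
proof -
  have "compactin (top_of_set U) K" using K by (simp add: compactin_subtopology)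
  then show ?thesis using topological_chartD(5)[OF c] by (rule image_compactin)
qed

lemma smooth_manifold_chart:
  "smooth_manifold M A \<Longrightarrow> c \<in> A \<Longrightarrow> topological_chart M c"
  unfolding smooth_manifold_def by blast

lemma smooth_manifold_compatible:
  "smooth_manifold M A \<Longrightarrow> (U, \<phi>) \<in> A \<Longrightarrow> (V, \<psi>) \<in> A \<Longrightarrow>
     smooth_on {x\<in>U. \<phi> x \<in> \<psi> ` V} (inv_into V \<psi> \<circ> \<phi>)"
  unfolding smooth_manifold_def smoothly_compatible_def by blast

text \<open>Maximality of the atlas reduces this to compatibility. The inverses
  \<open>inv_into W \<phi>\<close> and \<open>inv_into U \<phi>\<close> are different functions that
  agree on the image of \<open>W\<close>.\<close>

lemma restrict_chart:
  fixes M :: "'a topology" and A :: "('m::{finite,linorder}, 'a) chart set"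
  assumes M: "smooth_manifold M A" and c: "(U, \<phi>) \<in> A"
    and W: "openin (top_of_set half_space) W" "W \<subseteq> U"
  shows "(W, \<phi>) \<in> A"
proof -
  have tc: "topological_chart M (U, \<phi>)" using M c by (rule smooth_manifold_chart)
  note U = topological_chartD[OF tc]
  have openW: "openin M (\<phi> ` W)" by (rule openin_chart_image[OF tc W])
  have "homeomorphic_map (subtopology (top_of_set U) W) (subtopology (subtopology M (\<phi> ` U)) (\<phi> ` W)) \<phi>"
    by (rule homeomorphic_map_subtopologies[OF U(6)])
       (use W openin_subset[OF U(3)] in auto)
  then have "homeomorphic_map (top_of_set W) (subtopology M (\<phi> ` W)) \<phi>"
    using W(2) by (simp add: subtopology_subtopology inf.absorb2 image_mono)
  then have "topological_chart M (W, \<phi>)"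
    using W openW by (simp add: topological_chart_def)
  moreover have "smoothly_compatible (W, \<phi>) d" if "d \<in> A" for d
  proof -
    obtain V \<psi> where d: "d = (V, \<psi>)" by (cases d)
    have dA: "(V, \<psi>) \<in> A" using that d by simp
    have "smooth_on {x\<in>W. \<phi> x \<in> \<psi> ` V} (inv_into V \<psi> \<circ> \<phi>)"
      by (rule smooth_on_subset[OF smooth_manifold_compatible[OF M c dA]]) (use W in auto)
    moreover have "smooth_on {y\<in>V. \<psi> y \<in> \<phi> ` W} (inv_into W \<phi> \<circ> \<psi>)"
    proof (rule smooth_on_cong)
      show "openin (top_of_set half_space) {y\<in>V. \<psi> y \<in> \<phi> ` W}"
        by (rule openin_chart_preimage[OF smooth_manifold_chart[OF M dA] openW])
      show "smooth_on {y\<in>V. \<psi> y \<in> \<phi> ` W} (inv_into U \<phi> \<circ> \<psi>)"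
        by (rule smooth_on_subset[OF smooth_manifold_compatible[OF M dA c]]) (use W in auto)
      fix y assume "y \<in> {y\<in>V. \<psi> y \<in> \<phi> ` W}"
      then obtain x where x: "x \<in> W" "\<psi> y = \<phi> x" by auto
      have "inj_on \<phi> W" using U(4) W(2) inj_on_subset by blast
      then show "(inv_into U \<phi> \<circ> \<psi>) y = (inv_into W \<phi> \<circ> \<psi>) y"
        using x W(2) U(4) by (auto simp: inv_into_f_f)
    qed
    ultimately show ?thesis by (simp add: d smoothly_compatible_def)
  qed
  ultimately show ?thesis using M unfolding smooth_manifold_def by blast
qed

section \<open>Jacobians of transition maps\<close>

lemma has_derivative_jacobian:
  fixes f :: "real ^ 'm \<Rightarrow> real ^ 'n"
  assumes "f differentiable (at y within S)"
  shows "(f has_derivative (*v) (jacobian f (at y within S))) (at y within S)"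
proof -
  have D: "(f has_derivative frechet_derivative f (at y within S)) (at y within S)"
    using assms by (simp add: frechet_derivative_works)
  moreover have "(*v) (jacobian f (at y within S)) = frechet_derivative f (at y within S)"
    by (rule ext) (simp add: jacobian_def matrix_works has_derivative_linear[OF D])
  ultimately show ?thesis by simp
qed

lemma smooth_on_continuous_jacobian:
  fixes f :: "real ^ 'm::{finite,linorder} \<Rightarrow> real ^ 'n"
  assumes "smooth_on W f"
  shows "continuous_on W (\<lambda>y. jacobian f (at y within half_space))"
proof -
  have "jacobian f (at y within half_space) = (\<chi> i j. nderiv f [axis j 1] y $ i)" for y
    by (simp add: jacobian_def matrix_def)
  moreover have "continuous_on W (nderiv f [axis j 1])" for j
    using assms unfolding smooth_on_def Ck_on_def by (metis One_nat_def length_Cons list.size(3) order_refl)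
  ultimately show ?thesis by (auto intro!: continuous_intros)
qed

text \<open>The chain rule for a composite that is the identity near \<open>y\<close>; uniqueness of
  derivatives within the half space covers boundary points.\<close>

lemma transition_jacobian_inverse:
  assumes M: "smooth_manifold M A" and c: "(U, \<phi>) \<in> A" "(V, \<psi>) \<in> A"
    and y: "y \<in> U" and z: "z \<in> V" and yz: "\<phi> y = \<psi> z"
  shows "jacobian (inv_into U \<phi> \<circ> \<psi>) (at z within half_space)
      ** jacobian (inv_into V \<psi> \<circ> \<phi>) (at y within half_space) = mat 1"
proof -
  let ?\<tau> = "inv_into V \<psi> \<circ> \<phi>" and ?\<sigma> = "inv_into U \<phi> \<circ> \<psi>"
  let ?W = "{x\<in>U. \<phi> x \<in> \<psi> ` V}"
  note tU = topological_chartD[OF smooth_manifold_chart[OF M c(1)]]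
  note tV = topological_chartD[OF smooth_manifold_chart[OF M c(2)]]
  have W: "openin (top_of_set half_space) ?W"
    by (rule openin_chart_preimage[OF smooth_manifold_chart[OF M c(1)] tV(3)])
  have yW: "y \<in> ?W" using y z yz by auto
  have \<tau>y: "?\<tau> y = z" using yz z tV(4) by (simp add: inv_into_f_f)
  have "(?\<tau> has_derivative (*v) (jacobian ?\<tau> (at y within half_space))) (at y within ?W)"
    unfolding at_within_openin_half_space[OF W yW]
    by (intro has_derivative_jacobian smooth_on_differentiable[OF smooth_manifold_compatible[OF M c] yW])
  moreover have "(?\<sigma> has_derivative (*v) (jacobian ?\<sigma> (at z within half_space))) (at (?\<tau> y) within ?\<tau> ` ?W)"
    unfolding \<tau>y
  proof (rule has_derivative_subset)
    show "(?\<sigma> has_derivative (*v) (jacobian ?\<sigma> (at z within half_space))) (at z within half_space)"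
      using yz y z by (intro has_derivative_jacobian smooth_on_differentiable[OF smooth_manifold_compatible[OF M c(2,1)]])
        (auto simp flip: yz)
    show "?\<tau> ` ?W \<subseteq> half_space" by (auto intro!: subsetD[OF tV(2)] inv_into_into)
  qed
  ultimately have "((\<lambda>x. ?\<sigma> (?\<tau> x)) has_derivative
      (\<lambda>x. jacobian ?\<sigma> (at z within half_space) *v (jacobian ?\<tau> (at y within half_space) *v x))) (at y within ?W)"
    by (rule has_derivative_in_compose)
  then have "((\<lambda>x. ?\<sigma> (?\<tau> x)) has_derivative
      (\<lambda>x. jacobian ?\<sigma> (at z within half_space) *v (jacobian ?\<tau> (at y within half_space) *v x))) (at y within half_space)"
    unfolding at_within_openin_half_space[OF W yW] .
  then have "((\<lambda>x. x) has_derivative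
      (\<lambda>x. jacobian ?\<sigma> (at z within half_space) *v (jacobian ?\<tau> (at y within half_space) *v x))) (at y within half_space)"
    by (subst has_derivative_half_space_cong[OF W _ yW, of _ "\<lambda>x. ?\<sigma> (?\<tau> x)"])
       (auto simp: f_inv_into_f inv_into_f_f tU(4))
  moreover have "((\<lambda>x. x) has_derivative (\<lambda>x. x)) (at y within half_space)" by (rule has_derivative_ident)
  moreover have "y \<in> half_space" using y tU(2) by blast
  ultimately have "(\<lambda>x. jacobian ?\<sigma> (at z within half_space) *v (jacobian ?\<tau> (at y within half_space) *v x)) = (\<lambda>x. x)"
    using has_derivative_half_space_unique by blast
  then show ?thesis
    unfolding matrix_eq by (simp add: matrix_vector_mul_assoc[symmetric] fun_eq_iff)
qed

section \<open>Maps and their Clarke derivatives in different charts\<close>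

lemma Ck1_mapsD:
  assumes "f \<in> Ck1_maps k M A N B" "(U, \<phi>) \<in> A" "(V, \<psi>) \<in> B"
  shows "Ck1_on k {x\<in>U. f (\<phi> x) \<in> \<psi> ` V} (inv_into V \<psi> \<circ> f \<circ> \<phi>)"
  using assms unfolding Ck1_maps_def by blast

lemma Ck1_maps_openin_preimage:
  assumes f: "f \<in> Ck1_maps k M A N B" and c: "topological_chart M (U, \<phi>)" and T: "openin N T"
  shows "openin (top_of_set half_space) {x \<in> U. f (\<phi> x) \<in> T}"
proof -
  have "continuous_map (top_of_set U) N (f \<circ> \<phi>)"
    using f by (intro continuous_map_compose[OF topological_chartD(5)[OF c]]) (simp add: Ck1_maps_def)
  from openin_continuous_map_preimage[OF this T]
  have "openin (top_of_set U) {x \<in> U. f (\<phi> x) \<in> T}" by simp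
  then show ?thesis using topological_chartD(1)[OF c] by (rule openin_trans)
qed

text \<open>The chain rule is applied only where the representative \<open>f\<close> of
  \<open>h\<close> in the given charts is differentiable, and yields the bound with transition
  Jacobians on both sides. These are continuous, so in the limit they become the fixed matrices
  \<open>P\<close> and \<open>Q\<close> at the given point, and the bound, linear in
  \<open>D\<close>, extends from limits of Jacobians to their convex hull.\<close>

lemma clarke_derivative_change_charts:
  fixes M :: "'a topology" and A :: "('m::{finite,linorder}, 'a) chart set"
    and N :: "'b topology" and B :: "('n::{finite,linorder}, 'b) chart set"
  assumes M: "smooth_manifold M A" and N: "smooth_manifold N B" and h: "h \<in> Ck1_maps k M A N B"
    and c: "(U, \<phi>) \<in> A" "(U1, \<phi>1) \<in> A" "(V, \<psi>) \<in> B" "(V1, \<psi>1) \<in> B"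
    and hU: "(h \<circ> \<phi>) ` U \<subseteq> \<psi> ` V"
    and x: "x \<in> U" "x1 \<in> U1" "\<phi> x = \<phi>1 x1" "x1 \<in> ball p r"
    and S: "ball p r \<inter> half_space \<subseteq> U1" "(h \<circ> \<phi>1) ` (ball p r \<inter> half_space) \<subseteq> \<psi>1 ` V1"
    and ex: "expanding_on R e (ball p r \<inter> half_space) (inv_into V1 \<psi>1 \<circ> h \<circ> \<phi>1)"
  obtains P P' Q Q' where "Q ** Q' = mat 1" "P' ** P = mat 1"
    "\<And>v w D. (v, w) \<in> R \<Longrightarrow> D \<in> clarke_derivative U (inv_into V \<psi> \<circ> h \<circ> \<phi>) x \<Longrightarrow>
       e \<le> w \<bullet> ((P ** D ** Q) *v v)"
proof -
  note tU = topological_chartD[OF smooth_manifold_chart[OF M c(1)]]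
  note tU1 = topological_chartD[OF smooth_manifold_chart[OF M c(2)]]
  note tV = topological_chartD[OF smooth_manifold_chart[OF N c(3)]]
  note tV1 = topological_chartD[OF smooth_manifold_chart[OF N c(4)]]
  define f where "f = inv_into V \<psi> \<circ> h \<circ> \<phi>"
  define h1 where "h1 = inv_into V1 \<psi>1 \<circ> h \<circ> \<phi>1"
  define b where "b = inv_into U \<phi> \<circ> \<phi>1"
  define \<beta> where "\<beta> = inv_into U1 \<phi>1 \<circ> \<phi>"
  define a where "a = inv_into V1 \<psi>1 \<circ> \<psi>"
  define Wb where "Wb = {y\<in>U1. \<phi>1 y \<in> \<phi> ` U}"
  define W\<beta> where "W\<beta> = {y\<in>U. \<phi> y \<in> \<phi>1 ` U1}"
  define Wa where "Wa = {z\<in>V. \<psi> z \<in> \<psi>1 ` V1}"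
  define Jb where "Jb y = jacobian b (at y within half_space)" for y
  define Ja where "Ja z = jacobian a (at z within half_space)" for z
  have sb: "smooth_on Wb b" unfolding Wb_def b_def by (rule smooth_manifold_compatible[OF M c(2,1)])
  have s\<beta>: "smooth_on W\<beta> \<beta>" unfolding W\<beta>_def \<beta>_def by (rule smooth_manifold_compatible[OF M c(1,2)])
  have sa: "smooth_on Wa a" unfolding Wa_def a_def by (rule smooth_manifold_compatible[OF N c(3,4)])
  have oWb: "openin (top_of_set half_space) Wb"
    unfolding Wb_def by (rule openin_chart_preimage[OF smooth_manifold_chart[OF M c(2)] tU(3)])
  have oW\<beta>: "openin (top_of_set half_space) W\<beta>"
    unfolding W\<beta>_def by (rule openin_chart_preimage[OF smooth_manifold_chart[OF M c(1)] tU1(3)])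
  have f\<psi>: "f y \<in> V" "\<psi> (f y) = h (\<phi> y)" if "y \<in> U" for y
  proof -
    have "h (\<phi> y) \<in> \<psi> ` V" using hU that by auto
    then show "f y \<in> V" "\<psi> (f y) = h (\<phi> y)"
      unfolding f_def by (simp_all add: f_inv_into_f inv_into_into)
  qed
  have contf: "continuous_on U f"
  proof -
    have "{y\<in>U. h (\<phi> y) \<in> \<psi> ` V} = U" using hU by auto
    then have "Ck1_on k U f" using Ck1_mapsD[OF h c(1,3)] by (simp add: f_def)
    then show ?thesis
      unfolding Ck1_on_def Ck_on_def by (metis le0 list.size(3) nderiv.simps(1))
  qed
  \<comment> \<open>The part of the half ball that the chart \<open>\<phi>\<close> sees as well.
    There \<open>h1\<close> is the composite of \<open>b\<close>, \<open>f\<close> and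
    \<open>a\<close>, so differentiability of \<open>f\<close> at \<open>b y\<close> gives that of
    \<open>h1\<close> at \<open>y\<close>.\<close>
  define S1 where "S1 = Wb \<inter> ball p r"
  have oS1: "openin (top_of_set half_space) S1"
  proof -
    have "S1 = Wb \<inter> (half_space \<inter> ball p r)" using openin_imp_subset[OF oWb] unfolding S1_def by blast
    then show ?thesis using oWb by (simp add: openin_Int openin_open_Int)
  qed
  have S1: "y \<in> ball p r \<inter> half_space" "b y \<in> U" "\<phi> (b y) = \<phi>1 y" "f (b y) \<in> Wa" "h1 y = a (f (b y))" if "y \<in> S1" for y
  proof -
    have y: "y \<in> U1" "\<phi>1 y \<in> \<phi> ` U" "y \<in> ball p r" "y \<in> half_space"
      using that tU1(2) unfolding S1_def Wb_def by auto
    show "y \<in> ball p r \<inter> half_space" using y by simp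
    show b: "b y \<in> U" "\<phi> (b y) = \<phi>1 y"
      using y(2) unfolding b_def by (auto simp: f_inv_into_f intro: inv_into_into)
    have "(h \<circ> \<phi>1) y \<in> \<psi>1 ` V1" using y S(2) by blast
    then have "h (\<phi>1 y) \<in> \<psi>1 ` V1" by simp
    then show "f (b y) \<in> Wa" unfolding Wa_def using f\<psi>[OF b(1)] b(2) by simp
    show "h1 y = a (f (b y))" unfolding h1_def a_def o_def f\<psi>(2)[OF b(1)] b(2) ..
  qed
  have point: "e \<le> w \<bullet> (Ja (f (b y)) *v (J *v (Jb y *v v)))"
    if vw: "(v, w) \<in> R" and y: "y \<in> S1" and J: "(f has_derivative (*v) J) (at (b y) within U)" for v w y J
  proof (rule expanding_on_derivative[OF ex vw])
    show "y \<in> ball p r" "y \<in> half_space" using S1(1)[OF y] by auto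
    have "(b has_derivative (*v) (Jb y)) (at y within S1)"
      unfolding Jb_def at_within_openin_half_space[OF oS1 y]
      using y by (intro has_derivative_jacobian smooth_on_differentiable[OF sb]) (simp add: S1_def)
    moreover have "(f has_derivative (*v) J) (at (b y) within b ` S1)"
      using J by (rule has_derivative_subset) (use S1(2) in blast)
    ultimately have 1: "((\<lambda>y. f (b y)) has_derivative (\<lambda>v. J *v (Jb y *v v))) (at y within S1)"
      by (rule has_derivative_in_compose)
    have "(a has_derivative (*v) (Ja (f (b y)))) (at (f (b y)) within half_space)"
      unfolding Ja_def by (intro has_derivative_jacobian smooth_on_differentiable[OF sa] S1(4)[OF y])
    then have "(a has_derivative (*v) (Ja (f (b y)))) (at (f (b y)) within (\<lambda>y. f (b y)) ` S1)"
      by (rule has_derivative_subset) (use S1(4) tV(2) in \<open>auto simp: Wa_def\<close>)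
    from has_derivative_in_compose[OF 1 this]
    have "((\<lambda>y. a (f (b y))) has_derivative (\<lambda>v. Ja (f (b y)) *v (J *v (Jb y *v v)))) (at y within half_space)"
      unfolding at_within_openin_half_space[OF oS1 y] .
    then show "(inv_into V1 \<psi>1 \<circ> h \<circ> \<phi>1 has_derivative (\<lambda>v. Ja (f (b y)) *v (J *v (Jb y *v v)))) (at y within half_space)"
      unfolding h1_def[symmetric]
      by (subst has_derivative_half_space_cong[OF oS1 _ y, of h1 "\<lambda>y. a (f (b y))"]) (rule S1(5))
  qed
  have x1: "x1 \<in> S1" "b x1 = x" "\<beta> x = x1" "x \<in> W\<beta>"
    using x tU(4) tU1(4)
    by (auto simp: S1_def Wb_def W\<beta>_def b_def \<beta>_def x(3)[symmetric] inv_into_f_f)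
       (auto simp: x(3) inv_into_f_f)
  define Q where "Q = Jb x1"
  define P where "P = Ja (f x)"
  have fx: "f x \<in> Wa" using S1(4)[OF x1(1)] x1(2) by simp
  have lim: "e \<le> w \<bullet> (P *v (D *v (Q *v v)))"
    if vw: "(v, w) \<in> R" and X: "\<forall>i::nat. X i \<in> U \<and> f differentiable (at (X i) within U)" "X \<longlonglongrightarrow> x"
      "(\<lambda>i. jacobian f (at (X i) within U)) \<longlonglongrightarrow> D" for v w X D
  proof -
    \<comment> \<open>Near \<open>x\<close> the transition map \<open>\<beta>\<close> carries points
      of \<open>U\<close> into \<open>S1\<close>, where the pointwise bound is available, and
      \<open>b\<close> undoes \<open>\<beta>\<close>.\<close>
    define S2 where "S2 = W\<beta> \<inter> \<beta> -` S1"
    have "openin (top_of_set W\<beta>) S2"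
    proof -
      have "\<beta> ` W\<beta> \<subseteq> half_space"
        unfolding \<beta>_def W\<beta>_def by (auto intro!: subsetD[OF tU1(2)] inv_into_into)
      then show ?thesis
        unfolding S2_def using oS1 smooth_on_continuous[OF s\<beta>] by (intro continuous_openin_preimage) auto
    qed
    then have oS2: "openin (top_of_set half_space) S2" using oW\<beta> by (rule openin_trans)
    have "x \<in> S2" using x1 by (simp add: S2_def)
    then obtain \<rho> where \<rho>: "0 < \<rho>" "cball x \<rho> \<inter> half_space \<subseteq> S2"
      using openin_half_space_cball[OF oS2] by metis
    have evX: "\<forall>\<^sub>F i in sequentially. X i \<in> S2"
      using tendstoD[OF X(2) \<rho>(1)]
    proof eventually_elim
      case (elim i)
      then have "X i \<in> cball x \<rho> \<inter> half_space" using X(1) tU(2) by (auto simp: dist_commute)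
      then show ?case using \<rho>(2) by blast
    qed
    have evb: "b (\<beta> y) = y" if "y \<in> S2" for y
    proof -
      have "y \<in> U" "\<phi> y \<in> \<phi>1 ` U1" using that unfolding S2_def W\<beta>_def by auto
      then show ?thesis by (simp add: b_def \<beta>_def f_inv_into_f inv_into_f_f tU(4))
    qed
    have 1: "(\<lambda>i. \<beta> (X i)) \<longlonglongrightarrow> \<beta> x"
      by (rule continuous_on_tendsto_compose[OF smooth_on_continuous[OF s\<beta>] X(2) x1(4)])
         (use evX in eventually_elim, simp add: S2_def)
    have "\<forall>\<^sub>F i in sequentially. \<beta> (X i) \<in> Wb"
      using evX by eventually_elim (simp add: S2_def S1_def)
    then have 2: "(\<lambda>i. Jb (\<beta> (X i))) \<longlonglongrightarrow> Jb (\<beta> x)"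
      using x1 unfolding Jb_def
      by (intro continuous_on_tendsto_compose[OF smooth_on_continuous_jacobian[OF sb] 1]) (auto simp: S1_def)
    have 3: "(\<lambda>i. f (X i)) \<longlonglongrightarrow> f x"
      by (rule continuous_on_tendsto_compose[OF contf X(2) x(1)]) (use X(1) in simp)
    have "\<forall>\<^sub>F i in sequentially. f (X i) \<in> Wa"
      using evX
    proof eventually_elim
      case (elim i)
      then show ?case using S1(4)[of "\<beta> (X i)"] evb[OF elim] by (simp add: S2_def)
    qed
    then have 4: "(\<lambda>i. Ja (f (X i))) \<longlonglongrightarrow> Ja (f x)"
      unfolding Ja_def
      by (intro continuous_on_tendsto_compose[OF smooth_on_continuous_jacobian[OF sa] 3 fx])
    let ?J = "\<lambda>i. jacobian f (at (X i) within U)"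
    have "\<forall>\<^sub>F i in sequentially. e \<le> w \<bullet> (Ja (f (X i)) *v (?J i *v (Jb (\<beta> (X i)) *v v)))"
      using evX
    proof eventually_elim
      case (elim i)
      have "\<beta> (X i) \<in> S1" using elim by (simp add: S2_def)
      moreover have "(f has_derivative (*v) (?J i)) (at (b (\<beta> (X i))) within U)"
        unfolding evb[OF elim] using X(1) by (intro has_derivative_jacobian) blast
      ultimately show ?case using point[OF vw, of "\<beta> (X i)" "?J i"] by (simp add: evb[OF elim])
    qed
    moreover have "(\<lambda>i. w \<bullet> (Ja (f (X i)) *v (?J i *v (Jb (\<beta> (X i)) *v v))))
        \<longlonglongrightarrow> w \<bullet> (Ja (f x) *v (D *v (Jb (\<beta> x) *v v)))"
      by (intro tendsto_intros bounded_bilinear.tendsto[OF bounded_bilinear_matrix_vector_mult] 2 4 X(3))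
    ultimately have "e \<le> w \<bullet> (Ja (f x) *v (D *v (Jb (\<beta> x) *v v)))"
      by (intro tendsto_lowerbound[where F=sequentially]) auto
    then show ?thesis by (simp add: P_def Q_def x1)
  qed
  have hull: "e \<le> w \<bullet> ((P ** D ** Q) *v v)" if vw: "(v, w) \<in> R" and D: "D \<in> clarke_derivative U f x" for v w D
  proof -
    \<comment> \<open>Linear in \<open>D\<close> because \<open>P\<close> and \<open>Q\<close> no
      longer vary; so the matrices satisfying the bound form a convex set.\<close>
    have lin: "linear (\<lambda>D. w \<bullet> (P *v (D *v (Q *v v))))"
      by (rule linearI)
         (simp_all add: matrix_vector_mult_add_rdistrib matrix_vector_right_distrib inner_add_right
           matrix_vector_mult_scaleR flip: scaleR_matrix_vector_assoc)
    have "convex ((\<lambda>D. w \<bullet> (P *v (D *v (Q *v v)))) -` {e..})"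
      by (intro convex_linear_vimage lin convex_real_interval)
    moreover have "{A. \<exists>X. (\<forall>i::nat. X i \<in> U \<and> f differentiable (at (X i) within U)) \<and> X \<longlonglongrightarrow> x \<and>
             (\<lambda>i. jacobian f (at (X i) within U)) \<longlonglongrightarrow> A} \<subseteq> (\<lambda>D. w \<bullet> (P *v (D *v (Q *v v)))) -` {e..}"
      using lim[OF vw] by auto
    ultimately have "clarke_derivative U f x \<subseteq> (\<lambda>D. w \<bullet> (P *v (D *v (Q *v v)))) -` {e..}"
      unfolding clarke_derivative_def by (rule hull_minimal[rotated])
    then show ?thesis using D by (auto simp: matrix_vector_mul_assoc[symmetric])
  qed
  have "Q ** jacobian (inv_into U1 \<phi>1 \<circ> \<phi>) (at x within half_space) = mat 1"
    unfolding Q_def Jb_def b_def by (rule transition_jacobian_inverse[OF M c(1,2) x(1-3)])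
  moreover have "jacobian (inv_into V \<psi> \<circ> \<psi>1) (at (a (f x)) within half_space) ** P = mat 1"
  proof -
    have "f x \<in> V" "\<psi> (f x) \<in> \<psi>1 ` V1" using fx by (auto simp: Wa_def)
    then show ?thesis
      unfolding P_def Ja_def a_def
      by (intro transition_jacobian_inverse[OF N c(3,4)]) (auto simp: f_inv_into_f intro: inv_into_into)
  qed
  ultimately show thesis using hull that unfolding f_def by blast
qed

section \<open>Openness\<close>

lemma chart_around:
  assumes "smooth_manifold M A" "p \<in> topspace M"
  obtains U \<phi> a where "(U, \<phi>) \<in> A" "a \<in> U" "\<phi> a = p"
proof -
  have "p \<in> (\<Union>(U, \<phi>)\<in>A. \<phi> ` U)"
    using assms unfolding smooth_manifold_def by metis
  then show thesis using that by auto
qed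

lemma elementary_nbhd_self:
  fixes A :: "('m::{finite,linorder}, 'a) chart set" and B :: "('n::{finite,linorder}, 'b) chart set"
  assumes f: "f \<in> Ck1_maps k M A N B" and adm: "admissible A B f i"
    and A: "\<And>U \<phi>. (U, \<phi>) \<in> A \<Longrightarrow> U \<subseteq> half_space"
  shows "f \<in> elementary_nbhd k M A N B f i"
proof -
  obtain K U \<phi> V \<psi> \<epsilon> where i: "i = (K, (U, \<phi>), (V, \<psi>), \<epsilon>)" by (metis prod.collapse)
  have adm': "K \<subseteq> half_space" "0 < \<epsilon>" "(f \<circ> \<phi>) ` K \<subseteq> \<psi> ` V"
    using adm A[of U \<phi>] by (auto simp: admissible_def i)
  have "Ck1_norm k K (\<lambda>x. 0 :: (real, 'n) vec) < \<epsilon>"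
    using Ck1_norm_zero[OF adm'(1), of k] adm'(2) by (rule le_less_trans)
  then show ?thesis using f adm'(3) by (simp add: elementary_nbhd_def i)
qed

text \<open>From the bound \<open>c\<close> at the centre, half is given up to have it on a half
  ball and a quarter to allow for the perturbation; so \<open>c / 4\<close> is both the size of the
  neighbourhood and the bound that remains.\<close>

lemma expanding_nbhd_exists:
  fixes M :: "'a topology" and A :: "('m::{finite,linorder}, 'a) chart set"
    and N :: "'b topology" and B :: "('n::{finite,linorder}, 'b) chart set"
  assumes M: "smooth_manifold M A" and N: "smooth_manifold N B" and f: "f \<in> Ck1_maps k M A N B"
    and R: "\<And>R. \<Q> R \<Longrightarrow> \<forall>(v, w)\<in>R. norm v \<le> 1 \<and> norm w \<le> 1"
    and definite: "\<And>U \<phi> V \<psi> x. (U, \<phi>) \<in> A \<Longrightarrow> (V, \<psi>) \<in> B \<Longrightarrow> (f \<circ> \<phi>) ` U \<subseteq> \<psi> ` V \<Longrightarrow> x \<in> U \<Longrightarrow>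
       uniformly_definite \<Q> (clarke_derivative U (inv_into V \<psi> \<circ> f \<circ> \<phi>) x)"
    and T: "openin M T" "p \<in> T"
  obtains U \<phi> V \<psi> a r e R where "(U, \<phi>) \<in> A" "(V, \<psi>) \<in> B" "a \<in> U" "\<phi> a = p" "0 < r"
    "cball a r \<inter> half_space \<subseteq> U" "\<phi> ` U \<subseteq> T" "(f \<circ> \<phi>) ` U \<subseteq> \<psi> ` V" "0 < e" "\<Q> R"
    "\<And>h. h \<in> elementary_nbhd k M A N B f (cball a r \<inter> half_space, (U, \<phi>), (V, \<psi>), ereal e) \<Longrightarrow>
       expanding_on R e (ball a r \<inter> half_space) (inv_into V \<psi> \<circ> h \<circ> \<phi>)"
proof -
  have pM: "p \<in> topspace M" using T openin_subset by blast
  then obtain U0 \<phi> a where c0: "(U0, \<phi>) \<in> A" and a: "a \<in> U0" "\<phi> a = p"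
    by (rule chart_around[OF M])
  have "f p \<in> topspace N" using f pM unfolding Ck1_maps_def by blast
  then obtain V \<psi> b where d: "(V, \<psi>) \<in> B" and "b \<in> V" "\<psi> b = f p"
    by (rule chart_around[OF N])
  then have fp: "f p \<in> \<psi> ` V" by (metis image_eqI)
  note tU0 = topological_chartD[OF smooth_manifold_chart[OF M c0]]
  note tV = topological_chartD[OF smooth_manifold_chart[OF N d]]
  \<comment> \<open>The chart is shrunk to have its image in \<open>T\<close> and to be mapped by
    \<open>f\<close> into a single chart of \<open>N\<close>, as the hypothesis
    \<open>definite\<close> requires.\<close>
  define U where "U = {x \<in> U0. \<phi> x \<in> T} \<inter> {x \<in> U0. f (\<phi> x) \<in> \<psi> ` V}"
  have U: "openin (top_of_set half_space) U"
    unfolding U_def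
    by (intro openin_Int openin_chart_preimage[OF smooth_manifold_chart[OF M c0] T(1)]
        Ck1_maps_openin_preimage[OF f smooth_manifold_chart[OF M c0] tV(3)])
  have c: "(U, \<phi>) \<in> A" by (rule restrict_chart[OF M c0 U]) (auto simp: U_def)
  have aU: "a \<in> U" using a T(2) fp by (simp add: U_def)
  have fU: "(f \<circ> \<phi>) ` U \<subseteq> \<psi> ` V" by (auto simp: U_def)
  define F where "F = inv_into V \<psi> \<circ> f \<circ> \<phi>"
  have UV: "{x\<in>U. f (\<phi> x) \<in> \<psi> ` V} = U" by (auto simp: U_def)
  have F: "Ck1_on k U F" using Ck1_mapsD[OF f c d] by (simp add: F_def UV)
  obtain R c where Q: "\<Q> R" and c0: "0 < c"
    and RD: "\<And>v w D. (v, w) \<in> R \<Longrightarrow> D \<in> clarke_derivative U F a \<Longrightarrow> c \<le> w \<bullet> (D *v v)"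
    using definite[OF c d fU aU] unfolding uniformly_definite_def F_def by blast
  have R1: "norm v \<le> 1 \<and> norm w \<le> 1" if "(v, w) \<in> R" for v w using R[OF Q] that by blast
  obtain r0 L where r0: "0 < r0" "L-lipschitz_on (ball a r0 \<inter> half_space) F"
    using Ck1_on_locally_Lipschitz[OF U aU F] .
  have "c / 2 < c" using c0 by simp
  from expanding_on_if_clarke[OF U aU r0 R1 RD this]
  obtain r1 where r1: "0 < r1" "expanding_on R (c / 2) (ball a r1 \<inter> half_space) F" by metis
  obtain r2 where r2: "0 < r2" "cball a r2 \<inter> half_space \<subseteq> U"
    using openin_half_space_cball[OF U aU] .
  define r where "r = min (r1 / 2) r2"
  have r: "0 < r" "cball a r \<subseteq> ball a r1" "cball a r \<inter> half_space \<subseteq> U"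
    using r1(1) r2 by (auto simp: r_def)
  let ?K = "cball a r \<inter> half_space"
  have "expanding_on R (c / 4) (ball a r \<inter> half_space) (inv_into V \<psi> \<circ> h \<circ> \<phi>)"
    if h: "h \<in> elementary_nbhd k M A N B f (?K, (U, \<phi>), (V, \<psi>), ereal (c / 4))" for h
  proof -
    define H where "H = inv_into V \<psi> \<circ> h \<circ> \<phi>"
    have h': "h \<in> Ck1_maps k M A N B" "(h \<circ> \<phi>) ` ?K \<subseteq> \<psi> ` V" "Ck1_norm k ?K (\<lambda>x. H x - F x) < ereal (c / 4)"
      using h by (auto simp: elementary_nbhd_def H_def F_def)
    have "(c / 4)-lipschitz_on ?K (\<lambda>x. H x - F x)"
    proof (rule Lipschitz_if_Ck1_norm_less[OF _ _ _ h'(3)])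
      show "convex ?K" by (intro convex_Int convex_cball convex_half_space)
      fix x assume k: "0 < k" and x: "x \<in> ?K"
      have "F differentiable (at x within half_space)"
        using Ck1_on_differentiable[OF F k] x r(3) by blast
      moreover have "H differentiable (at x within half_space)"
        unfolding H_def
        by (rule Ck1_on_differentiable[OF Ck1_mapsD[OF h'(1) c d] k]) (use x r(3) h'(2) in auto)
      ultimately show "(\<lambda>x. H x - F x) differentiable (at x within half_space)"
        by (intro differentiable_diff)
    qed (use c0 in auto)
    moreover have "expanding_on R (c / 2) ?K F"
      by (rule expanding_on_subset[OF r1(2)]) (use r(2) in auto)
    ultimately have "expanding_on R (c / 2 - c / 4) ?K H"
      using R1 by (intro expanding_on_perturb[of R "c / 2" ?K F]) auto
    then have "expanding_on R (c / 4) ?K H" by simp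
    then show ?thesis unfolding H_def by (rule expanding_on_subset) auto
  qed
  moreover have "\<phi> ` U \<subseteq> T" by (auto simp: U_def)
  ultimately show thesis
    using c d aU a(2) r(1,3) fU c0 Q by (intro that[of U \<phi> V \<psi> a r "c / 4" R]) auto
qed

text \<open>Submersions and immersions differ only in \<open>\<Q>\<close>, and
  \<open>transform\<close> is what a change of charts asks of it. Around \<open>f\<close> a single
  basis set is built; its locally finite family allows the radius to vary from place to
  place.\<close>

theorem openin_uniformly_definite_maps:
  fixes M :: "'a topology" and A :: "('m::{finite,linorder}, 'a) chart set"
    and N :: "'b topology" and B :: "('n::{finite,linorder}, 'b) chart set"
  assumes M: "smooth_manifold M A" and N: "smooth_manifold N B"
    and R: "\<And>R. \<Q> R \<Longrightarrow> \<forall>(v, w)\<in>R. norm v \<le> 1 \<and> norm w \<le> 1"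
    and transform: "\<And>R c P P' Q Q' C. \<Q> R \<Longrightarrow> 0 < c \<Longrightarrow> Q ** Q' = mat 1 \<Longrightarrow> P' ** P = mat 1 \<Longrightarrow>
       (\<And>v w D. (v, w) \<in> R \<Longrightarrow> D \<in> C \<Longrightarrow> c \<le> w \<bullet> ((P ** D ** Q) *v v)) \<Longrightarrow> uniformly_definite \<Q> C"
  shows "openin (strong_topology k M A N B) {f \<in> Ck1_maps k M A N B.
     \<forall>(U, \<phi>)\<in>A. \<forall>(V, \<psi>)\<in>B. (f \<circ> \<phi>) ` U \<subseteq> \<psi> ` V \<longrightarrow>
       (\<forall>x\<in>U. uniformly_definite \<Q> (clarke_derivative U (inv_into V \<psi> \<circ> f \<circ> \<phi>) x))}"
    (is "openin _ ?X")
proof (subst openin_subopen, intro ballI)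
  fix f assume fX: "f \<in> ?X"
  then have f: "f \<in> Ck1_maps k M A N B" by blast
  have definite: "uniformly_definite \<Q> (clarke_derivative U (inv_into V \<psi> \<circ> f \<circ> \<phi>) x)"
    if "(U, \<phi>) \<in> A" "(V, \<psi>) \<in> B" "(f \<circ> \<phi>) ` U \<subseteq> \<psi> ` V" "x \<in> U" for U \<phi> V \<psi> x
    using fX that by blast
  \<comment> \<open>An index consists of the data of an elementary neighbourhood together with the
    centre and radius of a half ball, which the data alone do not record.\<close>
  define J :: "('m, 'a, 'n, 'b) nbhd_data \<times> (real, 'm) vec \<times> real \<Rightarrow> 'a set" where "J = (\<lambda>((K, (U, \<phi>), (V, \<psi>), \<epsilon>), a, r).
    \<phi> ` (ball a r \<inter> half_space))"
  define S :: "('m, 'a, 'n, 'b) nbhd_data \<times> (real, 'm) vec \<times> real \<Rightarrow> 'a set" where "S = (\<lambda>((K, (U, \<phi>), (V, \<psi>), \<epsilon>), a, r). \<phi> ` K)"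
  define good :: "('m, 'a, 'n, 'b) nbhd_data \<times> (real, 'm) vec \<times> real \<Rightarrow> bool" where "good = (\<lambda>((K, (U, \<phi>), (V, \<psi>), \<epsilon>), a, r).
    admissible A B f (K, (U, \<phi>), (V, \<psi>), \<epsilon>) \<and> ball a r \<inter> half_space \<subseteq> K \<and>
    (\<exists>R e. \<Q> R \<and> 0 < e \<and> (\<forall>h\<in>elementary_nbhd k M A N B f (K, (U, \<phi>), (V, \<psi>), \<epsilon>).
       expanding_on R e (ball a r \<inter> half_space) (inv_into V \<psi> \<circ> h \<circ> \<phi>))))"
  have sel: "\<exists>i. good i \<and> openin M (J i) \<and> p \<in> J i \<and> J i \<subseteq> S i \<and> compactin M (S i) \<and> S i \<subseteq> W"
    if W: "openin M W" "p \<in> W" for p W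
  proof -
    obtain U \<phi> V \<psi> a r e R where c: "(U, \<phi>) \<in> A" and d: "(V, \<psi>) \<in> B" and a: "a \<in> U" "\<phi> a = p" and r: "0 < r"
      and K: "cball a r \<inter> half_space \<subseteq> U" and UW: "\<phi> ` U \<subseteq> W" and fU: "(f \<circ> \<phi>) ` U \<subseteq> \<psi> ` V"
      and e: "0 < e" and Q: "\<Q> R"
      and ex: "\<And>h. h \<in> elementary_nbhd k M A N B f (cball a r \<inter> half_space, (U, \<phi>), (V, \<psi>), ereal e) \<Longrightarrow>
       expanding_on R e (ball a r \<inter> half_space) (inv_into V \<psi> \<circ> h \<circ> \<phi>)"
      by (rule expanding_nbhd_exists[OF M N f R definite W]) (assumption+, blast)
    note tc = smooth_manifold_chart[OF M c]
    let ?K = "cball a r \<inter> half_space"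
    let ?i = "((?K, (U, \<phi>), (V, \<psi>), ereal e), a, r)"
    have compK: "compact ?K" by (intro compact_Int_closed compact_cball closed_half_space)
    have "admissible A B f (?K, (U, \<phi>), (V, \<psi>), ereal e)"
      unfolding admissible_def using c d K fU e compK by auto
    then have "good ?i"
      unfolding good_def using Q e ex by auto
    moreover have "openin M (J ?i)"
    proof -
      have "openin (top_of_set half_space) (ball a r \<inter> half_space)"
        by (metis inf_commute open_ball openin_open_Int)
      moreover have "ball a r \<inter> half_space \<subseteq> U" using K by auto
      ultimately show ?thesis unfolding J_def by (simp add: openin_chart_image[OF tc])
    qed
    moreover have "p \<in> J ?i"
      unfolding J_def using a r topological_chartD(2)[OF tc] by auto
    moreover have "J ?i \<subseteq> S ?i" unfolding J_def S_def by auto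
    moreover have "compactin M (S ?i)"
      unfolding S_def using compactin_chart_image[OF tc compK K] by simp
    moreover have "S ?i \<subseteq> W" unfolding S_def using K UW by auto
    ultimately show ?thesis by blast
  qed
  have "second_countable M" "Hausdorff_space M" using M unfolding smooth_manifold_def by blast+
  then obtain I where I: "\<And>i. i \<in> I \<Longrightarrow> good i" "topspace M \<subseteq> (\<Union>i\<in>I. J i)"
    and fin: "\<And>p. p \<in> topspace M \<Longrightarrow> \<exists>W. openin M W \<and> p \<in> W \<and> finite {i \<in> I. S i \<inter> W \<noteq> {}}"
    by (rule locally_finite_cover_selection[of M good J S, OF _ _ sel]) (assumption+, blast)
  \<comment> \<open>Different indices may carry the same neighbourhood data, so the family is the
    image under \<open>fst\<close>; local finiteness passes to this image.\<close>
  define G where "G = Ck1_maps k M A N B \<inter> (\<Inter>i\<in>fst ` I. elementary_nbhd k M A N B f i)"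
  have adm: "admissible A B f i" if "i \<in> fst ` I" for i
    using that I(1) unfolding good_def by fastforce
  have "locally_finite_data M (fst ` I)"
    unfolding locally_finite_data_def
  proof
    fix p assume "p \<in> topspace M"
    then obtain W where W: "openin M W" "p \<in> W" "finite {i \<in> I. S i \<inter> W \<noteq> {}}" using fin by blast
    have "{i \<in> fst ` I. case i of (K, (U, \<phi>), _) \<Rightarrow> \<phi> ` K \<inter> W \<noteq> {}} \<subseteq> fst ` {i \<in> I. S i \<inter> W \<noteq> {}}"
      by (force simp: S_def)
    then have "finite {i \<in> fst ` I. case i of (K, (U, \<phi>), _) \<Rightarrow> \<phi> ` K \<inter> W \<noteq> {}}"
      using W(3) finite_subset by blast
    then show "\<exists>W. openin M W \<and> p \<in> W \<and> finite {i \<in> fst ` I. case i of (K, (U, \<phi>), _) \<Rightarrow> \<phi> ` K \<inter> W \<noteq> {}}"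
      using W by blast
  qed
  then have "G \<in> strong_basis k M A N B"
    unfolding strong_basis_def G_def using f adm by blast
  then have "openin (strong_topology k M A N B) G"
    unfolding strong_topology_def by (rule topology_generated_by_Basis)
  moreover have "f \<in> elementary_nbhd k M A N B f i" if "i \<in> fst ` I" for i
    by (rule elementary_nbhd_self[OF f adm[OF that]])
       (rule topological_chartD(2)[OF smooth_manifold_chart[OF M]])
  then have "f \<in> G" using f by (simp add: G_def)
  moreover have "G \<subseteq> ?X"
  proof
    fix h assume h: "h \<in> G"
    then have hC: "h \<in> Ck1_maps k M A N B" by (simp add: G_def)
    have "uniformly_definite \<Q> (clarke_derivative U (inv_into V \<psi> \<circ> h \<circ> \<phi>) x)"
      if c: "(U, \<phi>) \<in> A" and d: "(V, \<psi>) \<in> B" and hU: "(h \<circ> \<phi>) ` U \<subseteq> \<psi> ` V" and x: "x \<in> U" for U \<phi> V \<psi> x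
    proof -
      \<comment> \<open>The charts here are arbitrary: \<open>\<phi> x\<close> is located in one of
        the selected half balls and the bound known there is carried over.\<close>
      have "\<phi> x \<in> topspace M"
        using x topological_chartD(3)[OF smooth_manifold_chart[OF M c]] openin_subset by blast
      then obtain i where i: "i \<in> I" "\<phi> x \<in> J i" using I(2) by blast
      obtain K U1 \<phi>1 V1 \<psi>1 \<epsilon> a r where ieq: "i = ((K, (U1, \<phi>1), (V1, \<psi>1), \<epsilon>), a, r)"
        by (metis prod.collapse)
      let ?d = "(K, (U1, \<phi>1), (V1, \<psi>1), \<epsilon>)"
      have ad: "(U1, \<phi>1) \<in> A" "(V1, \<psi>1) \<in> B" "K \<subseteq> U1"
        using I(1)[OF i(1)] by (auto simp: good_def ieq admissible_def)
      have hd: "h \<in> elementary_nbhd k M A N B f ?d"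
        using h i(1) unfolding G_def ieq by force
      then have hK: "(h \<circ> \<phi>1) ` K \<subseteq> \<psi>1 ` V1" by (simp add: elementary_nbhd_def)
      obtain R e where Re: "ball a r \<inter> half_space \<subseteq> K" "\<Q> R" "0 < e"
          "expanding_on R e (ball a r \<inter> half_space) (inv_into V1 \<psi>1 \<circ> h \<circ> \<phi>1)"
        using I(1)[OF i(1)] hd by (auto simp: good_def ieq)
      obtain x1 where x1: "x1 \<in> ball a r" "x1 \<in> half_space" "\<phi> x = \<phi>1 x1"
        using i(2) by (auto simp: J_def ieq)
      have "x1 \<in> U1" using x1 Re(1) ad(3) by blast
      moreover have "ball a r \<inter> half_space \<subseteq> U1" using Re(1) ad(3) by blast
      moreover have "(h \<circ> \<phi>1) ` (ball a r \<inter> half_space) \<subseteq> \<psi>1 ` V1" using hK Re(1) by blast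
      ultimately obtain P P' Q Q' where "Q ** Q' = mat 1" "P' ** P = mat 1"
          "\<And>v w D. (v, w) \<in> R \<Longrightarrow> D \<in> clarke_derivative U (inv_into V \<psi> \<circ> h \<circ> \<phi>) x \<Longrightarrow>
             e \<le> w \<bullet> ((P ** D ** Q) *v v)"
        using clarke_derivative_change_charts[OF M N hC c ad(1) d ad(2) hU x _ x1(3) x1(1) _ _ Re(4)] by metis
      from transform[OF Re(2,3) this] show ?thesis .
    qed
    then show "h \<in> ?X" using hC by blast
  qed
  ultimately show "\<exists>T. openin (strong_topology k M A N B) T \<and> f \<in> T \<and> T \<subseteq> ?X" by blast
qed

lemma convex_clarke_derivative: "convex (clarke_derivative U f x)"
  unfolding clarke_derivative_def by (rule convex_convex_hull)

theorem propositionA12: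
  fixes M :: "'a topology" and A :: "('m::{finite,linorder}, 'a) chart set"
    and N :: "'b topology" and B :: "('n::{finite,linorder}, 'b) chart set"
    and k :: nat
  assumes "smooth_manifold M A" and "smooth_manifold N B"
  shows "openin (strong_topology k M A N B) (Sub_maps k M A N B) \<and>
         openin (strong_topology k M A N B) (Imm_maps k M A N B)"
proof
  show "openin (strong_topology k M A N B) (Sub_maps k M A N B)"
    unfolding Sub_maps_def submersive_iff_uniformly_definite[OF convex_clarke_derivative]
    by (intro openin_uniformly_definite_maps[OF assms] uniformly_definite_transform_submersive)
       (auto simp: covers_codomain_def)
  show "openin (strong_topology k M A N B) (Imm_maps k M A N B)"
    unfolding Imm_maps_def immersive_iff_uniformly_definite[OF convex_clarke_derivative]
    by (intro openin_uniformly_definite_maps[OF assms] uniformly_definite_transform_immersive)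
       (auto simp: covers_domain_def)
qed

end
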